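(* Let $T$ be Noetherian with respect to $\mathcal F$. The following are equivalent: (a) $T$ has Noetherian isolation; (b) for every formula $\theta(x,a)$ with parameters in a model of $T$, $\mathrm{RM}\,\theta(x,a)=\mathrm R_{\mathcal F}\,\theta(x,a)$; (c) for every consistent formula $\theta(x,a)$ with parameters in a model of $T$, $\mathrm{RM}\bigl(\overline{\theta(x,a)}\wedge\neg\theta(x,a)\bigr)<\mathrm{RM}\,\theta(x,a)$.
   Context: $\mathcal F$ is a collection of partitioned formulae closed under renaming of variables and finite conjunctions and containing $\top$. A collection $\mathcal C$ of subsets of a set is Noetherian if it contains the whole set, is closed under finite intersections and has the descending chain condition; $\mathcal F$ is Noetherian if for every model $N$ of $T$ and tuple $x$, $\mathcal C_N=\{\phi(N,b):\phi(x,y)\in\mathcal F,b\in N\}$ is Noetherian. $T$ is Noetherian with respect to $\mathcal F$ if $\mathcal F$ is Noetherian and every partitioned formula is equivalent modulo $T$ to a Boolean combination of formulae of $\mathcal F$ in the same partition. A formula with parameters is closed if it defines a set of the form $\phi(N,b)$ with $\phi\in\mathcal F$; the finite unions of such sets are the closed sets of a topology, and $\overline{\theta(x,a)}$ denotes the formula defining the topological closure of $\theta(x,a)$ (which is closed and definable over $a$). Rank $\mathrm R_{\mathcal C}$: on irreducible closed sets it is the foundational rank with respect to inclusion among irreducible closed sets; on closed sets the maximum over irreducible components ($-\infty$ for $\emptyset$); on arbitrary sets the rank of the closure. $\mathrm R_{\mathcal F}\,\theta(x,a)$ is the $\mathrm R_{\mathcal C_N}$-rank of $\theta(N,a)$ in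 an $\aleph_0$-saturated elementary extension $N$ of the ambient model. $\mathrm{RM}$ is Morley rank. $T$ has Noetherian isolation if every type $p$ over a subset $A$ of a model of $T$ contains a closed formula with parameters in $A$ which isolates $p$ among all types over $A$ of Morley rank at least $\mathrm{RM}(p)$.
   Formalization: In Noetherian isolation, "closed formula" is taken to define a finite union of sets φ(N,b) with φ in F (a closed set of the topology), not a single such set; with single sets (b) does not imply (a), e.g. an infinite set with a predicate for two points and F generated by equality and ¬P. *)

theory Defs
  imports "HOL-Library.FuncSet" "HOL-Library.Extended"
begin

unbundle cardinal_syntax

section \<open>Ordinals and ordinal-valued ranks\<close>

text \<open>
  The elements of \<open>'a ordinal\<close> are the order types of the well-orders on subsets of \<open>'a\<close>, that is,
  the ordinals of cardinality at most that of \<open>'a\<close>. A rank on at most \<open>|'a|\<close> many objects takes an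
  initial segment of the ordinals as its values, so if \<open>'a\<close> is infinite then no rank of a formula
  with parameters in a structure on a subset of \<open>'a\<close> (in a language with at most \<open>|'a|\<close> formulae)
  is cut off by this bound.
\<close>

quotient_type 'a ordinal = "'a rel" / partial: "\<lambda>r s. r =o s"
proof (rule part_equivpI)
  have "Well_order ({} :: 'a rel)" by simp
  then show "\<exists>r :: 'a rel. r =o r" using ordIso_reflexive by blast
  show "symp (\<lambda>r s :: 'a rel. r =o s)" by (simp add: sympI ordIso_symmetric)
  show "transp (\<lambda>r s :: 'a rel. r =o s)" by (meson transpI ordIso_transitive)
qed

instantiation ordinal :: (type) "{linorder, zero}"
begin

lift_definition zero_ordinal :: "'a ordinal" is "{}"
  by (simp add: ordIso_reflexive)

lift_definition less_eq_ordinal :: "'a ordinal \<Rightarrow> 'a ordinal \<Rightarrow> bool" is "\<lambda>r s. r \<le>o s"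
  by (meson ordIso_ordLeq_trans ordIso_symmetric ordLeq_ordIso_trans)

definition less_ordinal :: "'a ordinal \<Rightarrow> 'a ordinal \<Rightarrow> bool" where
  "less_ordinal \<alpha> \<beta> \<longleftrightarrow> \<alpha> \<le> \<beta> \<and> \<not> \<beta> \<le> \<alpha>"

instance
proof
  fix \<alpha> \<beta> \<gamma> :: "'a ordinal"
  show "(\<alpha> < \<beta>) = (\<alpha> \<le> \<beta> \<and> \<not> \<beta> \<le> \<alpha>)" by (rule less_ordinal_def)
  show "\<alpha> \<le> \<alpha>" by transfer (simp add: ordIso_iff_ordLeq)
  show "\<alpha> \<le> \<gamma>" if "\<alpha> \<le> \<beta>" "\<beta> \<le> \<gamma>" using that by transfer (rule ordLeq_transitive)
  show "\<alpha> = \<beta>" if "\<alpha> \<le> \<beta>" "\<beta> \<le> \<alpha>" using that by transfer (simp add: ordIso_iff_ordLeq)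
  show "\<alpha> \<le> \<beta> \<or> \<beta> \<le> \<alpha>"
    by transfer (auto simp: ordIso_def dest: ordLeq_total)
qed

end

lemma less_ordinal_rep:
  "\<alpha> < \<beta> \<Longrightarrow> rep_ordinal \<alpha> <o rep_ordinal \<beta>"
proof -
  assume "\<alpha> < \<beta>"
  have wo: "Well_order (rep_ordinal \<gamma>)" for \<gamma> :: "'a ordinal"
    using Quotient_rep_reflp[OF Quotient_ordinal, of \<gamma>] by (auto simp: ordIso_def)
  from \<open>\<alpha> < \<beta>\<close> have "\<not> \<beta> \<le> \<alpha>" by simp
  then have "\<not> rep_ordinal \<beta> \<le>o rep_ordinal \<alpha>"
    by (simp add: less_eq_ordinal.rep_eq)
  then show ?thesis using wo not_ordLeq_iff_ordLess by blast
qed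

instance ordinal :: (type) wellorder
proof
  fix P :: "'a ordinal \<Rightarrow> bool" and \<alpha>
  assume step: "\<And>\<alpha>. (\<And>\<beta>. \<beta> < \<alpha> \<Longrightarrow> P \<beta>) \<Longrightarrow> P \<alpha>"
  have "wf (inv_image (ordLess :: ('a rel \<times> 'a rel) set) rep_ordinal)"
    by (rule wf_inv_image[OF wf_ordLess])
  then have "wf {(\<alpha>, \<beta> :: 'a ordinal). \<alpha> < \<beta>}"
    by (rule wf_subset) (auto simp: inv_image_def less_ordinal_rep)
  then show "P \<alpha>" by (induction \<alpha> rule: wf_induct_rule) (auto intro: step)
qed

definition osucc :: "'a ordinal \<Rightarrow> 'a ordinal" where
  "osucc \<alpha> = (LEAST \<beta>. \<alpha> < \<beta>)"

definition olimit :: "'a ordinal \<Rightarrow> bool" where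
  "olimit \<alpha> \<longleftrightarrow> \<alpha> \<noteq> 0 \<and> (\<forall>\<beta>. \<alpha> \<noteq> osucc \<beta>)"

text \<open>\<open>rank_of P\<close> is the rank of an object for which \<open>P \<alpha>\<close> means ``the rank is at least \<open>\<alpha>\<close>''.\<close>

definition rank_of :: "('a ordinal \<Rightarrow> bool) \<Rightarrow> 'a ordinal extended" where
  "rank_of P = (if \<not> P 0 then Minf else if \<forall>\<alpha>. P \<alpha> then Pinf else Fin (GREATEST \<alpha>. P \<alpha>))"


section \<open>Noetherian families of sets\<close>

definition noetherian_family :: "'b set \<Rightarrow> 'b set set \<Rightarrow> bool" where
  "noetherian_family \<Omega> C \<longleftrightarrow>
     C \<subseteq> Pow \<Omega> \<and> \<Omega> \<in> C \<and> (\<forall>A\<in>C. \<forall>B\<in>C. A \<inter> B \<in> C) \<and>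
     \<not> (\<exists>S :: nat \<Rightarrow> 'b set. \<forall>i. S i \<in> C \<and> S (Suc i) \<subset> S i)"

definition closed_sets :: "'b set set \<Rightarrow> 'b set set" where
  "closed_sets C = {\<Union>S |S. finite S \<and> S \<subseteq> C}"

definition top_closure :: "'b set set \<Rightarrow> 'b set \<Rightarrow> 'b set" where
  "top_closure C S = \<Inter>{Z \<in> closed_sets C. S \<subseteq> Z}"

definition irreducible_closed :: "'b set set \<Rightarrow> 'b set \<Rightarrow> bool" where
  "irreducible_closed C Z \<longleftrightarrow> Z \<in> closed_sets C \<and> Z \<noteq> {} \<and>
     (\<forall>A\<in>closed_sets C. \<forall>B\<in>closed_sets C. Z = A \<union> B \<longrightarrow> Z = A \<or> Z = B)"

definition irr_components :: "'b set set \<Rightarrow> 'b set \<Rightarrow> 'b set set" where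
  "irr_components C Z = {X. irreducible_closed C X \<and> X \<subseteq> Z \<and>
     (\<forall>X'. irreducible_closed C X' \<and> X \<subseteq> X' \<and> X' \<subseteq> Z \<longrightarrow> X' = X)}"

inductive foundation_rank_ge :: "'b set set \<Rightarrow> 'a ordinal \<Rightarrow> 'b set \<Rightarrow> bool" for C where
  zero: "irreducible_closed C X \<Longrightarrow> foundation_rank_ge C 0 X"
| succ: "irreducible_closed C X \<Longrightarrow> Y \<subset> X \<Longrightarrow> foundation_rank_ge C \<alpha> Y
    \<Longrightarrow> foundation_rank_ge C (osucc \<alpha>) X"
| limit: "irreducible_closed C X \<Longrightarrow> olimit \<alpha> \<Longrightarrow> (\<And>\<beta>. \<beta> < \<alpha> \<Longrightarrow> foundation_rank_ge C \<beta> X)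
    \<Longrightarrow> foundation_rank_ge C \<alpha> X"

definition rank_irreducible :: "'b set set \<Rightarrow> 'b set \<Rightarrow> 'a ordinal extended" where
  "rank_irreducible C X = rank_of (\<lambda>\<alpha>. foundation_rank_ge C \<alpha> X)"

definition rank_closed :: "'b set set \<Rightarrow> 'b set \<Rightarrow> 'a ordinal extended" where
  "rank_closed C Z = (if Z = {} then Minf else Max (rank_irreducible C ` irr_components C Z))"

definition rank_C :: "'b set set \<Rightarrow> 'b set \<Rightarrow> 'a ordinal extended" where
  "rank_C C S = rank_closed C (top_closure C S)"


section \<open>First-order logic\<close>

datatype 'f tm = Var nat | Fn 'f "'f tm list"

datatype ('f, 'r) fm =
    Fls
  | Eq "'f tm" "'f tm"
  | Rel 'r "'f tm list"
  | Neg "('f, 'r) fm"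
  | Conj "('f, 'r) fm" "('f, 'r) fm"
  | Ex nat "('f, 'r) fm"

abbreviation Tru :: "('f, 'r) fm" where "Tru \<equiv> Neg Fls"

text \<open>A language is given by its function and relation symbols together with their arities.\<close>

record ('f, 'r) lang =
  funs :: "('f \<times> nat) set"
  rels :: "('r \<times> nat) set"

fun wf_tm :: "('f, 'r) lang \<Rightarrow> 'f tm \<Rightarrow> bool" where
  "wf_tm L (Var i) \<longleftrightarrow> True"
| "wf_tm L (Fn f ts) \<longleftrightarrow> (f, length ts) \<in> funs L \<and> (\<forall>t\<in>set ts. wf_tm L t)"

fun wf_fm :: "('f, 'r) lang \<Rightarrow> ('f, 'r) fm \<Rightarrow> bool" where
  "wf_fm L Fls \<longleftrightarrow> True"
| "wf_fm L (Eq s t) \<longleftrightarrow> wf_tm L s \<and> wf_tm L t"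
| "wf_fm L (Rel r ts) \<longleftrightarrow> (r, length ts) \<in> rels L \<and> (\<forall>t\<in>set ts. wf_tm L t)"
| "wf_fm L (Neg \<phi>) \<longleftrightarrow> wf_fm L \<phi>"
| "wf_fm L (Conj \<phi> \<psi>) \<longleftrightarrow> wf_fm L \<phi> \<and> wf_fm L \<psi>"
| "wf_fm L (Ex i \<phi>) \<longleftrightarrow> wf_fm L \<phi>"

fun fv_tm :: "'f tm \<Rightarrow> nat set" where
  "fv_tm (Var i) = {i}"
| "fv_tm (Fn f ts) = (\<Union>t\<in>set ts. fv_tm t)"

fun fv :: "('f, 'r) fm \<Rightarrow> nat set" where
  "fv Fls = {}"
| "fv (Eq s t) = fv_tm s \<union> fv_tm t"
| "fv (Rel r ts) = (\<Union>t\<in>set ts. fv_tm t)"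
| "fv (Neg \<phi>) = fv \<phi>"
| "fv (Conj \<phi> \<psi>) = fv \<phi> \<union> fv \<psi>"
| "fv (Ex i \<phi>) = fv \<phi> - {i}"

fun rename_tm :: "(nat \<Rightarrow> nat) \<Rightarrow> 'f tm \<Rightarrow> 'f tm" where
  "rename_tm \<sigma> (Var i) = Var (\<sigma> i)"
| "rename_tm \<sigma> (Fn f ts) = Fn f (map (rename_tm \<sigma>) ts)"

text \<open>Bound variables are renamed as well; for a bijection \<open>\<sigma>\<close> there is no capture.\<close>

fun rename :: "(nat \<Rightarrow> nat) \<Rightarrow> ('f, 'r) fm \<Rightarrow> ('f, 'r) fm" where
  "rename \<sigma> Fls = Fls"
| "rename \<sigma> (Eq s t) = Eq (rename_tm \<sigma> s) (rename_tm \<sigma> t)"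
| "rename \<sigma> (Rel r ts) = Rel r (map (rename_tm \<sigma>) ts)"
| "rename \<sigma> (Neg \<phi>) = Neg (rename \<sigma> \<phi>)"
| "rename \<sigma> (Conj \<phi> \<psi>) = Conj (rename \<sigma> \<phi>) (rename \<sigma> \<psi>)"
| "rename \<sigma> (Ex i \<phi>) = Ex (\<sigma> i) (rename \<sigma> \<phi>)"

record ('f, 'r, 'u) struc =
  univ_of :: "'u set"
  fn :: "'f \<Rightarrow> 'u list \<Rightarrow> 'u"
  rl :: "'r \<Rightarrow> 'u list \<Rightarrow> bool"

definition is_structure :: "('f, 'r) lang \<Rightarrow> ('f, 'r, 'u) struc \<Rightarrow> bool" where
  "is_structure L M \<longleftrightarrow> univ_of M \<noteq> {} \<and>
     (\<forall>(f, n)\<in>funs L. \<forall>ds. length ds = n \<and> set ds \<subseteq> univ_of M \<longrightarrow> fn M f ds \<in> univ_of M)"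

fun val :: "('f, 'r, 'u) struc \<Rightarrow> (nat \<Rightarrow> 'u) \<Rightarrow> 'f tm \<Rightarrow> 'u" where
  "val M s (Var i) = s i"
| "val M s (Fn f ts) = fn M f (map (val M s) ts)"

fun sat :: "('f, 'r, 'u) struc \<Rightarrow> (nat \<Rightarrow> 'u) \<Rightarrow> ('f, 'r) fm \<Rightarrow> bool" where
  "sat M s Fls \<longleftrightarrow> False"
| "sat M s (Eq t t') \<longleftrightarrow> val M s t = val M s t'"
| "sat M s (Rel r ts) \<longleftrightarrow> rl M r (map (val M s) ts)"
| "sat M s (Neg \<phi>) \<longleftrightarrow> \<not> sat M s \<phi>"
| "sat M s (Conj \<phi> \<psi>) \<longleftrightarrow> sat M s \<phi> \<and> sat M s \<psi>"
| "sat M s (Ex i \<phi>) \<longleftrightarrow> (\<exists>d\<in>univ_of M. sat M (s(i := d)) \<phi>)"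

definition is_theory :: "('f, 'r) lang \<Rightarrow> ('f, 'r) fm set \<Rightarrow> bool" where
  "is_theory L T \<longleftrightarrow> (\<forall>\<phi>\<in>T. wf_fm L \<phi> \<and> fv \<phi> = {})"

definition is_model :: "('f, 'r) lang \<Rightarrow> ('f, 'r) fm set \<Rightarrow> ('f, 'r, 'u) struc \<Rightarrow> bool" where
  "is_model L T M \<longleftrightarrow> is_structure L M \<and> (\<forall>\<phi>\<in>T. \<forall>s. range s \<subseteq> univ_of M \<longrightarrow> sat M s \<phi>)"


section \<open>Formulae with parameters, types and saturation\<close>

text \<open>
  A tuple \<open>x\<close> of variables is a finite set \<open>X\<close> of variables, and the points of \<open>M\<^sup>x\<close> are the elements
  of \<open>X \<rightarrow>\<^sub>E univ_of M\<close>. A formula \<open>\<theta>(x,a)\<close> with parameters is a pair \<open>(\<theta>, a)\<close>, where \<open>a\<close> assigns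
  parameters to the free variables of \<open>\<theta>\<close> outside \<open>X\<close>; the other values of \<open>a\<close> are irrelevant.
\<close>

definition points :: "('f, 'r, 'u) struc \<Rightarrow> nat set \<Rightarrow> (nat \<Rightarrow> 'u) set" where
  "points M X = X \<rightarrow>\<^sub>E univ_of M"

type_synonym ('f, 'r, 'u) pform = "('f, 'r) fm \<times> (nat \<Rightarrow> 'u)"

definition pforms :: "('f, 'r) lang \<Rightarrow> nat set \<Rightarrow> 'u set \<Rightarrow> ('f, 'r, 'u) pform set" where
  "pforms L X A = {(\<theta>, a). wf_fm L \<theta> \<and> a ` (fv \<theta> - X) \<subseteq> A}"

definition sols :: "('f, 'r, 'u) struc \<Rightarrow> nat set \<Rightarrow> ('f, 'r, 'u) pform \<Rightarrow> (nat \<Rightarrow> 'u) set" where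
  "sols M X = (\<lambda>(\<theta>, a). {c \<in> points M X. sat M (override_on a c X) \<theta>})"

definition types :: "('f, 'r) lang \<Rightarrow> ('f, 'r, 'u) struc \<Rightarrow> nat set \<Rightarrow> 'u set \<Rightarrow>
    ('f, 'r, 'u) pform set set" where
  "types L M X A = {p. p \<subseteq> pforms L X A \<and>
     (\<forall>\<Gamma>\<subseteq>p. finite \<Gamma> \<longrightarrow> (\<exists>c\<in>points M X. \<forall>\<chi>\<in>\<Gamma>. c \<in> sols M X \<chi>)) \<and>
     (\<forall>(\<theta>, a)\<in>pforms L X A. (\<theta>, a) \<in> p \<or> (Neg \<theta>, a) \<in> p)}"

definition aleph0_saturated :: "('f, 'r) lang \<Rightarrow> ('f, 'r, 'u) struc \<Rightarrow> bool" where
  "aleph0_saturated L N \<longleftrightarrow> (\<forall>X A. finite X \<and> finite A \<and> A \<subseteq> univ_of N \<longrightarrow>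
     (\<forall>p\<in>types L N X A. \<exists>c\<in>points N X. \<forall>\<chi>\<in>p. c \<in> sols N X \<chi>))"

definition elementary_embedding :: "('f, 'r) lang \<Rightarrow> ('f, 'r, 'u) struc \<Rightarrow> ('f, 'r, 'u) struc \<Rightarrow>
    ('u \<Rightarrow> 'u) \<Rightarrow> bool" where
  "elementary_embedding L M N h \<longleftrightarrow> h ` univ_of M \<subseteq> univ_of N \<and>
     (\<forall>\<phi> s. wf_fm L \<phi> \<and> range s \<subseteq> univ_of M \<longrightarrow> sat M s \<phi> = sat N (h \<circ> s) \<phi>)"

text \<open>
  Elementary extensions are taken up to isomorphism, since the universe of \<open>M\<close> may exhaust \<open>'u\<close>:
  the extension is a structure \<open>N\<close> with an elementary embedding \<open>h\<close> of \<open>M\<close>, and \<open>\<theta>(x,a)\<close> becomes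
  \<open>\<theta>(x,h(a))\<close>. The ranks below do not depend on the choice of \<open>(N, h)\<close>.
\<close>

definition saturated_ext :: "('f, 'r) lang \<Rightarrow> ('f, 'r, 'u) struc \<Rightarrow>
    ('f, 'r, 'u) struc \<times> ('u \<Rightarrow> 'u)" where
  "saturated_ext L M = (SOME (N, h).
     is_structure L N \<and> aleph0_saturated L N \<and> elementary_embedding L M N h)"

inductive morley_ge :: "('f, 'r) lang \<Rightarrow> ('f, 'r, 'u) struc \<Rightarrow> nat set \<Rightarrow>
    'u ordinal \<Rightarrow> ('f, 'r, 'u) pform \<Rightarrow> bool" for L N X where
  zero: "sols N X \<chi> \<noteq> {} \<Longrightarrow> morley_ge L N X 0 \<chi>"
| succ: "(\<And>i::nat. \<psi> i \<in> pforms L X (univ_of N)) \<Longrightarrow> (\<And>i. sols N X (\<psi> i) \<subseteq> sols N X \<chi>)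
    \<Longrightarrow> (\<And>i j. i \<noteq> j \<Longrightarrow> sols N X (\<psi> i) \<inter> sols N X (\<psi> j) = {})
    \<Longrightarrow> (\<And>i. morley_ge L N X \<alpha> (\<psi> i)) \<Longrightarrow> morley_ge L N X (osucc \<alpha>) \<chi>"
| limit: "olimit \<alpha> \<Longrightarrow> (\<And>\<beta>. \<beta> < \<alpha> \<Longrightarrow> morley_ge L N X \<beta> \<chi>) \<Longrightarrow> morley_ge L N X \<alpha> \<chi>"

definition RM :: "('f, 'r) lang \<Rightarrow> ('f, 'r, 'u) struc \<Rightarrow> nat set \<Rightarrow>
    ('f, 'r, 'u) pform \<Rightarrow> 'u ordinal extended" where
  "RM L M X = (\<lambda>(\<theta>, a). case saturated_ext L M of (N, h) \<Rightarrow>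
     rank_of (\<lambda>\<alpha>. morley_ge L N X \<alpha> (\<theta>, h \<circ> a)))"

definition RM_type :: "('f, 'r) lang \<Rightarrow> ('f, 'r, 'u) struc \<Rightarrow> nat set \<Rightarrow>
    ('f, 'r, 'u) pform set \<Rightarrow> 'u ordinal extended" where
  "RM_type L M X p = (LEAST r. \<exists>\<chi>\<in>p. r = RM L M X \<chi>)"


section \<open>Noetherian theories\<close>

text \<open>The triple \<open>(\<phi>, X, Y)\<close> is the partitioned formula \<open>\<phi>(x,y)\<close>.\<close>

type_synonym ('f, 'r) partfm = "('f, 'r) fm \<times> nat set \<times> nat set"

definition partitioned :: "('f, 'r) lang \<Rightarrow> ('f, 'r) partfm \<Rightarrow> bool" where
  "partitioned L = (\<lambda>(\<phi>, X, Y). wf_fm L \<phi> \<and> finite X \<and> finite Y \<and> X \<inter> Y = {} \<and> fv \<phi> \<subseteq> X \<union> Y)"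

definition formula_collection :: "('f, 'r) lang \<Rightarrow> ('f, 'r) partfm set \<Rightarrow> bool" where
  "formula_collection L F \<longleftrightarrow>
     (\<forall>\<Phi>\<in>F. partitioned L \<Phi>) \<and>
     (\<forall>\<phi> X Y \<sigma>. (\<phi>, X, Y) \<in> F \<and> bij \<sigma> \<longrightarrow> (rename \<sigma> \<phi>, \<sigma> ` X, \<sigma> ` Y) \<in> F) \<and>
     (\<forall>\<phi> \<psi> X Y Y'. (\<phi>, X, Y) \<in> F \<and> (\<psi>, X, Y') \<in> F \<longrightarrow> (Conj \<phi> \<psi>, X, Y \<union> Y') \<in> F) \<and>
     (\<forall>X Y. finite X \<and> finite Y \<and> X \<inter> Y = {} \<longrightarrow> (Tru, X, Y) \<in> F)"

definition instances :: "('f, 'r) partfm set \<Rightarrow> ('f, 'r, 'u) struc \<Rightarrow> nat set \<Rightarrow>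
    (nat \<Rightarrow> 'u) set set" where
  "instances F N X = {sols N X (\<phi>, b) |\<phi> Y b. (\<phi>, X, Y) \<in> F \<and> b ` Y \<subseteq> univ_of N}"

inductive_set bool_comb :: "('f, 'r) fm set \<Rightarrow> ('f, 'r) fm set" for G where
  base: "\<phi> \<in> G \<Longrightarrow> \<phi> \<in> bool_comb G"
| neg: "\<phi> \<in> bool_comb G \<Longrightarrow> Neg \<phi> \<in> bool_comb G"
| conj: "\<phi> \<in> bool_comb G \<Longrightarrow> \<psi> \<in> bool_comb G \<Longrightarrow> Conj \<phi> \<psi> \<in> bool_comb G"

text \<open>
  In the remaining definitions the models of \<open>T\<close> are those whose universe is a subset of the type
  \<open>'u\<close>. If \<open>'u\<close> has at least as many elements as the language has formulae, then every model of \<open>T\<close>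
  of cardinality at most \<open>|'u|\<close> is among them up to isomorphism, so that equivalence modulo \<open>T\<close> and
  the descending chain condition have their usual meaning by the Loewenheim-Skolem theorem.
\<close>

definition equiv_mod :: "'u itself \<Rightarrow> ('f, 'r) lang \<Rightarrow> ('f, 'r) fm set \<Rightarrow>
    ('f, 'r) fm \<Rightarrow> ('f, 'r) fm \<Rightarrow> bool" where
  "equiv_mod (_ :: 'u itself) L T \<phi> \<psi> \<longleftrightarrow>
     (\<forall>(M :: ('f, 'r, 'u) struc) s.
        is_model L T M \<and> range s \<subseteq> univ_of M \<longrightarrow> sat M s \<phi> = sat M s \<psi>)"

definition noetherian_collection :: "'u itself \<Rightarrow> ('f, 'r) lang \<Rightarrow> ('f, 'r) fm set \<Rightarrow>
    ('f, 'r) partfm set \<Rightarrow> bool" where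
  "noetherian_collection (_ :: 'u itself) L T F \<longleftrightarrow>
     (\<forall>(N :: ('f, 'r, 'u) struc) X. is_model L T N \<and> finite X \<longrightarrow>
        noetherian_family (points N X) (instances F N X))"

definition noetherian_theory :: "'u itself \<Rightarrow> ('f, 'r) lang \<Rightarrow> ('f, 'r) fm set \<Rightarrow>
    ('f, 'r) partfm set \<Rightarrow> bool" where
  "noetherian_theory (u :: 'u itself) L T F \<longleftrightarrow>
     noetherian_collection u L T F \<and>
     (\<forall>\<phi> X Y. partitioned L (\<phi>, X, Y) \<longrightarrow>
        (\<exists>\<psi>\<in>bool_comb {\<psi>. (\<psi>, X, Y) \<in> F}. equiv_mod u L T \<phi> \<psi>))"

text \<open>
  ``Closed'' refers to the topology, i.e. to finite unions of instances, as it must for the closure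
  of a formula to be closed. With single instances only, there would be too few closed formulae over
  \<open>A\<close>: take an infinite set with a predicate \<open>P\<close> for two of its elements and let the collection be
  generated by equality and \<open>\<not> P\<close>; Morley rank and the rank of the collection agree, but the only
  instance that is definable over the empty set and contains the elements of \<open>P\<close> is the whole set.
\<close>

definition closed_formula :: "('f, 'r) partfm set \<Rightarrow> ('f, 'r, 'u) struc \<Rightarrow> nat set \<Rightarrow>
    ('f, 'r, 'u) pform \<Rightarrow> bool" where
  "closed_formula F M X \<chi> \<longleftrightarrow> sols M X \<chi> \<in> closed_sets (instances F M X)"

definition closure_formula :: "('f, 'r) lang \<Rightarrow> ('f, 'r) partfm set \<Rightarrow> ('f, 'r, 'u) struc \<Rightarrow>
    nat set \<Rightarrow> ('f, 'r) fm \<Rightarrow> (nat \<Rightarrow> 'u) \<Rightarrow> ('f, 'r) fm" where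
  "closure_formula L F M X \<theta> a = (SOME \<chi>. wf_fm L \<chi> \<and> fv \<chi> \<subseteq> X \<union> fv \<theta> \<and>
     sols M X (\<chi>, a) = top_closure (instances F M X) (sols M X (\<theta>, a)))"

definition R_F :: "('f, 'r) lang \<Rightarrow> ('f, 'r) partfm set \<Rightarrow> ('f, 'r, 'u) struc \<Rightarrow> nat set \<Rightarrow>
    ('f, 'r, 'u) pform \<Rightarrow> 'u ordinal extended" where
  "R_F L F M X = (\<lambda>(\<theta>, a). case saturated_ext L M of (N, h) \<Rightarrow>
     rank_C (instances F N X) (sols N X (\<theta>, h \<circ> a)))"

definition noetherian_isolation :: "'u itself \<Rightarrow> ('f, 'r) lang \<Rightarrow> ('f, 'r) fm set \<Rightarrow>
    ('f, 'r) partfm set \<Rightarrow> bool" where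
  "noetherian_isolation (_ :: 'u itself) L T F \<longleftrightarrow>
     (\<forall>(M :: ('f, 'r, 'u) struc) X A p.
        is_model L T M \<and> finite X \<and> A \<subseteq> univ_of M \<and> p \<in> types L M X A \<longrightarrow>
        (\<exists>\<chi>\<in>p. closed_formula F M X \<chi> \<and>
           (\<forall>q\<in>types L M X A. RM_type L M X p \<le> RM_type L M X q \<and> \<chi> \<in> q \<longrightarrow> q = p)))"

end

theory Submission
  imports Defs
begin

text \<open>
  In a fixed model Morley rank is the Cantor-Bendixson rank of the Boolean algebra of definable sets,
  and this is the algebra of constructible sets of a Noetherian topology. Of two disjoint
  constructible sets at most one is dense in a given irreducible set, so a disjoint family of subsets
  of an irreducible set drops to proper closed subsets with one exception; hence Morley rank is at
  most the foundation rank. For the converse let \<open>Y\<close> be a proper closed subset of an irreducible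
  set \<open>Z\<close>: then \<open>Y\<close> is the boundary of \<open>Z - Y\<close>, so (c) forces the Morley rank to grow along chains
  of irreducible sets. Conversely the boundary of a constructible set contains no component of its
  closure, so the foundation rank satisfies the inequality of (c).

  A type is determined by the least closed set that it contains. Therefore a model on a subset of
  \<open>'u\<close> has at most \<open>|'u|\<close> types, all of them are realised in a Skolem hull of cardinality at most
  \<open>|'u|\<close> in an ultrapower, and the union of a chain of such hulls is a saturated extension that still
  lives on \<open>'u\<close>. Back and forth between two saturated models shows that Morley rank does not depend
  on the choice of this extension.
\<close>

section \<open>Ordinals of bounded cardinality\<close>

text \<open>\<open>saturated_ext\<close> is a choice: without an extension on the type
  \<open>'u\<close> itself, both ranks would be computed in an arbitrary pair. This is why so much
  of the proof is model construction. The rank arguments are carried out for an abstract Noetherian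
  family and reach a model only through the coincidence of definable and constructible sets.
  Conditions (b) and (c) are stated for \<open>M\<close>, but the ranks live in the extension
  \<open>N\<close>. From (c) to (b) the remedy is to apply (c) to \<open>N\<close>, whose own ranks
  are computed in a further extension \<open>N'\<close>; this is the only place where invariance of
  Morley rank enters. From (b) to (c) the closure chosen in \<open>M\<close> must be recognised in
  \<open>N\<close>. The ordinals stop at the successor cardinal of the size of \<open>'u\<close>.
  The strict inequality in (c) would fail between two ranks \<open>Pinf\<close>, so no foundation
  rank may reach the end; regularity of the cardinal and the bound on the number of closed sets
  ensure this. Isolation holds over every set \<open>A\<close> because the least closed set is
  sought among the sets defined by formulae of the type, whatever parameters its instances
  use.\<close>

lemma rep_ordinal_Well_order: "Well_order (rep_ordinal \<alpha>)"
  using Quotient_rep_reflp[OF Quotient_ordinal, of \<alpha>] by (auto simp: ordIso_def)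

lemma ordinal_less_iff: "\<alpha> < \<beta> \<longleftrightarrow> rep_ordinal \<alpha> <o rep_ordinal \<beta>"
proof -
  have "\<alpha> < \<beta> \<longleftrightarrow> \<not> rep_ordinal \<beta> \<le>o rep_ordinal \<alpha>"
    by (simp add: less_eq_ordinal.rep_eq[symmetric] not_le)
  then show ?thesis using rep_ordinal_Well_order not_ordLeq_iff_ordLess by blast
qed

lemma rep_abs_ordinal: "Well_order r \<Longrightarrow> rep_ordinal (abs_ordinal r) =o r"
  by (rule Quotient_rep_abs[OF Quotient_ordinal ordIso_reflexive])

text \<open>Otherwise the successor cardinal would embed into \<open>r\<close>, and its field would
  be no larger than that of \<open>r\<close>.\<close>

lemma Well_order_ordLess_cardSuc:
  fixes r :: "'b rel"
  assumes "Well_order r" "|Field r| \<le>o |UNIV :: 'a set|"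
  shows "r <o cardSuc |UNIV :: 'a set|"
proof (rule ccontr)
  assume "\<not> ?thesis"
  then have "cardSuc |UNIV :: 'a set| \<le>o r"
    using assms(1) cardSuc_Well_order[OF card_of_Card_order] not_ordLess_iff_ordLeq by blast
  then have "|Field (cardSuc |UNIV :: 'a set| )| \<le>o |Field r|" by (rule card_of_mono2)
  moreover have "|Field (cardSuc |UNIV :: 'a set| )| =o cardSuc |UNIV :: 'a set|"
    by (simp add: cardSuc_Card_order card_of_Card_order card_of_Field_ordIso)
  ultimately have "cardSuc |UNIV :: 'a set| \<le>o |UNIV :: 'a set|"
    using assms(2) by (meson ordIso_ordLeq_trans ordIso_symmetric ordLeq_transitive)
  then show False
    using cardSuc_greater[OF card_of_Card_order] not_ordLess_ordLeq by blast
qed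

text \<open>The ordinals of \<open>'a ordinal\<close> are those below the successor cardinal of \<open>|'a|\<close>, which is regular.\<close>

lemma ordinals_bounded:
  fixes A :: "'a ordinal set"
  assumes inf: "infinite (UNIV :: 'a set)" and A: "|A| \<le>o |UNIV :: 'a set|"
  shows "\<exists>\<beta>. \<forall>\<alpha>\<in>A. \<alpha> < \<beta>"
proof -
  define k where "k = cardSuc |UNIV :: 'a set|"
  have ck: "Card_order k" unfolding k_def by (simp add: cardSuc_Card_order card_of_Card_order)
  then have wk: "Well_order k" by (simp add: card_order_on_def)
  have tr: "trans k" and an: "antisym k" 
    using wk by (simp_all add: well_order_on_def linear_order_on_def partial_order_on_def preorder_on_def)
  \<comment> \<open>Every ordinal of the type is isomorphic to a proper initial segment of
    \<open>k\<close>; \<open>f \<alpha>\<close> will be the element that cuts this segment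
    off.\<close>
  have "\<exists>b\<in>Field k. rep_ordinal \<alpha> =o Restr k (underS k b)" for \<alpha> :: "'a ordinal"
  proof -
    have "rep_ordinal \<alpha> <o k" unfolding k_def
      using Well_order_ordLess_cardSuc[OF rep_ordinal_Well_order card_of_mono1[OF subset_UNIV]] by blast
    then show ?thesis using ordLess_iff_ordIso_Restr[OF wk rep_ordinal_Well_order] by blast
  qed
  then obtain f where f: "\<And>\<alpha> :: 'a ordinal. f \<alpha> \<in> Field k"
    "\<And>\<alpha> :: 'a ordinal. rep_ordinal \<alpha> =o Restr k (underS k (f \<alpha>))" by metis
  have "|f ` A| \<le>o |UNIV :: 'a set|" using A card_of_image ordLeq_transitive by blast
  then have "|f ` A| <o k"
    unfolding k_def using cardSuc_greater[OF card_of_Card_order] ordLeq_ordLess_trans by blast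
  then have "\<not> |f ` A| =o k" using not_ordLess_ordIso by blast
  moreover have "regularCard k" unfolding k_def
    using infinite_cardSuc_regularCard[OF _ card_of_Card_order, of "UNIV :: 'a set"] inf by (simp add: Field_card_of)
  moreover have "f ` A \<subseteq> Field k" by (simp add: f(1) image_subsetI)
  ultimately have "\<not> cofinal (f ` A) k" unfolding regularCard_def by blast
  then obtain b where b: "b \<in> Field k" "\<And>\<alpha>. \<alpha> \<in> A \<Longrightarrow> \<not> (b \<noteq> f \<alpha> \<and> (b, f \<alpha>) \<in> k)"
    unfolding cofinal_def by blast
  have le: "(f \<alpha>, b) \<in> k" if "\<alpha> \<in> A" for \<alpha>
  proof -
    have "Total k" "Refl k"
      using wk by (simp_all add: well_order_on_def linear_order_on_def partial_order_on_def preorder_on_def)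
    then show ?thesis using b(2)[OF that] b(1) f(1)[of \<alpha>]
      by (cases "b = f \<alpha>") (auto simp: total_on_def refl_on_def)
  qed
  have "\<not> finite (Field k)"
    unfolding k_def using inf by (simp add: card_of_cardSuc_finite)
  \<comment> \<open>\<open>b\<close> bounds the image of \<open>f\<close> only weakly. Above a
    strictly larger \<open>c\<close> the segment is strictly longer than all those cut off by
    \<open>f \<alpha>\<close>.\<close>
  then obtain c where c: "c \<in> Field k" "b \<noteq> c" "(b, c) \<in> k"
    using infinite_Card_order_limit[OF ck _ b(1)] by blast
  have of_k: "wo_rel.ofilter k (underS k a)" for a
    by (simp add: wo_rel.underS_ofilter wo_rel_def wk)
  define s where "s = Restr k (underS k c)"
  have ws: "Well_order s" unfolding s_def using wk Well_order_Restr by blast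
  have "s <o k" unfolding s_def 
    using underS_Restr_ordLess[OF wk] c(1) by blast
  then have "|Field s| <o k"
    using card_of_least[OF ws] ordLeq_ordLess_trans by blast
  then have "|Field s| \<le>o |UNIV :: 'a set|"
    unfolding k_def using cardSuc_ordLeq_ordLess[OF card_of_Card_order card_of_Card_order] by blast
  \<comment> \<open>\<open>s\<close> is a relation on \<open>'a set\<close>. It has at most as many
    elements as \<open>'a\<close>, so it can be copied to \<open>'a\<close>, where it represents the
    bounding ordinal.\<close>
  then obtain g :: "_ \<Rightarrow> 'a" where g: "inj_on g (Field s)"
    using card_of_ordLeq[of "Field s" "UNIV :: 'a set"] by blast
  define t where "t = dir_image s g"
  have st: "s =o t" unfolding t_def by (rule dir_image_ordIso[OF ws g])
  have wt: "Well_order t" unfolding t_def by (rule Well_order_dir_image[OF ws g])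
  show ?thesis
  proof (intro exI ballI)
    fix \<alpha> assume "\<alpha> \<in> A"
    have mem: "f \<alpha> \<in> underS k c"
    proof -
      have "(f \<alpha>, c) \<in> k" using le[OF \<open>\<alpha> \<in> A\<close>] c(3) tr by (meson transD)
      moreover have "f \<alpha> \<noteq> c" using le[OF \<open>\<alpha> \<in> A\<close>] c(2,3) an by (metis antisymD)
      ultimately show ?thesis by (simp add: underS_def)
    qed
    have "underS k (f \<alpha>) \<subseteq> underS k c"
      by (rule underS_incr[OF tr an]) (use mem in \<open>simp add: underS_def\<close>)
    then have "underS k (f \<alpha>) \<subset> underS k c"
      using mem underS_notIn[of "f \<alpha>" k] by blast
    then have "Restr k (underS k (f \<alpha>)) <o s"
      unfolding s_def using ofilter_subset_ordLess[OF wk of_k of_k] by blast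
    then have "rep_ordinal \<alpha> <o t" using f(2)[of \<alpha>] st
      by (meson ordIso_ordLess_trans ordLess_ordIso_trans)
    then have "rep_ordinal \<alpha> <o rep_ordinal (abs_ordinal t)"
      using rep_abs_ordinal[OF wt] ordIso_symmetric ordLess_ordIso_trans by blast
    then show "\<alpha> < abs_ordinal t" by (simp add: ordinal_less_iff)
  qed
qed

lemma ordinal_zero_le: "0 \<le> (\<alpha> :: 'a ordinal)"
proof (rule ccontr)
  assume "\<not> 0 \<le> \<alpha>"
  then have "rep_ordinal \<alpha> <o rep_ordinal (0 :: 'a ordinal)" by (simp add: ordinal_less_iff[symmetric])
  moreover have "rep_ordinal (0 :: 'a ordinal) =o ({} :: 'a rel)"
    unfolding zero_ordinal_def by (rule rep_abs_ordinal) simp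
  ultimately have "rep_ordinal \<alpha> <o ({} :: 'a rel)" by (rule ordLess_ordIso_trans)
  then obtain p :: "'a rel" where "Field p < Field ({} :: 'a rel)"
    using internalize_ordLess[of "rep_ordinal \<alpha>" "{} :: 'a rel"] by blast
  then show False by simp
qed

lemma ordinal_greater_exists:
  assumes "infinite (UNIV :: 'a set)"
  shows "\<exists>\<beta>. (\<alpha> :: 'a ordinal) < \<beta>"
proof -
  have "|{\<alpha>}| \<le>o |UNIV :: 'a set|" by (simp add: card_of_singl_ordLeq)
  from ordinals_bounded[OF assms this] show ?thesis by blast
qed

lemma osucc_greater:
  assumes "infinite (UNIV :: 'a set)"
  shows "(\<alpha> :: 'a ordinal) < osucc \<alpha>"
proof -
  obtain \<beta> where "\<alpha> < \<beta>" using ordinal_greater_exists[OF assms] by blast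
  then show ?thesis unfolding osucc_def by (rule LeastI)
qed

lemma osucc_least: "\<alpha> < \<beta> \<Longrightarrow> osucc \<alpha> \<le> \<beta>"
  unfolding osucc_def by (rule Least_le)

lemma less_osucc_iff:
  assumes "infinite (UNIV :: 'a set)"
  shows "\<beta> < osucc \<alpha> \<longleftrightarrow> \<beta> \<le> (\<alpha> :: 'a ordinal)"
proof
  assume "\<beta> < osucc \<alpha>"
  then have "\<not> \<alpha> < \<beta>" using osucc_least[of \<alpha> \<beta>] by auto
  then show "\<beta> \<le> \<alpha>" by simp
next
  assume "\<beta> \<le> \<alpha>"
  then show "\<beta> < osucc \<alpha>" using osucc_greater[OF assms, of \<alpha>] by (rule le_less_trans)
qed

lemma osucc_inject:
  assumes "infinite (UNIV :: 'a set)" and eq: "osucc \<alpha> = osucc (\<beta> :: 'a ordinal)"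
  shows "\<alpha> = \<beta>"
proof (rule order_antisym)
  show "\<alpha> \<le> \<beta>" using less_osucc_iff[OF assms(1), of \<alpha> \<beta>] osucc_greater[OF assms(1), of \<alpha>] eq by simp
  show "\<beta> \<le> \<alpha>" using less_osucc_iff[OF assms(1), of \<beta> \<alpha>] osucc_greater[OF assms(1), of \<beta>] eq by simp
qed

lemma osucc_neq_0:
  assumes "infinite (UNIV :: 'a set)"
  shows "osucc \<alpha> \<noteq> (0 :: 'a ordinal)"
  using osucc_greater[OF assms, of \<alpha>] ordinal_zero_le[of \<alpha>] by auto

lemma ordinal_cases:
  obtains "\<alpha> = 0" | \<beta> where "\<alpha> = osucc \<beta>" | "olimit \<alpha>"
  unfolding olimit_def by blast

lemma not_olimit_osucc [simp]: "\<not> olimit (osucc \<alpha>)"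
  by (auto simp: olimit_def)

lemma not_olimit_0 [simp]: "\<not> olimit 0"
  by (auto simp: olimit_def)

text \<open>Over an infinite type such a predicate holds nowhere, everywhere, or exactly up to a
  largest ordinal. The second clause excludes a failure that begins at a limit, where
  \<open>GREATEST\<close> would have no value.\<close>

definition rank_predicate :: "('a ordinal \<Rightarrow> bool) \<Rightarrow> bool" where
  "rank_predicate P \<longleftrightarrow> (\<forall>\<alpha> \<beta>. \<alpha> \<le> \<beta> \<longrightarrow> P \<beta> \<longrightarrow> P \<alpha>) \<and>
     (\<forall>\<alpha>. olimit \<alpha> \<longrightarrow> (\<forall>\<beta><\<alpha>. P \<beta>) \<longrightarrow> P \<alpha>)"

text \<open>All later comparisons of ranks go through the ordinals below them, so the three cases of
  \<open>rank_of\<close> are treated here once.\<close>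

lemma Fin_le_rank_of:
  fixes P :: "'a ordinal \<Rightarrow> bool"
  assumes inf: "infinite (UNIV :: 'a set)" and P: "rank_predicate P"
  shows "Fin \<alpha> \<le> rank_of P \<longleftrightarrow> P \<alpha>"
proof -
  have down: "P \<alpha>" if "P \<beta>" "\<alpha> \<le> \<beta>" for \<alpha> \<beta>
    using P that unfolding rank_predicate_def by blast
  consider "\<not> P 0" | "\<forall>\<alpha>. P \<alpha>" | "P 0" "\<exists>\<alpha>. \<not> P \<alpha>" by blast
  then show ?thesis
  proof cases
    case 1
    then show ?thesis using down ordinal_zero_le by (auto simp: rank_of_def)
  next
    case 2
    then show ?thesis by (auto simp: rank_of_def)
  next
    case 3
    \<comment> \<open>The first failure of \<open>P\<close> is neither 0 nor a limit, hence a
      successor, and its predecessor is the greatest ordinal that satisfies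
      \<open>P\<close>.\<close>
    define \<gamma> where "\<gamma> = (LEAST \<alpha>. \<not> P \<alpha>)"
    have \<gamma>: "\<not> P \<gamma>" "\<And>\<beta>. \<beta> < \<gamma> \<Longrightarrow> P \<beta>"
      unfolding \<gamma>_def using 3(2) LeastI_ex[of "\<lambda>\<alpha>. \<not> P \<alpha>"] not_less_Least by blast+
    have "\<gamma> \<noteq> 0" using 3(1) \<gamma>(1) by blast
    moreover have "\<not> olimit \<gamma>" using P \<gamma> unfolding rank_predicate_def by blast
    ultimately obtain \<delta> where \<delta>: "\<gamma> = osucc \<delta>" using ordinal_cases by blast
    have P_iff: "P \<beta> \<longleftrightarrow> \<beta> \<le> \<delta>" for \<beta>
      using down \<gamma> \<delta> less_osucc_iff[OF inf] by (metis leI)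
    then have "(GREATEST \<alpha>. P \<alpha>) = \<delta>" by (intro Greatest_equality) auto
    then have "rank_of P = Fin \<delta>" using 3 unfolding rank_of_def by simp
    then show ?thesis by (simp add: P_iff)
  qed
qed

text \<open>If \<open>s < r\<close>, some \<open>Fin \<gamma>\<close> lies above \<open>s\<close>
  and not above \<open>r\<close>. When \<open>r\<close> is \<open>Pinf\<close> and \<open>s\<close>
  is an ordinal, this needs a larger ordinal, hence an infinite type.\<close>

lemma extended_leI:
  fixes r s :: "'a ordinal extended"
  assumes inf: "infinite (UNIV :: 'a set)" and le: "\<And>\<alpha>. Fin \<alpha> \<le> r \<Longrightarrow> Fin \<alpha> \<le> s"
  shows "r \<le> s"
proof (rule ccontr)
  assume "\<not> r \<le> s"
  then have "s < r" by simp
  then obtain \<gamma> where "s < Fin \<gamma>" "Fin \<gamma> \<le> r"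
  proof (cases s)
    case (Fin \<beta>)
    obtain \<gamma> where "\<beta> < \<gamma>" using ordinal_greater_exists[OF inf] by blast
    show ?thesis
    proof (cases r)
      case (Fin \<delta>)
      then show ?thesis using that[of \<delta>] \<open>s < r\<close> by simp
    next
      case Pinf
      then show ?thesis using that[of \<gamma>] \<open>\<beta> < \<gamma>\<close> Fin by simp
    next
      case Minf
      then show ?thesis using \<open>s < r\<close> by simp
    qed
  next
    case Pinf
    then show ?thesis using \<open>s < r\<close> by simp
  next
    case Minf
    then show ?thesis using \<open>s < r\<close> that[of 0] that by (cases r) auto
  qed
  then show False using le leD by blast
qed

text \<open>Applied to the ranks of the formulae in a type, this makes the \<open>LEAST\<close> in
  \<open>RM_type\<close> an attained minimum.\<close>

lemma extended_has_minimum: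
  fixes S :: "'a :: wellorder extended set"
  assumes "x0 \<in> S"
  shows "\<exists>m\<in>S. \<forall>x\<in>S. m \<le> x"
proof -
  consider "Minf \<in> S" | "S \<subseteq> {Pinf}" | \<alpha> where "Minf \<notin> S" "Fin \<alpha> \<in> S"
  proof (cases "Minf \<notin> S \<and> \<not> S \<subseteq> {Pinf}")
    case True
    then obtain x where "x \<in> S" "x \<noteq> Pinf" "x \<noteq> Minf" by blast
    then show ?thesis using that True by (cases x) auto
  qed (use that in blast)
  then show ?thesis
  proof cases
    case 1
    then show ?thesis by (intro bexI[of _ Minf]) auto
  next
    case 2
    then have "S = {Pinf}" using assms by blast
    then show ?thesis by simp
  next
    case 3
    define m where "m = (LEAST \<alpha>. Fin \<alpha> \<in> S)"
    have "Fin m \<in> S" unfolding m_def by (rule LeastI[of _ \<alpha>]) fact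
    moreover have "Fin m \<le> x" if "x \<in> S" for x
      using that 3(1) by (cases x) (auto simp: m_def intro: Least_le)
    ultimately show ?thesis by blast
  qed
qed

section \<open>Noetherian topologies\<close>

text \<open>The Boolean algebra generated by \<open>C\<close>, with complements relative to
  \<open>\<Omega>\<close>. The clauses match those of \<open>bool_comb\<close>, so a Boolean
  combination of formulae visibly defines a constructible set.\<close>

inductive_set constructible :: "'b set \<Rightarrow> 'b set set \<Rightarrow> 'b set set" for \<Omega> C where
  base: "S \<in> C \<Longrightarrow> S \<in> constructible \<Omega> C"
| compl: "S \<in> constructible \<Omega> C \<Longrightarrow> \<Omega> - S \<in> constructible \<Omega> C"
| inter: "S \<in> constructible \<Omega> C \<Longrightarrow> S' \<in> constructible \<Omega> C \<Longrightarrow> S \<inter> S' \<in> constructible \<Omega> C"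

locale noetherian_topology =
  fixes \<Omega> :: "'b set" and C :: "'b set set"
  assumes noetherian: "noetherian_family \<Omega> C"
begin

abbreviation closed :: "'b set \<Rightarrow> bool" where "closed Z \<equiv> Z \<in> closed_sets C"
abbreviation irreducible :: "'b set \<Rightarrow> bool" where "irreducible Z \<equiv> irreducible_closed C Z"
abbreviation cl :: "'b set \<Rightarrow> 'b set" where "cl S \<equiv> top_closure C S"
abbreviation B :: "'b set set" where "B \<equiv> constructible \<Omega> C"

lemma C_sub: "V \<in> C \<Longrightarrow> V \<subseteq> \<Omega>" and C_top: "\<Omega> \<in> C"
  and C_inter: "V \<in> C \<Longrightarrow> W \<in> C \<Longrightarrow> V \<inter> W \<in> C"
  using noetherian unfolding noetherian_family_def by auto

lemma C_wf: "wf {(V, W). V \<in> C \<and> W \<in> C \<and> V \<subset> W}"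
proof -
  have no_chain: "\<not> (\<exists>S :: nat \<Rightarrow> 'b set. \<forall>i. S i \<in> C \<and> S (Suc i) \<subset> S i)"
    using noetherian unfolding noetherian_family_def by simp
  have "\<not> (\<exists>S. \<forall>i. (S (Suc i), S i) \<in> {(V, W). V \<in> C \<and> W \<in> C \<and> V \<subset> W})"
  proof
    assume "\<exists>S. \<forall>i. (S (Suc i), S i) \<in> {(V, W). V \<in> C \<and> W \<in> C \<and> V \<subset> W}"
    then obtain S where "\<forall>i. (S (Suc i), S i) \<in> {(V, W). V \<in> C \<and> W \<in> C \<and> V \<subset> W}" ..
    then have "\<forall>i. S i \<in> C \<and> S (Suc i) \<subset> S i" by simp
    then show False using no_chain by blast
  qed
  then show ?thesis by (rule iffD2[OF wf_iff_no_infinite_down_chain])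
qed

lemma closed_base: "V \<in> C \<Longrightarrow> closed V"
  unfolding closed_sets_def by (intro CollectI exI[of _ "{V}"]) auto

lemma closed_empty: "closed {}"
  unfolding closed_sets_def by (intro CollectI exI[of _ "{}"]) auto

lemma closed_top: "closed \<Omega>"
  using C_top by (rule closed_base)

lemma closed_union: "closed Z \<Longrightarrow> closed Z' \<Longrightarrow> closed (Z \<union> Z')"
proof -
  assume "closed Z" "closed Z'"
  then obtain S S' where "Z = \<Union>S" "finite S" "S \<subseteq> C" "Z' = \<Union>S'" "finite S'" "S' \<subseteq> C"
    unfolding closed_sets_def by auto
  then show ?thesis unfolding closed_sets_def by (intro CollectI exI[of _ "S \<union> S'"]) auto
qed

lemma closed_Union: "finite S \<Longrightarrow> (\<And>Z. Z \<in> S \<Longrightarrow> closed Z) \<Longrightarrow> closed (\<Union>S)"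
  by (induction S rule: finite_induct) (auto intro: closed_empty closed_union)

lemma closed_inter: "closed Z \<Longrightarrow> closed Z' \<Longrightarrow> closed (Z \<inter> Z')"
proof -
  assume "closed Z" "closed Z'"
  then obtain S S' where *: "Z = \<Union>S" "finite S" "S \<subseteq> C" "Z' = \<Union>S'" "finite S'" "S' \<subseteq> C"
    unfolding closed_sets_def by auto
  let ?S = "(\<lambda>(V, V'). V \<inter> V') ` (S \<times> S')"
  have "Z \<inter> Z' = \<Union>?S" using * by auto
  moreover have "finite ?S" "?S \<subseteq> C" using * C_inter by auto
  ultimately show ?thesis unfolding closed_sets_def by blast
qed

lemma closed_sub: "closed Z \<Longrightarrow> Z \<subseteq> \<Omega>"
  unfolding closed_sets_def using C_sub by auto

lemma constructible_sub: "S \<in> B \<Longrightarrow> S \<subseteq> \<Omega>"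
  by (induction rule: constructible.induct) (use C_sub in auto)

lemma constructible_top: "\<Omega> \<in> B" using C_top by (rule constructible.base)

lemma constructible_empty: "{} \<in> B" using constructible.compl[OF constructible_top] by simp

lemma constructible_union: "S \<in> B \<Longrightarrow> S' \<in> B \<Longrightarrow> S \<union> S' \<in> B"
proof -
  assume *: "S \<in> B" "S' \<in> B"
  then have "\<Omega> - ((\<Omega> - S) \<inter> (\<Omega> - S')) \<in> B" by (intro constructible.compl constructible.inter)
  moreover have "\<Omega> - ((\<Omega> - S) \<inter> (\<Omega> - S')) = S \<union> S'" using * constructible_sub by auto
  ultimately show ?thesis by simp
qed

lemma constructible_diff: "S \<in> B \<Longrightarrow> S' \<in> B \<Longrightarrow> S - S' \<in> B"
proof -
  assume *: "S \<in> B" "S' \<in> B"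
  then have "S \<inter> (\<Omega> - S') \<in> B" by (intro constructible.compl constructible.inter)
  moreover have "S \<inter> (\<Omega> - S') = S - S'" using constructible_sub[OF *(1)] by auto
  ultimately show ?thesis by simp
qed

lemma constructible_Union: "finite S \<Longrightarrow> S \<subseteq> B \<Longrightarrow> \<Union>S \<in> B"
  by (induction S rule: finite_induct) (auto intro: constructible_empty constructible_union)

lemma closed_constructible: "closed Z \<Longrightarrow> Z \<in> B"
  unfolding closed_sets_def by (auto intro!: constructible_Union intro: constructible.base)

section \<open>The descending chain condition for closed sets\<close>

definition dcc :: "'b set \<Rightarrow> bool" where
  "dcc Z \<longleftrightarrow> (\<forall>S. (\<forall>i::nat. closed (S i) \<and> S i \<subseteq> Z \<and> S (Suc i) \<subseteq> S i) \<longrightarrow> (\<exists>n. \<forall>m\<ge>n. S m = S n))"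

text \<open>A chain below \<open>Z \<union> Z'\<close> is recovered from its traces on
  \<open>Z\<close> and on \<open>Z'\<close>, and both traces become stationary. A trace of a strict
  chain need not be strict, which is why \<open>dcc\<close> speaks of weakly decreasing
  sequences.\<close>

lemma dcc_union:
  assumes "dcc Z" "dcc Z'" "closed Z" "closed Z'"
  shows "dcc (Z \<union> Z')"
  unfolding dcc_def
proof (intro allI impI)
  fix S assume S: "\<forall>i::nat. closed (S i) \<and> S i \<subseteq> Z \<union> Z' \<and> S (Suc i) \<subseteq> S i"
  have "\<forall>i. closed (S i \<inter> Z) \<and> S i \<inter> Z \<subseteq> Z \<and> S (Suc i) \<inter> Z \<subseteq> S i \<inter> Z"
    "\<forall>i. closed (S i \<inter> Z') \<and> S i \<inter> Z' \<subseteq> Z' \<and> S (Suc i) \<inter> Z' \<subseteq> S i \<inter> Z'"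
    using S assms(3,4) closed_inter by blast+
  then obtain n n' where n: "\<forall>m\<ge>n. S m \<inter> Z = S n \<inter> Z" and n': "\<forall>m\<ge>n'. S m \<inter> Z' = S n' \<inter> Z'"
    using assms(1)[unfolded dcc_def, rule_format, of "\<lambda>i. S i \<inter> Z"]
      assms(2)[unfolded dcc_def, rule_format, of "\<lambda>i. S i \<inter> Z'"] by blast
  have split: "S i = (S i \<inter> Z) \<union> (S i \<inter> Z')" for i using S by blast
  have "S m = S (max n n')" if "m \<ge> max n n'" for m
  proof -
    have "S m \<inter> Z = S (max n n') \<inter> Z" using n that by (metis max.bounded_iff max.cobounded1)
    moreover have "S m \<inter> Z' = S (max n n') \<inter> Z'" using n' that by (metis max.bounded_iff max.cobounded2)
    ultimately show ?thesis using split[of m] split[of "max n n'"] by simp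
  qed
  then show "\<exists>n. \<forall>m\<ge>n. S m = S n" by blast
qed

lemma dcc_empty: "dcc {}" unfolding dcc_def by simp

lemma dcc_Union: "finite S \<Longrightarrow> (\<And>Z. Z \<in> S \<Longrightarrow> closed Z \<and> dcc Z) \<Longrightarrow> dcc (\<Union>S)"
proof (induction S rule: finite_induct)
  case (insert Z S)
  then have "dcc (Z \<union> \<Union>S)" by (intro dcc_union closed_Union) auto
  then show ?case by simp
qed (simp add: dcc_empty)

text \<open>Induction along \<open>C\<close>: as soon as a chain below \<open>V\<close> differs from
  \<open>V\<close>, it continues below a finite union of members of \<open>C\<close> that are
  properly contained in \<open>V\<close>.\<close>

lemma dcc_C: "V \<in> C \<Longrightarrow> dcc V"
proof (induction V rule: wf_induct_rule[OF C_wf])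
  case (1 V)
  show ?case unfolding dcc_def
  proof (intro allI impI)
    fix S assume S: "\<forall>i::nat. closed (S i) \<and> S i \<subseteq> V \<and> S (Suc i) \<subseteq> S i"
    then have dec: "S m \<subseteq> S n" if "n \<le> m" for m n using that by (simp add: lift_Suc_antimono_le)
    show "\<exists>n. \<forall>m\<ge>n. S m = S n"
    proof (cases "\<forall>i. S i = V")
      case False
      then obtain k where k: "S k \<subset> V" using S by blast
      have "closed (S k)" using S by blast
      then obtain \<V> where \<V>: "S k = \<Union>\<V>" "finite \<V>" "\<V> \<subseteq> C"
        unfolding closed_sets_def by blast
      have "dcc (S k)" unfolding \<V>(1)
      proof (rule dcc_Union[OF \<V>(2)])
        fix Z assume "Z \<in> \<V>"
        then have "Z \<in> C" "Z \<subset> V" using \<V> k by auto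
        then show "closed Z \<and> dcc Z" using 1 closed_base by blast
      qed
      moreover have "\<forall>i. closed (S (i + k)) \<and> S (i + k) \<subseteq> S k \<and> S (Suc i + k) \<subseteq> S (i + k)"
        using S dec by simp
      ultimately obtain n where n: "\<forall>m\<ge>n. S (m + k) = S (n + k)"
        unfolding dcc_def by (elim allE[of _ "\<lambda>i. S (i + k)"]) auto
      have "S m = S (n + k)" if "m \<ge> n + k" for m
        using n[rule_format, of "m - k"] that by simp
      then show ?thesis by blast
    qed simp
  qed
qed

lemma closed_wf: "wf {(Z, Z'). closed Z \<and> closed Z' \<and> Z \<subset> Z'}"
proof -
  have "\<not> (\<exists>S. \<forall>i::nat. (S (Suc i), S i) \<in> {(Z, Z'). closed Z \<and> closed Z' \<and> Z \<subset> Z'})"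
  proof
    assume "\<exists>S. \<forall>i::nat. (S (Suc i), S i) \<in> {(Z, Z'). closed Z \<and> closed Z' \<and> Z \<subset> Z'}"
    then obtain S where "\<forall>i::nat. closed (S (Suc i)) \<and> closed (S i) \<and> S (Suc i) \<subset> S i" by auto
    then have S: "closed (S i)" "S (Suc i) \<subset> S i" for i by blast+
    then have "\<forall>i. closed (S i) \<and> S i \<subseteq> \<Omega> \<and> S (Suc i) \<subseteq> S i" using closed_sub by blast
    then obtain n where "\<forall>m\<ge>n. S m = S n" using dcc_C[OF C_top] unfolding dcc_def by blast
    then have "n \<le> Suc n \<longrightarrow> S (Suc n) = S n" by (rule spec)
    then have "S (Suc n) = S n" by (rule mp) simp
    then show False using S(2)[of n] by blast
  qed
  then show ?thesis by (rule iffD2[OF wf_iff_no_infinite_down_chain])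
qed

text \<open>The properties \<open>P\<close> used later are: containing a given set, being defined by
  a formula of a given type, and meeting a boundary in a set of large rank.\<close>

lemma closed_minimal:
  assumes "closed Z0" "P Z0"
  obtains Z where "closed Z" "P Z" "\<And>Z'. closed Z' \<Longrightarrow> P Z' \<Longrightarrow> Z' \<subseteq> Z \<Longrightarrow> Z' = Z"
proof -
  obtain Z where Z: "Z \<in> {Z. closed Z \<and> P Z}"
    "\<And>Y. (Y, Z) \<in> {(Z, Z'). closed Z \<and> closed Z' \<and> Z \<subset> Z'} \<Longrightarrow> Y \<notin> {Z. closed Z \<and> P Z}"
    using wfE_min[OF closed_wf, of Z0 "{Z. closed Z \<and> P Z}"] assms by blast
  show ?thesis
  proof (rule that)
    fix Z' assume "closed Z'" "P Z'" "Z' \<subseteq> Z"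
    then show "Z' = Z" using Z by blast
  qed (use Z in auto)
qed

text \<open>\<open>top_closure\<close> intersects possibly infinitely many closed sets. A minimal
  closed superset of \<open>S\<close> meets every other one in itself, so it is already the whole
  intersection.\<close>

lemma closure_props:
  assumes "S \<subseteq> \<Omega>"
  shows "closed (cl S)" "S \<subseteq> cl S" "\<And>Z. closed Z \<Longrightarrow> S \<subseteq> Z \<Longrightarrow> cl S \<subseteq> Z"
proof -
  obtain Z where Z: "closed Z" "S \<subseteq> Z" "\<And>Z'. closed Z' \<Longrightarrow> S \<subseteq> Z' \<Longrightarrow> Z' \<subseteq> Z \<Longrightarrow> Z' = Z"
    using closed_minimal[OF closed_top, of "\<lambda>Z. S \<subseteq> Z"] assms by blast
  have least: "Z \<subseteq> Z'" if "closed Z'" "S \<subseteq> Z'" for Z'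
    using Z(3)[of "Z \<inter> Z'"] Z(1,2) that closed_inter[of Z Z'] by blast
  have "cl S = Z" unfolding top_closure_def using Z(1,2) least by blast
  then show "closed (cl S)" "S \<subseteq> cl S" "\<And>Z. closed Z \<Longrightarrow> S \<subseteq> Z \<Longrightarrow> cl S \<subseteq> Z"
    using Z least by auto
qed

lemma closure_empty: "cl {} = {}"
  using closure_props(3)[of "{}" "{}"] closed_empty by auto

section \<open>Irreducible closed sets and irreducible components\<close>

lemma irreducible_closed: "irreducible X \<Longrightarrow> closed X"
  unfolding irreducible_closed_def by blast

lemma irreducible_nonempty: "irreducible X \<Longrightarrow> X \<noteq> {}"
  unfolding irreducible_closed_def by blast

lemma irreducible_subset_union:
  assumes "irreducible X" "closed Z" "closed Z'" "X \<subseteq> Z \<union> Z'"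
  shows "X \<subseteq> Z \<or> X \<subseteq> Z'"
proof -
  have "X = (X \<inter> Z) \<union> (X \<inter> Z')" using assms(4) by blast
  moreover have "closed (X \<inter> Z)" "closed (X \<inter> Z')"
    using assms irreducible_closed closed_inter by blast+
  ultimately have "X = X \<inter> Z \<or> X = X \<inter> Z'" using assms(1) unfolding irreducible_closed_def by blast
  then show ?thesis by blast
qed

lemma irreducible_subset_Union:
  assumes "irreducible X" "finite S" "\<And>Z. Z \<in> S \<Longrightarrow> closed Z" "X \<subseteq> \<Union>S"
  shows "\<exists>Z\<in>S. X \<subseteq> Z"
  using assms(2,3,4)
proof (induction S rule: finite_induct)
  case empty
  then show ?case using irreducible_nonempty[OF assms(1)] by simp
next
  case (insert Z S)
  then have "X \<subseteq> Z \<or> X \<subseteq> \<Union>S"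
    by (intro irreducible_subset_union[OF assms(1)] closed_Union) auto
  then show ?case using insert by auto
qed

lemma irreducible_decomposition:
  assumes "closed Z"
  shows "\<exists>S. finite S \<and> (\<forall>X\<in>S. irreducible X) \<and> Z = \<Union>S"
  using assms
proof (induction Z rule: wf_induct_rule[OF closed_wf])
  case (1 Z)
  show ?case
  proof (cases "irreducible Z \<or> Z = {}")
    case True
    then show ?thesis by (metis Union_empty all_not_in_conv ccpo_Sup_singleton finite.emptyI finite.insertI singletonD)
  next
    case False
    then obtain A A' where A: "closed A" "closed A'" "Z = A \<union> A'" "Z \<noteq> A" "Z \<noteq> A'"
      using 1(2) unfolding irreducible_closed_def by blast
    then have "A \<subset> Z" "A' \<subset> Z" by auto
    then obtain S S' where "finite S" "\<forall>X\<in>S. irreducible X" "A = \<Union>S"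
      "finite S'" "\<forall>X\<in>S'. irreducible X" "A' = \<Union>S'"
      using 1(1)[of A] 1(1)[of A'] A(1,2) 1(2) by blast
    then show ?thesis using A(3) by (intro exI[of _ "S \<union> S'"]) auto
  qed
qed

lemma irr_component_props: "X \<in> irr_components C Z \<Longrightarrow> irreducible X \<and> X \<subseteq> Z"
  unfolding irr_components_def by blast

text \<open>Components are maximal among all irreducible closed subsets of \<open>Z\<close>.
  Comparison with one finite decomposition \<open>S\<close> of \<open>Z\<close> shows that they are
  maximal members of \<open>S\<close>, which gives finiteness and covering.\<close>

lemma irr_components_props:
  assumes "closed Z"
  shows "finite (irr_components C Z)"
    and "irreducible X \<Longrightarrow> X \<subseteq> Z \<Longrightarrow> \<exists>Y\<in>irr_components C Z. X \<subseteq> Y"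
    and "\<Union>(irr_components C Z) = Z"
proof -
  obtain S where S: "finite S" "\<And>X. X \<in> S \<Longrightarrow> irreducible X" "Z = \<Union>S"
    using irreducible_decomposition[OF assms] by blast
  have inS: "\<exists>Y\<in>S. X \<subseteq> Y" if "irreducible X" "X \<subseteq> Z" for X
    using irreducible_subset_Union[OF that(1) S(1)] S that irreducible_closed by blast
  have "irr_components C Z \<subseteq> S"
  proof
    fix X assume X: "X \<in> irr_components C Z"
    then obtain Y where Y: "Y \<in> S" "X \<subseteq> Y" using inS irr_component_props by blast
    then have "Y \<subseteq> Z" "irreducible Y" using S by auto
    then have "Y = X" using X Y(2) unfolding irr_components_def by blast
    then show "X \<in> S" using Y(1) by simp
  qed
  then show "finite (irr_components C Z)" using S(1) finite_subset by blast
  have comp: "\<exists>Y\<in>irr_components C Z. X \<subseteq> Y" if X: "irreducible X" "X \<subseteq> Z" for X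
  proof -
    have "finite {Y \<in> S. X \<subseteq> Y}" "{Y \<in> S. X \<subseteq> Y} \<noteq> {}" using S(1) inS[OF X] by auto
    then obtain Y where Y: "Y \<in> S" "X \<subseteq> Y" "\<And>Y'. Y' \<in> S \<Longrightarrow> X \<subseteq> Y' \<Longrightarrow> Y \<subseteq> Y' \<Longrightarrow> Y = Y'"
      using finite_has_maximal[of "{Y \<in> S. X \<subseteq> Y}"] by auto
    have "Y \<in> irr_components C Z" unfolding irr_components_def
    proof (intro CollectI conjI allI impI)
      show "irreducible Y" "Y \<subseteq> Z" using Y S by auto
      fix X' assume X': "irreducible X' \<and> Y \<subseteq> X' \<and> X' \<subseteq> Z"
      then obtain Y' where Y': "Y' \<in> S" "X' \<subseteq> Y'" using inS by blast
      then have "Y = Y'" using Y X' by (meson order_trans)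
      then show "X' = Y" using X' Y' by blast
    qed
    then show ?thesis using Y(2) by blast
  qed
  then show "irreducible X \<Longrightarrow> X \<subseteq> Z \<Longrightarrow> \<exists>Y\<in>irr_components C Z. X \<subseteq> Y" by blast
  show "\<Union>(irr_components C Z) = Z"
  proof
    show "\<Union>(irr_components C Z) \<subseteq> Z" using irr_component_props by blast
    show "Z \<subseteq> \<Union>(irr_components C Z)"
    proof
      fix x assume "x \<in> Z"
      then obtain Y where "Y \<in> S" "x \<in> Y" using S(3) by blast
      then show "x \<in> \<Union>(irr_components C Z)" using comp[of Y] S by blast
    qed
  qed
qed

text \<open>The trace of \<open>S\<close> on \<open>X\<close> is not dense in \<open>X\<close>. For
  irreducible \<open>X\<close> the small sets form an ideal, which is prime on the constructible
  sets; the complementary ultrafilter is the type of a generic point of \<open>X\<close>.\<close>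

definition small :: "'b set \<Rightarrow> 'b set \<Rightarrow> bool" where
  "small X S \<longleftrightarrow> (\<exists>W. closed W \<and> W \<subset> X \<and> S \<inter> X \<subseteq> W)"

lemma small_mono: "small X S \<Longrightarrow> S' \<inter> X \<subseteq> S \<Longrightarrow> small X S'"
  unfolding small_def by blast

lemma small_union:
  assumes "irreducible X" "small X S" "small X S'"
  shows "small X (S \<union> S')"
proof -
  obtain W W' where W: "closed W" "W \<subset> X" "S \<inter> X \<subseteq> W" "closed W'" "W' \<subset> X" "S' \<inter> X \<subseteq> W'"
    using assms unfolding small_def by blast
  then have "\<not> X \<subseteq> W \<union> W'" using irreducible_subset_union[OF assms(1)] by blast
  then have "closed (W \<union> W') \<and> W \<union> W' \<subset> X \<and> (S \<union> S') \<inter> X \<subseteq> W \<union> W'" using W closed_union by blast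
  then show ?thesis unfolding small_def by blast
qed

lemma small_empty: "irreducible X \<Longrightarrow> small X {}"
  unfolding small_def using closed_empty irreducible_nonempty by blast

lemma not_small_self: "X \<subseteq> S \<Longrightarrow> \<not> small X S"
  unfolding small_def by blast

lemma small_compl_inter:
  assumes "irreducible X" "small X (\<Omega> - S)" "small X (\<Omega> - S')"
  shows "small X (\<Omega> - S \<inter> S')"
  using small_union[OF assms] by (rule small_mono) auto

text \<open>A member of \<open>C\<close> either contains \<open>X\<close> or meets it in a proper
  closed subset, and the alternative survives complements and intersections.\<close>

lemma small_dichotomy:
  assumes "irreducible X" "S \<in> B"
  shows "small X S \<or> small X (\<Omega> - S)"
  using assms(2)
proof (induction rule: constructible.induct)
  case (base S)
  show ?case
  proof (cases "X \<subseteq> S")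
    case True
    then show ?thesis using small_mono[OF small_empty[OF assms(1)], of "\<Omega> - S"] by auto
  next
    case False
    have "closed (S \<inter> X)" using base closed_base irreducible_closed[OF assms(1)] closed_inter by blast
    then show ?thesis unfolding small_def using False by blast
  qed
next
  case (compl S)
  then show ?case by (auto simp: double_diff constructible_sub)
next
  case (inter S S')
  then show ?case
    using small_compl_inter[OF assms(1)] small_mono[of X S "S \<inter> S'"] small_mono[of X S' "S \<inter> S'"] by blast
qed

lemma not_both_small:
  assumes "irreducible X" "small X S" "small X (\<Omega> - S)"
  shows False
proof -
  have "X \<subseteq> S \<union> (\<Omega> - S)" using closed_sub[OF irreducible_closed[OF assms(1)]] by blast
  then show False using small_union[OF assms] not_small_self by blast
qed

text \<open>If \<open>S'\<close> were small in the component \<open>X\<close>, its closure would be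
  covered by a proper closed subset of \<open>X\<close> and the other components, none of which
  contains \<open>X\<close>. It is applied to \<open>S\<close> itself and to its boundary.\<close>

lemma component_not_small:
  assumes S: "S \<subseteq> \<Omega>" and X: "X \<in> irr_components C (cl S)" and S': "S' \<subseteq> cl S"
    and sub: "X \<subseteq> cl S'"
  shows "\<not> small X S'"
proof
  assume "small X S'"
  then obtain W where W: "closed W" "W \<subset> X" "S' \<inter> X \<subseteq> W" unfolding small_def by blast
  let ?R = "irr_components C (cl S) - {X}"
  have fin: "finite ?R" using irr_components_props(1)[OF closure_props(1)[OF S]] by simp
  have clR: "closed (\<Union>?R)"
    by (rule closed_Union[OF fin]) (use irr_component_props irreducible_closed in blast)
  have irr: "irreducible X" using X irr_component_props by blast
  have "S' \<subseteq> W \<union> \<Union>?R"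
  proof
    fix x assume "x \<in> S'"
    then have "x \<in> \<Union>(irr_components C (cl S))"
      using S' irr_components_props(3)[OF closure_props(1)[OF S]] by blast
    then show "x \<in> W \<union> \<Union>?R" using W(3) \<open>x \<in> S'\<close> by blast
  qed
  moreover have "S' \<subseteq> \<Omega>" using S' closed_sub[OF closure_props(1)[OF S]] by blast
  ultimately have "cl S' \<subseteq> W \<union> \<Union>?R"
    using closure_props(3)[OF _ closed_union[OF W(1) clR]] by blast
  then have "X \<subseteq> W \<or> X \<subseteq> \<Union>?R" using irreducible_subset_union[OF irr W(1) clR] sub by blast
  then have "X \<subseteq> \<Union>?R" using W(2) by blast
  then obtain Y where Y: "Y \<in> ?R" "X \<subseteq> Y"
    using irreducible_subset_Union[OF irr fin] irr_component_props irreducible_closed by blast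
  then have "irreducible Y" "Y \<subseteq> cl S" using irr_component_props by blast+
  then show False using X Y unfolding irr_components_def by blast
qed

end

section \<open>Morley rank and foundation rank of constructible sets\<close>

text \<open>The recursion of \<open>morley_ge\<close> with formulae replaced by their solution sets.
  Only the pieces \<open>\<psi> i\<close> are required to lie in \<open>B\<close>, so the rank also
  makes sense, and is monotone, for arbitrary sets \<open>S\<close>.\<close>

inductive mge :: "'b set set \<Rightarrow> 'a ordinal \<Rightarrow> 'b set \<Rightarrow> bool" for B where
  zero: "S \<noteq> {} \<Longrightarrow> mge B 0 S"
| succ: "(\<And>i::nat. \<psi> i \<in> B) \<Longrightarrow> (\<And>i. \<psi> i \<subseteq> S) \<Longrightarrow> (\<And>i j. i \<noteq> j \<Longrightarrow> \<psi> i \<inter> \<psi> j = {})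
    \<Longrightarrow> (\<And>i. mge B \<alpha> (\<psi> i)) \<Longrightarrow> mge B (osucc \<alpha>) S"
| limit: "olimit \<alpha> \<Longrightarrow> (\<And>\<beta>. \<beta> < \<alpha> \<Longrightarrow> mge B \<beta> S) \<Longrightarrow> mge B \<alpha> S"

definition mrank :: "'b set set \<Rightarrow> 'b set \<Rightarrow> 'a ordinal extended" where
  "mrank B S = rank_of (\<lambda>\<alpha>. mge B \<alpha> S)"

lemma Fin_osucc_le: "Fin \<alpha> < r \<Longrightarrow> Fin (osucc \<alpha>) \<le> r"
  by (cases r) (auto intro: osucc_least)

lemma mge_0:
  assumes inf: "infinite (UNIV :: 'a set)" and "mge B (0 :: 'a ordinal) S"
  shows "S \<noteq> {}"
  using assms(2) by (cases rule: mge.cases) (use osucc_neq_0[OF inf] in \<open>auto dest: sym\<close>)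

lemma mge_osuccE:
  assumes inf: "infinite (UNIV :: 'a set)" and "mge B (osucc \<alpha> :: 'a ordinal) S"
  obtains \<psi> where "\<And>i::nat. \<psi> i \<in> B" "\<And>i. \<psi> i \<subseteq> S" "\<And>i j. i \<noteq> j \<Longrightarrow> \<psi> i \<inter> \<psi> j = {}"
    "\<And>i. mge B \<alpha> (\<psi> i)"
  using assms(2)
proof (cases rule: mge.cases)
  case zero
  then show ?thesis using osucc_neq_0[OF inf] by metis
next
  case (succ \<psi> \<beta>)
  then have "\<beta> = \<alpha>" using osucc_inject[OF inf] by metis
  then show ?thesis using succ that by blast
next
  case limit
  then show ?thesis by simp
qed

lemma mge_olimitD:
  assumes "mge B \<alpha> S" "olimit \<alpha>" "\<beta> < \<alpha>"
  shows "mge B \<beta> S"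
  using assms by (cases rule: mge.cases) auto

lemma mge_mono: "mge B (\<alpha> :: 'a ordinal) S \<Longrightarrow> S \<subseteq> S' \<Longrightarrow> mge B \<alpha> S'"
proof (induction arbitrary: S' rule: mge.induct)
  case (zero S)
  then show ?case by (intro mge.zero) auto
next
  case (succ \<psi> S \<alpha>)
  have "\<psi> i \<subseteq> S'" for i using succ.hyps(2)[of i] succ.prems by blast
  then show ?case using succ.hyps(1,3,4) by (intro mge.succ[of \<psi>])
next
  case (limit \<alpha> S)
  then show ?case by (blast intro: mge.limit[OF limit.hyps(1)])
qed

lemma mge_antimono:
  assumes inf: "infinite (UNIV :: 'a set)"
  shows "mge B (\<alpha> :: 'a ordinal) S \<Longrightarrow> \<beta> \<le> \<alpha> \<Longrightarrow> mge B \<beta> S"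
proof (induction arbitrary: \<beta> rule: mge.induct)
  case (zero S)
  then have "\<beta> = 0" using ordinal_zero_le[of \<beta>] by auto
  then show ?case using mge.zero[OF zero.hyps] by simp
next
  case (succ \<psi> S \<alpha>)
  show ?case
  proof (cases "\<beta> = osucc \<alpha>")
    case True
    then show ?thesis using succ.hyps mge.succ[of \<psi> B S \<alpha>] by blast
  next
    case False
    then have "\<beta> \<le> \<alpha>" using succ.prems less_osucc_iff[OF inf, of \<beta> \<alpha>] by (simp add: order_less_le)
    then have "mge B \<beta> (\<psi> 0)" using succ by blast
    then show ?thesis using mge_mono succ by blast
  qed
next
  case (limit \<alpha> S)
  show ?case
  proof (cases "\<beta> = \<alpha>")
    case True
    then show ?thesis using mge.limit[OF limit.hyps(1,2)] by simp
  next
    case False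
    then show ?thesis using limit.hyps(2) limit.prems by (simp add: order_less_le)
  qed
qed

lemma mge_rank_predicate:
  "infinite (UNIV :: 'a set) \<Longrightarrow> rank_predicate (\<lambda>\<alpha> :: 'a ordinal. mge B \<alpha> S)"
  unfolding rank_predicate_def using mge_antimono mge.limit by blast

lemma Fin_le_mrank:
  "infinite (UNIV :: 'a set) \<Longrightarrow> Fin (\<alpha> :: 'a ordinal) \<le> mrank B S \<longleftrightarrow> mge B \<alpha> S"
  unfolding mrank_def by (rule Fin_le_rank_of[OF _ mge_rank_predicate])

lemma mrank_mono:
  "infinite (UNIV :: 'a set) \<Longrightarrow> S \<subseteq> S' \<Longrightarrow> (mrank B S :: 'a ordinal extended) \<le> mrank B S'"
  by (rule extended_leI) (auto simp: Fin_le_mrank intro: mge_mono)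

text \<open>At a successor, one of the two sets catches infinitely many of the disjoint pieces
  without loss of rank. At a limit, two levels at which the sets fail are replaced by the larger
  one, where the induction hypothesis applies.\<close>

lemma mge_union:
  assumes inf: "infinite (UNIV :: 'a set)"
    and inter: "\<And>S S'. S \<in> B \<Longrightarrow> S' \<in> B \<Longrightarrow> S \<inter> S' \<in> B"
    and S: "S \<in> B" "S' \<in> B"
  shows "mge B (\<alpha> :: 'a ordinal) (S \<union> S') \<Longrightarrow> mge B \<alpha> S \<or> mge B \<alpha> S'"
  using S
proof (induction \<alpha> arbitrary: S S' rule: less_induct)
  case (less \<alpha>)
  show ?case
  proof (cases \<alpha> rule: ordinal_cases)
    case 1
    have "S \<union> S' \<noteq> {}" by (rule mge_0[OF inf less.prems(1)[unfolded 1]])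
    then have "S \<noteq> {} \<or> S' \<noteq> {}" by simp
    then show ?thesis unfolding 1 using mge.zero[of S B] mge.zero[of S' B] by auto
  next
    case (2 \<beta>)
    then obtain \<psi> where \<psi>: "\<And>i::nat. \<psi> i \<in> B" "\<And>i. \<psi> i \<subseteq> S \<union> S'"
      "\<And>i j. i \<noteq> j \<Longrightarrow> \<psi> i \<inter> \<psi> j = {}" "\<And>i. mge B \<beta> (\<psi> i)"
      using mge_osuccE[OF inf less.prems(1)[unfolded 2]] by blast
    have \<beta>: "\<beta> < \<alpha>" using 2 osucc_greater[OF inf] by simp
    have or: "mge B \<beta> (\<psi> i \<inter> S) \<or> mge B \<beta> (\<psi> i \<inter> S')" for i
    proof -
      have "\<psi> i = \<psi> i \<inter> S \<union> \<psi> i \<inter> S'" using \<psi>(2)[of i] by blast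
      then have "mge B \<beta> (\<psi> i \<inter> S \<union> \<psi> i \<inter> S')" using \<psi>(4)[of i] by simp
      then show ?thesis by (rule less.IH[OF \<beta>]) (rule inter, rule \<psi>(1), rule less.prems)+
    qed
    \<comment> \<open>A set \<open>U\<close> that meets infinitely many pieces in rank at least
      \<open>\<beta>\<close> has rank at least \<open>\<alpha>\<close>; \<open>f\<close> picks a
      sequence of such indices.\<close>
    have *: "mge B \<alpha> U" if U: "infinite {i. mge B \<beta> (\<psi> i \<inter> U)}" "U \<in> B" for U
    proof -
      obtain f :: "nat \<Rightarrow> nat" where f: "inj f" "range f \<subseteq> {i. mge B \<beta> (\<psi> i \<inter> U)}"
        using infinite_countable_subset[OF U(1)] by blast
      show ?thesis unfolding 2
      proof (rule mge.succ[of "\<lambda>i. \<psi> (f i) \<inter> U"])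
        show "\<psi> (f i) \<inter> U \<in> B" for i using inter \<psi>(1) U(2) by blast
        show "\<psi> (f i) \<inter> U \<inter> (\<psi> (f j) \<inter> U) = {}" if "i \<noteq> j" for i j
          using \<psi>(3)[of "f i" "f j"] f(1) that by (auto dest: injD)
        show "mge B \<beta> (\<psi> (f i) \<inter> U)" for i using f(2) by blast
      qed auto
    qed
    have "{i. mge B \<beta> (\<psi> i \<inter> S)} \<union> {i. mge B \<beta> (\<psi> i \<inter> S')} = UNIV" using or by blast
    then have "infinite {i. mge B \<beta> (\<psi> i \<inter> S)} \<or> infinite {i. mge B \<beta> (\<psi> i \<inter> S')}"
      by (metis finite_Un infinite_UNIV_nat)
    then show ?thesis using *[OF _ less.prems(2)] *[OF _ less.prems(3)] by blast
  next
    case 3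
    show ?thesis
    proof (rule ccontr)
      assume "\<not> ?thesis"
      then obtain \<beta> \<beta>' where \<beta>: "\<beta> < \<alpha>" "\<not> mge B \<beta> S" "\<beta>' < \<alpha>" "\<not> mge B \<beta>' S'"
        using mge.limit[OF 3, of B S] mge.limit[OF 3, of B S'] by blast
      let ?\<gamma> = "max \<beta> \<beta>'"
      have "?\<gamma> < \<alpha>" using \<beta> by simp
      moreover have "mge B ?\<gamma> (S \<union> S')" using mge_olimitD[OF less.prems(1) 3 \<open>?\<gamma> < \<alpha>\<close>] .
      ultimately have "mge B ?\<gamma> S \<or> mge B ?\<gamma> S'" using less.IH less.prems(2,3) by simp
      then show False
        using mge_antimono[OF inf, of B ?\<gamma> S \<beta>] mge_antimono[OF inf, of B ?\<gamma> S' \<beta>'] \<beta> by auto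
    qed
  qed
qed

context noetherian_topology
begin

lemma mge_union_B:
  "infinite (UNIV :: 'a set) \<Longrightarrow> S \<in> B \<Longrightarrow> S' \<in> B \<Longrightarrow> mge B (\<alpha> :: 'a ordinal) (S \<union> S') \<Longrightarrow>
    mge B \<alpha> S \<or> mge B \<alpha> S'"
  by (rule mge_union) (auto intro: constructible.inter)

lemma mge_nonempty:
  "infinite (UNIV :: 'a set) \<Longrightarrow> mge B (\<alpha> :: 'a ordinal) S \<Longrightarrow> S \<noteq> {}"
  using mge_0 mge_antimono ordinal_zero_le by blast

lemma mge_Union:
  assumes inf: "infinite (UNIV :: 'a set)"
  shows "finite \<S> \<Longrightarrow> \<S> \<subseteq> B \<Longrightarrow> mge B (\<alpha> :: 'a ordinal) (\<Union>\<S>) \<Longrightarrow> \<exists>S\<in>\<S>. mge B \<alpha> S"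
proof (induction \<S> rule: finite_induct)
  case empty
  then have "mge B \<alpha> {}" by simp
  from mge_nonempty[OF inf this] show ?case by simp
next
  case (insert S \<S>)
  then have "mge B \<alpha> S \<or> mge B \<alpha> (\<Union>\<S>)"
    by (intro mge_union_B[OF inf]) (auto intro: constructible_Union)
  then show ?case using insert by auto
qed

text \<open>\<open>S\<close> is the union of its traces on the finitely many components of
  \<open>Z\<close>, and rank is carried by one member of a finite union.\<close>

lemma mge_component:
  assumes inf: "infinite (UNIV :: 'a set)"
    and S: "S \<in> B" "S \<subseteq> Z" "closed Z" and mge: "mge B (\<alpha> :: 'a ordinal) S"
  shows "\<exists>X\<in>irr_components C Z. mge B \<alpha> (S \<inter> X)"
proof -
  let ?\<S> = "(\<lambda>X. S \<inter> X) ` irr_components C Z"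
  have "\<Union>?\<S> = S" using irr_components_props(3)[OF S(3)] S(2) by auto
  moreover have "finite ?\<S>" using irr_components_props(1)[OF S(3)] by simp
  moreover have "?\<S> \<subseteq> B"
    using S(1) irr_component_props irreducible_closed closed_constructible constructible.inter by fastforce
  ultimately show ?thesis using mge_Union[OF inf, of ?\<S> \<alpha>] mge by auto
qed

section \<open>Foundation rank and its comparison with Morley rank\<close>

abbreviation frg :: "'a ordinal \<Rightarrow> 'b set \<Rightarrow> bool" where "frg \<equiv> foundation_rank_ge C"

lemma frg_irreducible: "frg \<alpha> X \<Longrightarrow> irreducible X"
  by (cases rule: foundation_rank_ge.cases)

lemma frg_mono: "frg \<alpha> X \<Longrightarrow> X \<subseteq> X' \<Longrightarrow> irreducible X' \<Longrightarrow> frg \<alpha> X'"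
proof (induction arbitrary: X' rule: foundation_rank_ge.induct)
  case (zero X)
  then show ?case by (intro foundation_rank_ge.zero)
next
  case (succ X Y \<alpha>)
  then show ?case by (blast intro: foundation_rank_ge.succ[of C X' Y])
next
  case (limit X \<alpha>)
  then show ?case by (blast intro: foundation_rank_ge.limit[OF limit.prems(2) limit.hyps(2)])
qed

lemma frg_antimono:
  assumes inf: "infinite (UNIV :: 'a set)"
  shows "frg (\<alpha> :: 'a ordinal) X \<Longrightarrow> \<beta> \<le> \<alpha> \<Longrightarrow> frg \<beta> X"
proof (induction arbitrary: \<beta> rule: foundation_rank_ge.induct)
  case (zero X)
  then have "\<beta> = 0" using ordinal_zero_le[of \<beta>] by auto
  then show ?case using foundation_rank_ge.zero[OF zero.hyps] by simp
next
  case (succ X Y \<alpha>)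
  show ?case
  proof (cases "\<beta> = osucc \<alpha>")
    case True
    then show ?thesis using succ.hyps foundation_rank_ge.succ by blast
  next
    case False
    then have "\<beta> \<le> \<alpha>" using succ.prems less_osucc_iff[OF inf, of \<beta> \<alpha>] by (simp add: order_less_le)
    then have "frg \<beta> Y" using succ by blast
    then show ?thesis using frg_mono succ by blast
  qed
next
  case (limit X \<alpha>)
  show ?case
  proof (cases "\<beta> = \<alpha>")
    case True
    then show ?thesis using foundation_rank_ge.limit[OF limit.hyps(1,2,3)] by simp
  next
    case False
    then show ?thesis using limit.hyps(3) limit.prems by (simp add: order_less_le)
  qed
qed

lemma frg_osuccE:
  assumes inf: "infinite (UNIV :: 'a set)" and "frg (osucc \<alpha> :: 'a ordinal) X"
  obtains Y where "Y \<subset> X" "frg \<alpha> Y"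
  using assms(2)
proof (cases rule: foundation_rank_ge.cases)
  case zero
  then show ?thesis using osucc_neq_0[OF inf] by metis
next
  case (succ Y \<beta>)
  then have "\<beta> = \<alpha>" using osucc_inject[OF inf] by metis
  then show ?thesis using succ that by blast
next
  case limit
  then show ?thesis by simp
qed

lemma Fin_le_rank_irreducible:
  assumes inf: "infinite (UNIV :: 'a set)"
  shows "Fin (\<alpha> :: 'a ordinal) \<le> rank_irreducible C X \<longleftrightarrow> frg \<alpha> X"
  unfolding rank_irreducible_def
proof (rule Fin_le_rank_of[OF inf])
  show "rank_predicate (\<lambda>\<alpha> :: 'a ordinal. frg \<alpha> X)"
    unfolding rank_predicate_def
  proof (intro conjI allI impI)
    fix \<alpha> :: "'a ordinal" assume *: "olimit \<alpha>" "\<forall>\<beta><\<alpha>. frg \<beta> X"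
    \<comment> \<open>The limit clause of \<open>foundation_rank_ge\<close> also asks for
      irreducibility, which follows from the level 0 below the limit.\<close>
    then have "0 < \<alpha>" using ordinal_zero_le[of \<alpha>] by (auto simp: olimit_def order_less_le)
    then show "frg \<alpha> X" using * frg_irreducible by (blast intro: foundation_rank_ge.limit)
  qed (use frg_antimono[OF inf] in blast)
qed

text \<open>Each irreducible subset of the closure lies in a component and foundation rank is
  monotone, so the maximum over the components may be replaced by a statement about arbitrary
  irreducible subsets.\<close>

lemma Fin_le_rank_C:
  assumes inf: "infinite (UNIV :: 'a set)" and S: "S \<subseteq> \<Omega>"
  shows "Fin (\<alpha> :: 'a ordinal) \<le> rank_C C S \<longleftrightarrow> (\<exists>X. X \<subseteq> cl S \<and> frg \<alpha> X)"
proof (cases "cl S = {}")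
  case True
  then have "\<not> frg \<alpha> X" if "X \<subseteq> cl S" for X
    using that frg_irreducible[of \<alpha> X] irreducible_nonempty[of X] by auto
  then show ?thesis using True by (auto simp: rank_C_def rank_closed_def)
next
  case False
  let ?I = "irr_components C (cl S)"
  note comps = irr_components_props[OF closure_props(1)[OF S]]
  have ne: "?I \<noteq> {}" using comps(3) False by auto
  have "Fin \<alpha> \<le> rank_C C S \<longleftrightarrow> (\<exists>X\<in>?I. Fin \<alpha> \<le> rank_irreducible C X)"
    using False comps(1) ne by (simp add: rank_C_def rank_closed_def Max_ge_iff)
  also have "\<dots> \<longleftrightarrow> (\<exists>X. X \<subseteq> cl S \<and> frg \<alpha> X)"
  proof
    assume "\<exists>X. X \<subseteq> cl S \<and> frg \<alpha> X"
    then obtain X where X: "X \<subseteq> cl S" "frg \<alpha> X" by blast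
    then obtain Y where Y: "Y \<in> ?I" "X \<subseteq> Y" using comps(2) frg_irreducible by blast
    then show "\<exists>X\<in>?I. Fin \<alpha> \<le> rank_irreducible C X"
      using frg_mono[OF X(2)] irr_component_props Fin_le_rank_irreducible[OF inf] by blast
  qed (use irr_component_props Fin_le_rank_irreducible[OF inf] in blast)
  finally show ?thesis .
qed

text \<open>Two disjoint constructible subsets of an irreducible set are not both dense in it, so only
  one member of a disjoint family can avoid dropping to a smaller irreducible set.\<close>

lemma mge_imp_frg:
  assumes inf: "infinite (UNIV :: 'a set)"
  shows "irreducible X \<Longrightarrow> S \<in> B \<Longrightarrow> S \<subseteq> X \<Longrightarrow> mge B (\<alpha> :: 'a ordinal) S \<Longrightarrow> frg \<alpha> X"
proof (induction \<alpha> arbitrary: X S rule: less_induct)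
  case (less \<alpha>)
  show ?case
  proof (cases \<alpha> rule: ordinal_cases)
    case 1
    then show ?thesis using less.prems foundation_rank_ge.zero by blast
  next
    case (2 \<beta>)
    then obtain \<psi> where \<psi>: "\<And>i::nat. \<psi> i \<in> B" "\<And>i. \<psi> i \<subseteq> S"
      "\<And>i j. i \<noteq> j \<Longrightarrow> \<psi> i \<inter> \<psi> j = {}" "\<And>i. mge B \<beta> (\<psi> i)"
      using mge_osuccE[OF inf less.prems(4)[unfolded 2]] by blast
    have \<beta>: "\<beta> < \<alpha>" using 2 osucc_greater[OF inf] by simp
    have "\<exists>i. small X (\<psi> i)"
    proof (rule ccontr)
      assume "\<nexists>i. small X (\<psi> i)"
      then have "small X (\<Omega> - \<psi> 0)" "small X (\<Omega> - \<psi> 1)"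
        using small_dichotomy[OF less.prems(1)] \<psi>(1) by blast+
      from small_compl_inter[OF less.prems(1) this] \<psi>(3)[of 0 1] have "small X \<Omega>" by simp
      then show False using not_small_self closed_sub irreducible_closed[OF less.prems(1)] by blast
    qed
    then obtain i W where W: "closed W" "W \<subset> X" "\<psi> i \<inter> X \<subseteq> W" unfolding small_def by blast
    then have "\<psi> i \<subseteq> W" using \<psi>(2) less.prems(3) by blast
    \<comment> \<open>\<open>W\<close> need not be irreducible, so the piece is cut down to a
      component of \<open>W\<close> on which it keeps its rank.\<close>
    then obtain Y where Y: "Y \<in> irr_components C W" "mge B \<beta> (\<psi> i \<inter> Y)"
      using mge_component[OF inf \<psi>(1) _ W(1) \<psi>(4)] by blast
    then have irr: "irreducible Y" "Y \<subseteq> W" using irr_component_props by blast+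
    have "frg \<beta> Y"
      using less.IH[OF \<beta> irr(1) _ _ Y(2)] constructible.inter[OF \<psi>(1) closed_constructible[OF irreducible_closed[OF irr(1)]]] by blast
    then show ?thesis unfolding 2 using foundation_rank_ge.succ[OF less.prems(1)] irr(2) W(2) by blast
  next
    case 3
    show ?thesis
    proof (rule foundation_rank_ge.limit[OF less.prems(1) 3])
      fix \<beta> assume "\<beta> < \<alpha>"
      then show "frg \<beta> X" using less.IH[of \<beta> X S] mge_olimitD[OF less.prems(4) 3] less.prems by blast
    qed
  qed
qed

lemma mrank_le_rank_C:
  assumes inf: "infinite (UNIV :: 'a set)" and S: "S \<in> B"
  shows "(mrank B S :: 'a ordinal extended) \<le> rank_C C S"
proof (rule extended_leI[OF inf])
  fix \<alpha> :: "'a ordinal" assume "Fin \<alpha> \<le> mrank B S"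
  then have "mge B \<alpha> S" by (simp add: Fin_le_mrank[OF inf])
  note c = closure_props[OF constructible_sub[OF S]]
  obtain X where X: "X \<in> irr_components C (cl S)" "mge B \<alpha> (S \<inter> X)"
    using mge_component[OF inf S c(2) c(1) \<open>mge B \<alpha> S\<close>] by blast
  then have irr: "irreducible X" "X \<subseteq> cl S" using irr_component_props by blast+
  have "frg \<alpha> X"
    using mge_imp_frg[OF inf irr(1) _ _ X(2)] constructible.inter[OF S closed_constructible[OF irreducible_closed[OF irr(1)]]] by blast
  then show "Fin \<alpha> \<le> rank_C C S" using irr(2) Fin_le_rank_C[OF inf constructible_sub[OF S]] by blast
qed

lemma mrank_eq_rank_C:
  assumes inf: "infinite (UNIV :: 'a set)"
    and boundary: "\<And>S. S \<in> B \<Longrightarrow> S \<noteq> {} \<Longrightarrow> (mrank B (cl S - S) :: 'a ordinal extended) < mrank B S"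
    and S: "S \<in> B"
  shows "(mrank B S :: 'a ordinal extended) = rank_C C S"
proof (rule order_antisym[OF mrank_le_rank_C[OF inf S]])
  have frg_mge: "mge B \<alpha> X" if "frg \<alpha> X" for X and \<alpha> :: "'a ordinal"
    using that
  proof (induction rule: foundation_rank_ge.induct)
    case (zero X)
    then show ?case by (rule mge.zero[OF irreducible_nonempty])
  next
    case (succ X Y \<alpha>)
    let ?S = "X - Y"
    have irr: "irreducible Y" using succ frg_irreducible by blast
    have S: "?S \<in> B"
      by (intro constructible_diff closed_constructible irreducible_closed succ.hyps(1) irr)
    note c = closure_props[OF constructible_sub[OF S]]
    \<comment> \<open>\<open>X\<close> is irreducible and not contained in \<open>Y\<close>, so
      \<open>X - Y\<close> is dense in it; hence the boundary of \<open>X - Y\<close> is exactly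
      \<open>Y\<close>.\<close>
    have "X \<subseteq> Y \<union> cl ?S" using c(2) by blast
    then have "X \<subseteq> cl ?S"
      using irreducible_subset_union[OF succ(1) irreducible_closed[OF irr] c(1)] succ(2) by blast
    then have "cl ?S = X" using c(3)[OF irreducible_closed[OF succ(1)]] by blast
    moreover have XY: "?S \<noteq> {}" "X - ?S = Y" using succ(2) by auto
    ultimately have "mrank B Y < (mrank B ?S :: 'a ordinal extended)"
      using boundary[OF S] XY by simp
    moreover have "Fin \<alpha> \<le> mrank B Y" using succ by (simp add: Fin_le_mrank[OF inf])
    moreover have "mrank B ?S \<le> (mrank B X :: 'a ordinal extended)" by (rule mrank_mono[OF inf]) auto
    ultimately have "Fin \<alpha> < mrank B X" by (meson le_less_trans less_le_trans)
    then have "Fin (osucc \<alpha>) \<le> mrank B X" by (rule Fin_osucc_le)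
    then show ?case by (simp add: Fin_le_mrank[OF inf])
  next
    case (limit X \<alpha>)
    then show ?case by (blast intro: mge.limit[OF limit.hyps(2)])
  qed
  note c = closure_props[OF constructible_sub[OF S]]
  show "rank_C C S \<le> (mrank B S :: 'a ordinal extended)"
  proof (rule extended_leI[OF inf])
    fix \<alpha> :: "'a ordinal" assume "Fin \<alpha> \<le> rank_C C S"
    then obtain X where "X \<subseteq> cl S" "frg \<alpha> X" using Fin_le_rank_C[OF inf constructible_sub[OF S]] by blast
    then have m: "mge B \<alpha> (cl S)" using frg_mge mge_mono by blast
    have ne: "S \<noteq> {}" using m mge_nonempty[OF inf] closure_empty by blast
    \<comment> \<open>The rank of the closure is attained on \<open>S\<close> or on its boundary,
      and by assumption the boundary has smaller rank than \<open>S\<close>.\<close>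
    have "S \<union> (cl S - S) = cl S" using c(2) by blast
    then have "mge B \<alpha> S \<or> mge B \<alpha> (cl S - S)"
      using mge_union_B[OF inf S constructible_diff[OF closed_constructible[OF c(1)] S]] m by simp
    then have "Fin \<alpha> \<le> mrank B S \<or> Fin \<alpha> \<le> mrank B (cl S - S)" by (simp add: Fin_le_mrank[OF inf])
    then show "Fin \<alpha> \<le> mrank B S"
      using boundary[OF S ne] by (elim disjE) (auto dest: order.strict_trans1 simp: order_less_imp_le)
  qed
qed

text \<open>Noetherian induction: each proper closed subset fails at some ordinal, and there are few
  enough closed sets for these ordinals to have a strict bound \<open>\<beta>\<close>. Then
  \<open>X\<close> fails at the successor of \<open>\<beta>\<close>. Thus no foundation rank is cut
  off by the size of \<open>'a\<close>.\<close>

lemma not_all_frg: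
  assumes inf: "infinite (UNIV :: 'a set)" and card: "|closed_sets C| \<le>o |UNIV :: 'a set|"
    and "closed X"
  shows "\<exists>\<alpha> :: 'a ordinal. \<not> frg \<alpha> X"
  using assms(3)
proof (induction X rule: wf_induct_rule[OF closed_wf])
  case (1 X)
  let ?Y = "{Y. closed Y \<and> Y \<subset> X}"
  have "\<forall>Y\<in>?Y. \<exists>\<alpha> :: 'a ordinal. \<not> frg \<alpha> Y" using 1 by blast
  then obtain f where f: "\<And>Y. Y \<in> ?Y \<Longrightarrow> \<not> frg (f Y :: 'a ordinal) Y" by metis
  have "|f ` ?Y| \<le>o |?Y|" by (rule card_of_image)
  moreover have "|?Y| \<le>o |closed_sets C|" by (rule card_of_mono1) blast
  ultimately have "|f ` ?Y| \<le>o |UNIV :: 'a set|" using card by (meson ordLeq_transitive)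
  then obtain \<beta> where \<beta>: "\<forall>\<alpha>\<in>f ` ?Y. \<alpha> < \<beta>" using ordinals_bounded[OF inf] by blast
  have "\<not> frg (osucc \<beta>) X"
  proof
    assume "frg (osucc \<beta>) X"
    then obtain Y where Y: "Y \<subset> X" "frg \<beta> Y" by (rule frg_osuccE[OF inf])
    then have "Y \<in> ?Y" using frg_irreducible irreducible_closed by blast
    then show False using f \<beta> frg_antimono[OF inf Y(2), of "f Y"] by (simp add: less_imp_le)
  qed
  then show ?case by blast
qed

text \<open>\<open>S\<close> is dense in each component of its closure, so by the dichotomy the
  boundary is small there and its closure contains no component; an irreducible subset of that
  closure is therefore proper in a component. This raises each ordinal level by one, which is strict
  only if the boundary does not have rank \<open>Pinf\<close>; the cardinality assumption excludes
  that.\<close>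

lemma rank_C_boundary:
  assumes inf: "infinite (UNIV :: 'a set)" and card: "|closed_sets C| \<le>o |UNIV :: 'a set|"
    and S: "S \<in> B" "S \<noteq> {}"
  shows "(rank_C C (cl S - S) :: 'a ordinal extended) < rank_C C S"
proof -
  note sub = constructible_sub[OF S(1)]
  note c = closure_props[OF sub]
  let ?D = "cl S - S"
  have D: "?D \<in> B" by (rule constructible_diff[OF closed_constructible[OF c(1)] S(1)])
  have step: "Fin (osucc \<alpha>) \<le> rank_C C S" if le: "Fin \<alpha> \<le> rank_C C ?D" for \<alpha> :: "'a ordinal"
  proof -
    obtain Y where Y: "Y \<subseteq> cl ?D" "frg \<alpha> Y" using iffD1[OF Fin_le_rank_C[OF inf constructible_sub[OF D]] le] by blast
    have "cl ?D \<subseteq> cl S" using closure_props(3)[OF constructible_sub[OF D] c(1)] by blast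
    then obtain X where X: "X \<in> irr_components C (cl S)" "Y \<subseteq> X"
      using irr_components_props(2)[OF c(1) frg_irreducible[OF Y(2)]] Y(1) by blast
    have irr: "irreducible X" "X \<subseteq> cl S" using X irr_component_props by blast+
    have "\<not> small X S" using component_not_small[OF sub X(1) c(2) irr(2)] .
    then have "small X (\<Omega> - S)" using small_dichotomy[OF irr(1) S(1)] by blast
    then have "small X ?D" by (rule small_mono) (use closed_sub[OF c(1)] in blast)
    then have "\<not> X \<subseteq> cl ?D" using component_not_small[OF sub X(1), of ?D] by blast
    then have "Y \<subset> X" using X(2) Y(1) by blast
    then have "frg (osucc \<alpha>) X" using foundation_rank_ge.succ[OF irr(1)] Y(2) by blast
    then show ?thesis using Fin_le_rank_C[OF inf sub] irr(2) by blast
  qed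
  have irr0: "Fin 0 \<le> (rank_C C S :: 'a ordinal extended)"
  proof -
    have "cl S \<noteq> {}" using c(2) S(2) by blast
    then obtain X where "X \<in> irr_components C (cl S)" using irr_components_props(3)[OF c(1)] by blast
    then have "irreducible X" "X \<subseteq> cl S" using irr_component_props by blast+
    then have "X \<subseteq> cl S \<and> frg (0 :: 'a ordinal) X" by (simp add: foundation_rank_ge.zero)
    then show ?thesis using Fin_le_rank_C[OF inf sub, of 0] by blast
  qed
  show ?thesis
  proof (cases "rank_C C ?D :: 'a ordinal extended")
    case (Fin \<alpha>)
    then have "Fin (osucc \<alpha>) \<le> rank_C C S" using step by simp
    moreover have "Fin \<alpha> < Fin (osucc \<alpha>)" using osucc_greater[OF inf] by simp
    ultimately show ?thesis using Fin by (metis less_le_trans)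
  next
    case Pinf
    have "\<forall>X\<in>irr_components C (cl ?D). \<exists>\<alpha> :: 'a ordinal. \<not> frg \<alpha> X"
      using not_all_frg[OF inf card] irreducible_closed irr_component_props[of _ "cl ?D"] by simp
    then obtain f where f: "\<And>X. X \<in> irr_components C (cl ?D) \<Longrightarrow> \<not> frg (f X :: 'a ordinal) X" by metis
    let ?I = "irr_components C (cl ?D)"
    have finI: "finite ?I" by (rule irr_components_props(1)[OF closure_props(1)[OF constructible_sub[OF D]]])
    \<comment> \<open>Each of the finitely many components fails at an ordinal not above
      \<open>\<beta>\<close>. The 0 keeps the set nonempty for \<open>Max\<close>.\<close>
    define \<beta> where "\<beta> = Max (insert 0 (f ` ?I))"
    have "Fin \<beta> \<le> rank_C C ?D" using Pinf by simp
    from iffD1[OF Fin_le_rank_C[OF inf constructible_sub[OF D]] this]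
    obtain X where X: "X \<subseteq> cl ?D" "frg \<beta> X" by blast
    obtain Y where Y: "Y \<in> ?I" "X \<subseteq> Y"
      using irr_components_props(2)[OF closure_props(1)[OF constructible_sub[OF D]] frg_irreducible[OF X(2)] X(1)] by blast
    then have "frg \<beta> Y" using frg_mono[OF X(2)] irr_component_props by blast
    moreover have "f Y \<le> \<beta>" unfolding \<beta>_def using finI Y(1) by (intro Max_ge) auto
    ultimately have "frg (f Y) Y" by (rule frg_antimono[OF inf])
    then show ?thesis using f[OF Y(1)] by blast
  next
    case Minf
    then show ?thesis using irr0 by (cases "rank_C C S :: 'a ordinal extended") auto
  qed
qed

end

section \<open>Formulae with parameters and elementary maps\<close>

lemma val_cong: "(\<And>i. i \<in> fv_tm t \<Longrightarrow> s i = s' i) \<Longrightarrow> val M s t = val M s' t"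
proof (induction t)
  case (Fn f ts)
  have "val M s t = val M s' t" if "t \<in> set ts" for t
    by (rule Fn.IH[OF that]) (use Fn.prems that in auto)
  then have "map (val M s) ts = map (val M s') ts" by simp
  then show ?case by (simp only: val.simps)
qed simp

lemma sat_cong: "(\<And>i. i \<in> fv \<phi> \<Longrightarrow> s i = s' i) \<Longrightarrow> sat M s \<phi> = sat M s' \<phi>"
proof (induction \<phi> arbitrary: s s')
  case (Eq t t')
  have "val M s t = val M s' t" "val M s t' = val M s' t'" by (rule val_cong, use Eq in auto)+
  then show ?case by simp
next
  case (Rel r ts)
  have "val M s t = val M s' t" if "t \<in> set ts" for t
    by (rule val_cong) (use Rel that in auto)
  then have "map (val M s) ts = map (val M s') ts" by simp
  then show ?case by (simp only: sat.simps)
next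
  case (Neg \<phi>)
  then have "sat M s \<phi> = sat M s' \<phi>" by (intro Neg.IH) simp
  then show ?case by simp
next
  case (Conj \<phi> \<psi>)
  have "sat M s \<phi> = sat M s' \<phi>" by (rule Conj.IH(1)) (use Conj.prems in simp)
  moreover have "sat M s \<psi> = sat M s' \<psi>" by (rule Conj.IH(2)) (use Conj.prems in simp)
  ultimately show ?case by simp
next
  case (Ex j \<phi>)
  have "sat M (s(j := d)) \<phi> = sat M (s'(j := d)) \<phi>" for d
    by (rule Ex.IH) (use Ex.prems in auto)
  then show ?case by simp
qed simp

lemma finite_fv_tm: "finite (fv_tm t)"
  by (induction t) auto

lemma finite_fv: "finite (fv \<phi>)"
  by (induction \<phi>) (auto simp: finite_fv_tm)

section \<open>Renaming of variables\<close>

lemma val_rename: "val M s (rename_tm \<sigma> t) = val M (\<lambda>i. s (\<sigma> i)) t"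
proof (induction t)
  case (Fn f ts)
  then have "map (val M s \<circ> rename_tm \<sigma>) ts = map (val M (\<lambda>i. s (\<sigma> i))) ts" by simp
  then show ?case by (simp del: map_eq_conv)
qed simp

text \<open>Bound variables are renamed too; in the quantifier case injectivity keeps the updated
  variable \<open>\<sigma> i\<close> apart from the images of the others.\<close>

lemma sat_rename: "inj \<sigma> \<Longrightarrow> sat M s (rename \<sigma> \<phi>) = sat M (\<lambda>i. s (\<sigma> i)) \<phi>"
proof (induction \<phi> arbitrary: s)
  case (Rel r ts)
  have "map (val M s \<circ> rename_tm \<sigma>) ts = map (val M (\<lambda>i. s (\<sigma> i))) ts" by (simp add: val_rename)
  then show ?case by (simp del: map_eq_conv)
next
  case (Ex i \<phi>)
  have "(\<lambda>j. (s(\<sigma> i := d)) (\<sigma> j)) = (\<lambda>j. s (\<sigma> j))(i := d)" for d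
    using Ex.prems by (auto simp: fun_eq_iff dest: injD)
  then have "sat M (s(\<sigma> i := d)) (rename \<sigma> \<phi>) = sat M ((\<lambda>j. s (\<sigma> j))(i := d)) \<phi>" for d
    using Ex.IH[OF Ex.prems, of "s(\<sigma> i := d)"] by (simp only:)
  then show ?case by (simp only: rename.simps sat.simps)
qed (auto simp: val_rename)

lemma fv_tm_rename: "fv_tm (rename_tm \<sigma> t) = \<sigma> ` fv_tm t"
  by (induction t) auto

lemma fv_rename: "inj \<sigma> \<Longrightarrow> fv (rename \<sigma> \<phi>) = \<sigma> ` fv \<phi>"
proof (induction \<phi>)
  case (Ex i \<phi>)
  then show ?case using image_set_diff[of \<sigma> "fv \<phi>" "{i}"] by simp
qed (auto simp: fv_tm_rename)

lemma wf_tm_rename: "wf_tm L (rename_tm \<sigma> t) = wf_tm L t"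
  by (induction t) auto

lemma wf_rename: "wf_fm L (rename \<sigma> \<phi>) = wf_fm L \<phi>"
  by (induction \<phi>) (auto simp: wf_tm_rename)

lemma renaming_exists:
  fixes X V Z :: "nat set"
  assumes "finite X" "finite V" "finite Z"
  shows "\<exists>\<sigma>. bij \<sigma> \<and> (\<forall>i\<in>X. \<sigma> i = i) \<and> \<sigma> ` (V - X) \<inter> (Z \<union> X) = {}"
proof -
  obtain n where n: "\<forall>i\<in>X \<union> V \<union> Z. i < n"
    using assms finite_nat_set_iff_bounded[of "X \<union> V \<union> Z"] by auto
  \<comment> \<open>\<open>\<sigma>\<close> exchanges each variable of \<open>V - X\<close> with its
    translate by \<open>n\<close>, which exceeds all variables in sight. It is an involution, hence
    a bijection, as the closure of the collection under renaming demands.\<close>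
  define \<sigma> where "\<sigma> i = (if i \<in> V - X then i + n else if n \<le> i \<and> i - n \<in> V - X then i - n else i)" for i
  have "\<sigma> (\<sigma> i) = i" for i
  proof -
    consider "i \<in> V - X" | "i \<notin> V - X" "n \<le> i" "i - n \<in> V - X" | "i \<notin> V - X" "\<not> (n \<le> i \<and> i - n \<in> V - X)" by blast
    then show ?thesis
    proof cases
      case 1
      have "i + n \<notin> V" using n by force
      then show ?thesis using 1 by (simp add: \<sigma>_def)
    next
      case 2
      have "i \<notin> V" using n[rule_format, of i] 2(2) by auto
      then show ?thesis using 2 by (simp add: \<sigma>_def)
    next
      case 3
      then have "\<sigma> i = i" unfolding \<sigma>_def by (simp only: if_False)
      then show ?thesis by simp
    qed
  qed
  then have "bij \<sigma>" by (rule involuntory_imp_bij)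
  moreover have "\<sigma> i = i" if "i \<in> X" for i
  proof -
    have "i < n" using that n by blast
    then show ?thesis using that by (simp add: \<sigma>_def)
  qed
  moreover have "\<sigma> i \<notin> Z \<union> X" if "i \<in> V - X" for i using that n unfolding \<sigma>_def by auto
  ultimately show ?thesis by blast
qed

section \<open>Quantification over finite tuples of variables\<close>

definition ExS :: "nat set \<Rightarrow> ('f, 'r) fm \<Rightarrow> ('f, 'r) fm" where
  "ExS X \<phi> = foldr Ex (sorted_list_of_set X) \<phi>"

definition AllS :: "nat set \<Rightarrow> ('f, 'r) fm \<Rightarrow> ('f, 'r) fm" where
  "AllS X \<phi> = Neg (ExS X (Neg \<phi>))"

definition Imp :: "('f, 'r) fm \<Rightarrow> ('f, 'r) fm \<Rightarrow> ('f, 'r) fm" where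
  "Imp \<phi> \<psi> = Neg (Conj \<phi> (Neg \<psi>))"

definition Disj :: "('f, 'r) fm \<Rightarrow> ('f, 'r) fm \<Rightarrow> ('f, 'r) fm" where
  "Disj \<phi> \<psi> = Neg (Conj (Neg \<phi>) (Neg \<psi>))"

lemma sat_Imp [simp]: "sat M s (Imp \<phi> \<psi>) \<longleftrightarrow> (sat M s \<phi> \<longrightarrow> sat M s \<psi>)"
  by (simp add: Imp_def)

lemma sat_Disj [simp]: "sat M s (Disj \<phi> \<psi>) \<longleftrightarrow> sat M s \<phi> \<or> sat M s \<psi>"
  by (auto simp: Disj_def)

lemma fv_Imp [simp]: "fv (Imp \<phi> \<psi>) = fv \<phi> \<union> fv \<psi>" by (simp add: Imp_def)
lemma fv_Disj [simp]: "fv (Disj \<phi> \<psi>) = fv \<phi> \<union> fv \<psi>" by (simp add: Disj_def)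
lemma wf_Imp [simp]: "wf_fm L (Imp \<phi> \<psi>) \<longleftrightarrow> wf_fm L \<phi> \<and> wf_fm L \<psi>" by (simp add: Imp_def)
lemma wf_Disj [simp]: "wf_fm L (Disj \<phi> \<psi>) \<longleftrightarrow> wf_fm L \<phi> \<and> wf_fm L \<psi>" by (simp add: Disj_def)

lemma sat_foldr_Ex:
  "sat M s (foldr Ex xs \<phi>) \<longleftrightarrow> (\<exists>c. c ` set xs \<subseteq> univ_of M \<and> sat M (override_on s c (set xs)) \<phi>)"
proof (induction xs arbitrary: s)
  case Nil
  then show ?case by simp
next
  case (Cons x xs)
  show ?case
  proof
    assume "sat M s (foldr Ex (x # xs) \<phi>)"
    then obtain d where d: "d \<in> univ_of M" "sat M (s(x := d)) (foldr Ex xs \<phi>)" by auto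
    then obtain c where "c ` set xs \<subseteq> univ_of M" "sat M (override_on (s(x := d)) c (set xs)) \<phi>"
      unfolding Cons by blast
    note dc = d(1) this
    \<comment> \<open>If \<open>x\<close> occurs again in \<open>xs\<close>, the inner quantifier
      overrides the outer one, so \<open>c\<close> takes precedence over \<open>d\<close>.\<close>
    let ?c = "\<lambda>i. if i \<in> set xs then c i else d"
    have "override_on (s(x := d)) c (set xs) = override_on s ?c (set (x # xs))"
      by (auto simp: override_on_def fun_eq_iff)
    then have "sat M (override_on s ?c (set (x # xs))) \<phi>" using dc(3) by simp
    moreover have "?c ` set (x # xs) \<subseteq> univ_of M" using dc by auto
    ultimately show "\<exists>c. c ` set (x # xs) \<subseteq> univ_of M \<and> sat M (override_on s c (set (x # xs))) \<phi>"
      by blast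
  next
    assume "\<exists>c. c ` set (x # xs) \<subseteq> univ_of M \<and> sat M (override_on s c (set (x # xs))) \<phi>"
    then obtain c where c: "c ` set (x # xs) \<subseteq> univ_of M" "sat M (override_on s c (set (x # xs))) \<phi>"
      by blast
    have "override_on (s(x := c x)) c (set xs) = override_on s c (set (x # xs))"
      by (auto simp: override_on_def fun_eq_iff)
    then have "sat M (override_on (s(x := c x)) c (set xs)) \<phi>" using c(2) by simp
    then have "sat M (s(x := c x)) (foldr Ex xs \<phi>)" unfolding Cons using c(1) by auto
    then show "sat M s (foldr Ex (x # xs) \<phi>)" using c(1) by auto
  qed
qed

lemma sat_ExS:
  assumes "finite X"
  shows "sat M s (ExS X \<phi>) \<longleftrightarrow> (\<exists>c\<in>points M X. sat M (override_on s c X) \<phi>)"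
proof -
  have *: "sat M s (ExS X \<phi>) \<longleftrightarrow> (\<exists>c. c ` X \<subseteq> univ_of M \<and> sat M (override_on s c X) \<phi>)"
    using assms by (simp add: ExS_def sat_foldr_Ex)
  have "override_on s (restrict c X) X = override_on s c X" for c
    by (auto simp: override_on_def fun_eq_iff)
  then show ?thesis unfolding *
  proof (intro iffI; elim exE bexE conjE)
    fix c assume "c ` X \<subseteq> univ_of M" "sat M (override_on s c X) \<phi>"
      "\<And>c. override_on s (restrict c X) X = override_on s c X"
    then show "\<exists>c\<in>points M X. sat M (override_on s c X) \<phi>"
      by (intro bexI[of _ "restrict c X"]) (auto simp: points_def)
  next
    fix c assume "c \<in> points M X" "sat M (override_on s c X) \<phi>"
    then show "\<exists>c. c ` X \<subseteq> univ_of M \<and> sat M (override_on s c X) \<phi>"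
      by (intro exI[of _ c]) (auto simp: points_def)
  qed
qed

lemma sat_AllS:
  "finite X \<Longrightarrow> sat M s (AllS X \<phi>) \<longleftrightarrow> (\<forall>c\<in>points M X. sat M (override_on s c X) \<phi>)"
  by (simp add: AllS_def sat_ExS)

lemma fv_ExS [simp]: "finite X \<Longrightarrow> fv (ExS X \<phi>) = fv \<phi> - X"
proof -
  have "fv (foldr Ex xs \<phi>) = fv \<phi> - set xs" for xs by (induction xs) auto
  then show "finite X \<Longrightarrow> fv (ExS X \<phi>) = fv \<phi> - X" by (simp add: ExS_def)
qed

lemma wf_ExS [simp]: "wf_fm L (ExS X \<phi>) = wf_fm L \<phi>"
proof -
  have "wf_fm L (foldr Ex xs \<phi>) = wf_fm L \<phi>" for xs by (induction xs) auto
  then show ?thesis by (simp add: ExS_def)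
qed

lemma fv_AllS [simp]: "finite X \<Longrightarrow> fv (AllS X \<phi>) = fv \<phi> - X"
  by (simp add: AllS_def)

lemma wf_AllS [simp]: "wf_fm L (AllS X \<phi>) = wf_fm L \<phi>"
  by (simp add: AllS_def)

section \<open>Solution sets of formulae with parameters and their Boolean operations\<close>

lemma mem_sols: "c \<in> sols M X (\<theta>, a) \<longleftrightarrow> c \<in> points M X \<and> sat M (override_on a c X) \<theta>"
  by (simp add: sols_def)

lemma sols_sub: "sols M X \<chi> \<subseteq> points M X"
  by (cases \<chi>) (auto simp: mem_sols)

lemma mem_pforms: "(\<theta>, a) \<in> pforms L X A \<longleftrightarrow> wf_fm L \<theta> \<and> a ` (fv \<theta> - X) \<subseteq> A"
  by (simp add: pforms_def)

lemma pforms_mono: "A \<subseteq> A' \<Longrightarrow> pforms L X A \<subseteq> pforms L X A'"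
  by (auto simp: pforms_def)

lemma sols_cong:
  assumes "\<And>i. i \<in> fv \<theta> - X \<Longrightarrow> a i = a' i"
  shows "sols M X (\<theta>, a) = sols M X (\<theta>, a')"
proof -
  have "sat M (override_on a c X) \<theta> = sat M (override_on a' c X) \<theta>" for c
    by (rule sat_cong) (use assms in \<open>auto simp: override_on_def\<close>)
  then show ?thesis by (auto simp: mem_sols)
qed

definition map_params :: "('u \<Rightarrow> 'u) \<Rightarrow> ('f, 'r, 'u) pform \<Rightarrow> ('f, 'r, 'u) pform" where
  "map_params h \<chi> = (fst \<chi>, h \<circ> snd \<chi>)"

lemma map_params_simp [simp]: "map_params h (\<theta>, a) = (\<theta>, h \<circ> a)" by (simp add: map_params_def)
lemma map_params_id [simp]: "map_params id \<chi> = \<chi>" by (simp add: map_params_def)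

definition pneg :: "('f, 'r, 'u) pform \<Rightarrow> ('f, 'r, 'u) pform" where
  "pneg \<chi> = (Neg (fst \<chi>), snd \<chi>)"

lemma pneg_simp [simp]: "pneg (\<theta>, a) = (Neg \<theta>, a)" by (simp add: pneg_def)
lemma map_params_pneg: "map_params h (pneg \<chi>) = pneg (map_params h \<chi>)" by (simp add: map_params_def pneg_def)

lemma sols_pneg: "sols M X (pneg \<chi>) = points M X - sols M X \<chi>"
  by (cases \<chi>) (auto simp: mem_sols)

lemma pneg_pforms: "pneg \<chi> \<in> pforms L X A \<longleftrightarrow> \<chi> \<in> pforms L X A"
  by (cases \<chi>) (simp add: mem_pforms)

text \<open>A fixed choice that depends on sets of variables only. Conjunctions built with it are
  the same formula for every model and every map of the parameters, so forming them commutes with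
  transport.\<close>

definition away :: "nat set \<Rightarrow> nat set \<Rightarrow> nat set \<Rightarrow> nat \<Rightarrow> nat" where
  "away X V Z = (SOME \<sigma>. bij \<sigma> \<and> (\<forall>i\<in>X. \<sigma> i = i) \<and> \<sigma> ` (V - X) \<inter> (Z \<union> X) = {})"

lemma away_props:
  assumes "finite X" "finite V" "finite Z"
  shows "bij (away X V Z)" "inj (away X V Z)" "\<And>i. i \<in> X \<Longrightarrow> away X V Z i = i"
    "\<And>i. i \<in> V \<Longrightarrow> i \<notin> X \<Longrightarrow> away X V Z i \<notin> Z \<and> away X V Z i \<notin> X"
proof -
  have *: "bij (away X V Z) \<and> (\<forall>i\<in>X. away X V Z i = i) \<and> away X V Z ` (V - X) \<inter> (Z \<union> X) = {}"
    unfolding away_def by (rule someI_ex[OF renaming_exists[OF assms]])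
  then show "bij (away X V Z)" "inj (away X V Z)" by (auto simp: bij_is_inj)
  show "\<And>i. i \<in> X \<Longrightarrow> away X V Z i = i" using * by blast
  show "\<And>i. i \<in> V \<Longrightarrow> i \<notin> X \<Longrightarrow> away X V Z i \<notin> Z \<and> away X V Z i \<notin> X" using * by blast
qed

text \<open>The parameter variables of the second formula are moved away from those of the first, so that
  one assignment can serve both.\<close>

definition pconj :: "nat set \<Rightarrow> ('f, 'r, 'u) pform \<Rightarrow> ('f, 'r, 'u) pform \<Rightarrow> ('f, 'r, 'u) pform" where
  "pconj X \<chi> \<chi>' = (let \<sigma> = away X (fv (fst \<chi>')) (fv (fst \<chi>)) in
     (Conj (fst \<chi>) (rename \<sigma> (fst \<chi>')),
      \<lambda>i. if i \<in> fv (fst \<chi>) then snd \<chi> i else snd \<chi>' (inv \<sigma> i)))"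

lemma sols_map_params_pconj:
  assumes "finite X"
  shows "sols M X (map_params h (pconj X \<chi> \<chi>')) = sols M X (map_params h \<chi>) \<inter> sols M X (map_params h \<chi>')"
proof -
  obtain \<theta> a \<theta>' a' where \<chi>: "\<chi> = (\<theta>, a)" "\<chi>' = (\<theta>', a')" by fastforce
  define \<sigma> where "\<sigma> = away X (fv \<theta>') (fv \<theta>)"
  note \<sigma> = away_props[OF assms finite_fv[of \<theta>'] finite_fv[of \<theta>], folded \<sigma>_def]
  define b where "b = (\<lambda>i. if i \<in> fv \<theta> then a i else a' (inv \<sigma> i))"
  have p: "pconj X \<chi> \<chi>' = (Conj \<theta> (rename \<sigma> \<theta>'), b)"
    by (simp only: pconj_def \<chi> \<sigma>_def b_def Let_def fst_conv snd_conv)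
  have 1: "sat M (override_on (h \<circ> b) c X) \<theta> = sat M (override_on (h \<circ> a) c X) \<theta>" for c
    by (rule sat_cong) (auto simp: override_on_def b_def)
  have 2: "sat M (override_on (h \<circ> b) c X) (rename \<sigma> \<theta>') = sat M (override_on (h \<circ> a') c X) \<theta>'" for c
    unfolding sat_rename[OF \<sigma>(2)]
  proof (rule sat_cong)
    fix i assume i: "i \<in> fv \<theta>'"
    show "override_on (h \<circ> b) c X (\<sigma> i) = override_on (h \<circ> a') c X i"
    proof (cases "i \<in> X")
      case True
      then show ?thesis by (simp add: \<sigma>(3))
    next
      case False
      then have "\<sigma> i \<notin> fv \<theta>" "\<sigma> i \<notin> X" using \<sigma>(4)[OF i] by auto
      then show ?thesis using False by (simp add: b_def inv_f_f[OF \<sigma>(2)])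
    qed
  qed
  show ?thesis unfolding p unfolding \<chi> map_params_simp using 1 2 by (auto simp: mem_sols)
qed

lemma pconj_pforms:
  assumes X: "finite X" and \<chi>: "\<chi> \<in> pforms L X A" "\<chi>' \<in> pforms L X A"
  shows "pconj X \<chi> \<chi>' \<in> pforms L X A"
proof -
  obtain \<theta> a \<theta>' a' where eq: "\<chi> = (\<theta>, a)" "\<chi>' = (\<theta>', a')" by fastforce
  define \<sigma> where "\<sigma> = away X (fv \<theta>') (fv \<theta>)"
  note \<sigma> = away_props[OF X finite_fv[of \<theta>'] finite_fv[of \<theta>], folded \<sigma>_def]
  define b where "b = (\<lambda>i. if i \<in> fv \<theta> then a i else a' (inv \<sigma> i))"
  have p: "pconj X \<chi> \<chi>' = (Conj \<theta> (rename \<sigma> \<theta>'), b)"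
    by (simp only: pconj_def eq \<sigma>_def b_def Let_def fst_conv snd_conv)
  have "b i \<in> A" if i: "i \<in> fv \<theta> - X" for i
    using \<chi>(1) i by (auto simp: eq mem_pforms b_def)
  moreover have "b (\<sigma> i) \<in> A" if i: "i \<in> fv \<theta>'" "\<sigma> i \<notin> X" for i
  proof -
    have "i \<notin> X" using \<sigma>(3)[of i] i(2) by auto
    then have "a' i \<in> A" "\<sigma> i \<notin> fv \<theta>" using \<chi>(2) i \<sigma>(4)[of i] by (auto simp: eq mem_pforms)
    then show ?thesis by (simp add: b_def inv_f_f[OF \<sigma>(2)])
  qed
  ultimately show ?thesis
    unfolding p using \<chi> by (auto simp: eq mem_pforms wf_rename fv_rename[OF \<sigma>(2)])
qed

lemma sols_pconj: "finite X \<Longrightarrow> sols M X (pconj X \<chi> \<chi>') = sols M X \<chi> \<inter> sols M X \<chi>'"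
  using sols_map_params_pconj[of X M id] by simp

lemma Tru_pforms: "(Tru, a) \<in> pforms L X A"
  by (simp add: mem_pforms)

lemma sols_Tru: "sols M X (Tru, a) = points M X"
  by (auto simp: mem_sols)

text \<open>One formula serves all structures and all maps of parameters: finite satisfiability is
  read off in one structure and transferred to another through it.\<close>

lemma pconj_finite:
  assumes X: "finite X" and "finite \<Gamma>" "\<Gamma> \<subseteq> pforms L X A"
  shows "\<exists>\<chi>\<in>pforms L X A. \<forall>(M :: ('f, 'r, 'u) struc) h. sols M X (map_params h \<chi>) = {c \<in> points M X. \<forall>\<chi>'\<in>\<Gamma>. c \<in> sols M X (map_params h \<chi>')}"
  using assms(2,3)
proof (induction \<Gamma> rule: finite_induct)
  case empty
  show ?case
    by (rule bexI[of _ "(Tru, undefined)"]) (auto simp: mem_sols mem_pforms)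
next
  case (insert \<chi>' \<Gamma>)
  then obtain \<chi> where \<chi>: "\<chi> \<in> pforms L X A"
    "\<And>(M :: ('f, 'r, 'u) struc) h. sols M X (map_params h \<chi>) = {c \<in> points M X. \<forall>\<chi>'\<in>\<Gamma>. c \<in> sols M X (map_params h \<chi>')}" by auto
  show ?case
  proof (rule bexI[of _ "pconj X \<chi>' \<chi>"])
    show "pconj X \<chi>' \<chi> \<in> pforms L X A" by (rule pconj_pforms[OF X]) (use insert.prems \<chi>(1) in auto)
    show "\<forall>(M :: ('f, 'r, 'u) struc) h. sols M X (map_params h (pconj X \<chi>' \<chi>)) = {c \<in> points M X. \<forall>\<chi>'\<in>insert \<chi>' \<Gamma>. c \<in> sols M X (map_params h \<chi>')}"
      unfolding sols_map_params_pconj[OF X] \<chi>(2) using sols_sub by auto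
  qed
qed

text \<open>\<open>elementary_embedding\<close> speaks of assignments with all values in the
  universe; outside the free variables the values are replaced by a fixed element.\<close>

lemma elementary_sat:
  assumes "elementary_embedding L M N h" "univ_of M \<noteq> {}" "wf_fm L \<phi>" "s ` fv \<phi> \<subseteq> univ_of M"
  shows "sat M s \<phi> = sat N (h \<circ> s) \<phi>"
proof -
  obtain u where u: "u \<in> univ_of M" using assms(2) by blast
  define s' where "s' i = (if i \<in> fv \<phi> then s i else u)" for i
  have "range s' \<subseteq> univ_of M" using assms(4) u by (auto simp: s'_def)
  then have "sat M s' \<phi> = sat N (h \<circ> s') \<phi>"
    using assms(1,3) unfolding elementary_embedding_def by blast
  moreover have "sat M s' \<phi> = sat M s \<phi>" by (rule sat_cong) (simp add: s'_def)
  moreover have "sat N (h \<circ> s') \<phi> = sat N (h \<circ> s) \<phi>" by (rule sat_cong) (simp add: s'_def)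
  ultimately show ?thesis by simp
qed

lemma map_params_pforms:
  assumes "elementary_embedding L M N h" "\<chi> \<in> pforms L X (univ_of M)"
  shows "map_params h \<chi> \<in> pforms L X (univ_of N)"
proof (cases \<chi>)
  case (Pair \<theta> a)
  then show ?thesis using assms unfolding elementary_embedding_def
    by (auto simp: mem_pforms) blast
qed

text \<open>Only the values at free variables are required to lie in \<open>A\<close>, so sentences
  are covered even when \<open>A\<close> is empty. With finite \<open>A\<close> these are the maps
  extended in the back-and-forth argument.\<close>

definition partial_elementary :: "('f, 'r) lang \<Rightarrow> ('f, 'r, 'u) struc \<Rightarrow> ('f, 'r, 'u) struc \<Rightarrow> 'u set \<Rightarrow> ('u \<Rightarrow> 'u) \<Rightarrow> bool" where
  "partial_elementary L M N A f \<longleftrightarrow> A \<subseteq> univ_of M \<and> f ` A \<subseteq> univ_of N \<and>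
     (\<forall>\<phi> s. wf_fm L \<phi> \<longrightarrow> s ` fv \<phi> \<subseteq> A \<longrightarrow> sat M s \<phi> = sat N (f \<circ> s) \<phi>)"

lemma partial_elementary_sat: "partial_elementary L M N A f \<Longrightarrow> wf_fm L \<phi> \<Longrightarrow> s ` fv \<phi> \<subseteq> A \<Longrightarrow> sat M s \<phi> = sat N (f \<circ> s) \<phi>"
  unfolding partial_elementary_def by blast

lemma elementary_partial_elementary:
  assumes "elementary_embedding L M N h" "univ_of M \<noteq> {}"
  shows "partial_elementary L M N (univ_of M) h"
  unfolding partial_elementary_def using assms(1) elementary_sat[OF assms] by (auto simp: elementary_embedding_def)

text \<open>Solvability is expressed by \<open>ExS X \<theta>\<close>, whose free variables carry
  the parameters only. Disjointness and inclusion of solution sets reduce to this case by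
  conjunction and negation.\<close>

lemma partial_elementary_sols_empty:
  assumes f: "partial_elementary L M N A f" and X: "finite X" and \<chi>: "\<chi> \<in> pforms L X A"
  shows "sols M X \<chi> = {} \<longleftrightarrow> sols N X (map_params f \<chi>) = {}"
proof (cases \<chi>)
  case (Pair \<theta> a)
  have "sat M a (ExS X \<theta>) = sat N (f \<circ> a) (ExS X \<theta>)"
    by (rule partial_elementary_sat[OF f]) (use \<chi> X Pair in \<open>auto simp: mem_pforms\<close>)
  then have "(\<exists>c\<in>points M X. sat M (override_on a c X) \<theta>) \<longleftrightarrow> (\<exists>c\<in>points N X. sat N (override_on (f \<circ> a) c X) \<theta>)"
    by (simp only: sat_ExS[OF X])
  then show ?thesis unfolding Pair map_params_simp by (auto simp: sols_def)
qed

lemma partial_elementary_disjoint: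
  assumes f: "partial_elementary L M N A f" and X: "finite X" and \<chi>: "\<chi> \<in> pforms L X A" "\<chi>' \<in> pforms L X A"
  shows "sols M X \<chi> \<inter> sols M X \<chi>' = {} \<longleftrightarrow> sols N X (map_params f \<chi>) \<inter> sols N X (map_params f \<chi>') = {}"
  using partial_elementary_sols_empty[OF f X pconj_pforms[OF X \<chi>]]
  by (simp add: sols_map_params_pconj[OF X] sols_pconj[OF X])

lemma partial_elementary_sols_subset:
  assumes f: "partial_elementary L M N A f" and X: "finite X" and \<chi>: "\<chi> \<in> pforms L X A" "\<chi>' \<in> pforms L X A"
  shows "sols M X \<chi> \<subseteq> sols M X \<chi>' \<longleftrightarrow> sols N X (map_params f \<chi>) \<subseteq> sols N X (map_params f \<chi>')"
proof -
  have "pneg \<chi>' \<in> pforms L X A" using \<chi>(2) by (simp add: pneg_pforms)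
  from partial_elementary_disjoint[OF f X \<chi>(1) this] show ?thesis
    unfolding map_params_pneg sols_pneg using sols_sub[of M X \<chi>] sols_sub[of N X "map_params f \<chi>"] by auto
qed

lemma elementary_sols_empty:
  assumes "elementary_embedding L M N h" "univ_of M \<noteq> {}" "finite X" "\<chi> \<in> pforms L X (univ_of M)"
  shows "sols M X \<chi> = {} \<longleftrightarrow> sols N X (map_params h \<chi>) = {}"
  by (rule partial_elementary_sols_empty[OF elementary_partial_elementary[OF assms(1,2)] assms(3,4)])

lemma elementary_sols_subset:
  assumes "elementary_embedding L M N h" "univ_of M \<noteq> {}" "finite X"
    "\<chi> \<in> pforms L X (univ_of M)" "\<chi>' \<in> pforms L X (univ_of M)"
  shows "sols M X \<chi> \<subseteq> sols M X \<chi>' \<longleftrightarrow> sols N X (map_params h \<chi>) \<subseteq> sols N X (map_params h \<chi>')"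
  by (rule partial_elementary_sols_subset[OF elementary_partial_elementary[OF assms(1,2)] assms(3-5)])

lemma elementary_model:
  fixes M N :: "('f, 'r, 'u) struc"
  assumes "elementary_embedding L M N h" "is_model L T M" "is_structure L N" "is_theory L T"
  shows "is_model L T N"
  unfolding is_model_def
proof (intro conjI ballI allI impI)
  fix \<phi> and s :: "nat \<Rightarrow> 'u" assume \<phi>: "\<phi> \<in> T" and "range s \<subseteq> univ_of N"
  then have w: "wf_fm L \<phi>" "fv \<phi> = {}" using assms(4) by (auto simp: is_theory_def)
  obtain u where u: "u \<in> univ_of M" using assms(2) by (auto simp: is_model_def is_structure_def)
  then have "sat M (\<lambda>_. u) \<phi>" using assms(2) \<phi> by (simp add: is_model_def image_subset_iff)
  moreover have "sat M (\<lambda>_. u) \<phi> = sat N (h \<circ> (\<lambda>_. u)) \<phi>"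
    by (rule elementary_sat[OF assms(1)]) (use u w in auto)
  moreover have "sat N (h \<circ> (\<lambda>_. u)) \<phi> = sat N s \<phi>" by (rule sat_cong) (simp add: w)
  ultimately show "sat N s \<phi>" by simp
qed (rule assms(3))

text \<open>A closed set is a finite union of instances. A pair \<open>(\<zeta>, Y)\<close> is one
  formula that defines such a union for each value of the parameter variables \<open>Y\<close>, so
  first-order formulae can quantify over the closed sets of a given shape.\<close>

inductive_set union_form :: "('f, 'r) partfm set \<Rightarrow> nat set \<Rightarrow> (('f, 'r) fm \<times> nat set) set" for F X where
  fls: "(Fls, {}) \<in> union_form F X"
| base: "(\<phi>, X, Y) \<in> F \<Longrightarrow> (\<phi>, Y) \<in> union_form F X"
| disj: "(\<phi>, Y) \<in> union_form F X \<Longrightarrow> (\<psi>, Y') \<in> union_form F X \<Longrightarrow> (Disj \<phi> \<psi>, Y \<union> Y') \<in> union_form F X"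

locale model_of_noetherian =
  fixes L :: "('f, 'r) lang" and T :: "('f, 'r) fm set" and F :: "('f, 'r) partfm set"
    and N :: "('f, 'r, 'u) struc" and X :: "nat set"
  assumes theory_T: "is_theory L T"
    and collection_F: "formula_collection L F"
    and noetherian_T: "noetherian_theory TYPE('u) L T F"
    and model: "is_model L T N" and finX: "finite X"
begin

sublocale noetherian_topology "points N X" "instances F N X"
  using noetherian_T model finX
  by unfold_locales (auto simp: noetherian_theory_def noetherian_collection_def)

lemma univ_nonempty: "univ_of N \<noteq> {}"
  using model by (simp add: is_model_def is_structure_def)

lemma F_props:
  assumes "(\<phi>, X, Y) \<in> F"
  shows "wf_fm L \<phi>" "finite Y" "X \<inter> Y = {}" "fv \<phi> \<subseteq> X \<union> Y"
  using assms collection_F unfolding formula_collection_def partitioned_def by fastforce+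

lemma union_form_props:
  "(\<zeta>, Y) \<in> union_form F X \<Longrightarrow> wf_fm L \<zeta> \<and> finite Y \<and> X \<inter> Y = {} \<and> fv \<zeta> \<subseteq> X \<union> Y"
  by (induction rule: union_form.induct) (use F_props in auto)

lemma union_form_closed:
  "(\<zeta>, Y) \<in> union_form F X \<Longrightarrow> b ` Y \<subseteq> univ_of N \<Longrightarrow> closed (sols N X (\<zeta>, b))"
proof (induction rule: union_form.induct)
  case fls
  have "sols N X (Fls, b) = {}" by (simp add: sols_def)
  then show ?case using closed_empty by simp
next
  case (base \<phi> Y)
  then show ?case by (intro closed_base) (auto simp: instances_def)
next
  case (disj \<phi> Y \<psi> Y')
  have "sols N X (Disj \<phi> \<psi>, b) = sols N X (\<phi>, b) \<union> sols N X (\<psi>, b)" by (auto simp: mem_sols)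
  then show ?case using disj closed_union by (simp add: image_Un)
qed

text \<open>The parameter variables of each new disjunct are moved away from \<open>W\<close> and
  from those already used. The renaming fixes \<open>X\<close>, so the renamed formula is again in
  the collection with the same tuple.\<close>

lemma closed_union_form:
  assumes "closed Z" "finite W"
  shows "\<exists>\<zeta> Y b. (\<zeta>, Y) \<in> union_form F X \<and> Y \<inter> W = {} \<and> b ` Y \<subseteq> univ_of N \<and> Z = sols N X (\<zeta>, b)"
proof -
  obtain S where S: "finite S" "S \<subseteq> instances F N X" "Z = \<Union>S"
    using assms(1) unfolding closed_sets_def by auto
  have "\<exists>\<zeta> Y b. (\<zeta>, Y) \<in> union_form F X \<and> Y \<inter> W = {} \<and> b ` Y \<subseteq> univ_of N \<and> \<Union>S = sols N X (\<zeta>, b)"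
    using S(1,2)
  proof (induction S rule: finite_induct)
    case empty
    show ?case
      by (intro exI[of _ Fls] exI[of _ "{}"] exI[of _ undefined]) (auto simp: sols_def union_form.fls)
  next
    case (insert V S)
    then obtain \<zeta> Y b where \<zeta>: "(\<zeta>, Y) \<in> union_form F X" "Y \<inter> W = {}" "b ` Y \<subseteq> univ_of N" "\<Union>S = sols N X (\<zeta>, b)"
      by auto
    obtain \<phi> Y' b' where \<phi>: "(\<phi>, X, Y') \<in> F" "b' ` Y' \<subseteq> univ_of N" "V = sols N X (\<phi>, b')"
      using insert.prems unfolding instances_def by auto
    note Y = union_form_props[OF \<zeta>(1)] note Y' = F_props[OF \<phi>(1)]
    have fin: "finite (W \<union> Y)" using Y assms(2) by simp
    define \<sigma> where "\<sigma> = away X Y' (W \<union> Y)"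
    note \<sigma> = away_props[OF finX Y'(2) fin, folded \<sigma>_def]
    define b'' where "b'' i = (if i \<in> Y then b i else b' (inv \<sigma> i))" for i
    have out: "\<sigma> i \<notin> W \<and> \<sigma> i \<notin> Y \<and> \<sigma> i \<notin> X" if "i \<in> Y'" for i
      using \<sigma>(4)[OF that] that Y'(3) by blast
    have b''\<sigma>: "b'' (\<sigma> i) = b' i" if "i \<in> Y'" for i
      using out[OF that] by (simp add: b''_def inv_f_f[OF \<sigma>(2)])
    have "\<sigma> ` X = X" using \<sigma>(3) by force
    then have "(rename \<sigma> \<phi>, X, \<sigma> ` Y') \<in> F"
      using collection_F \<phi>(1) \<sigma>(1) unfolding formula_collection_def by metis
    then have d: "(Disj \<zeta> (rename \<sigma> \<phi>), Y \<union> \<sigma> ` Y') \<in> union_form F X"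
      by (intro union_form.disj \<zeta>(1) union_form.base)
    have 1: "sat N (override_on b'' c X) \<zeta> = sat N (override_on b c X) \<zeta>" for c
      by (rule sat_cong) (use Y in \<open>auto simp: override_on_def b''_def\<close>)
    have 2: "sat N (override_on b'' c X) (rename \<sigma> \<phi>) = sat N (override_on b' c X) \<phi>" for c
      unfolding sat_rename[OF \<sigma>(2)]
    proof (rule sat_cong)
      fix i assume i: "i \<in> fv \<phi>"
      show "override_on b'' c X (\<sigma> i) = override_on b' c X i"
      proof (cases "i \<in> X")
        case True
        then show ?thesis by (simp add: \<sigma>(3))
      next
        case False
        then have "i \<in> Y'" using Y'(4) i by blast
        then show ?thesis using False out b''\<sigma> by simp
      qed
    qed
    have "\<Union>(insert V S) = sols N X (Disj \<zeta> (rename \<sigma> \<phi>), b'')"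
      unfolding Union_insert \<zeta>(4) \<phi>(3) using 1 2 by (auto simp: mem_sols)
    moreover have "b'' ` (Y \<union> \<sigma> ` Y') \<subseteq> univ_of N"
    proof -
      have "b'' ` Y \<subseteq> univ_of N" using \<zeta>(3) by (auto simp: b''_def)
      moreover have "b'' ` \<sigma> ` Y' \<subseteq> univ_of N" using \<phi>(2) b''\<sigma> by auto
      ultimately show ?thesis by (simp add: image_Un)
    qed
    moreover have "(Y \<union> \<sigma> ` Y') \<inter> W = {}" using \<zeta>(2) out by auto
    ultimately show ?case using d by blast
  qed
  then show ?thesis using S(3) by simp
qed

lemma instance_pform:
  assumes "(\<phi>, X, Y) \<in> F" "b ` Y \<subseteq> univ_of N"
  shows "(\<phi>, b) \<in> pforms L X (univ_of N)"
  using F_props[OF assms(1)] assms(2) by (auto simp: mem_pforms)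

lemma bool_comb_constructible:
  assumes "\<psi> \<in> bool_comb {\<psi>. (\<psi>, X, Y) \<in> F}" "b ` Y \<subseteq> univ_of N"
  shows "sols N X (\<psi>, b) \<in> B"
  using assms(1)
proof (induction rule: bool_comb.induct)
  case (base \<phi>)
  then show ?case using assms(2) by (intro constructible.base) (auto simp: instances_def)
next
  case (neg \<phi>)
  then show ?case using constructible.compl sols_pneg[of N X "(\<phi>, b)"] by simp
next
  case (conj \<phi> \<psi>)
  have "sols N X (Conj \<phi> \<psi>, b) = sols N X (\<phi>, b) \<inter> sols N X (\<psi>, b)" by (auto simp: mem_sols)
  then show ?case using conj constructible.inter by simp
qed

lemma sols_constructible:
  assumes "\<chi> \<in> pforms L X (univ_of N)"
  shows "sols N X \<chi> \<in> B"
proof (cases \<chi>)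
  case (Pair \<theta> a)
  define Y where "Y = fv \<theta> - X"
  have "partitioned L (\<theta>, X, Y)"
    using assms finX finite_fv[of \<theta>] by (auto simp: Pair partitioned_def Y_def mem_pforms)
  then obtain \<psi> where \<psi>: "\<psi> \<in> bool_comb {\<psi>. (\<psi>, X, Y) \<in> F}" "equiv_mod TYPE('u) L T \<theta> \<psi>"
    using noetherian_T unfolding noetherian_theory_def by blast
  obtain u where u: "u \<in> univ_of N" using univ_nonempty by blast
  \<comment> \<open>\<open>equiv_mod\<close> compares only assignments with all values in the model,
    so \<open>a\<close> is changed where its values are irrelevant.\<close>
  define b where "b i = (if i \<in> Y then a i else u)" for i
  have b: "range b \<subseteq> univ_of N" using assms u by (auto simp: b_def Pair mem_pforms Y_def)
  have "sols N X (\<theta>, a) = sols N X (\<theta>, b)" by (rule sols_cong) (simp add: b_def Y_def)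
  also have "\<dots> = sols N X (\<psi>, b)"
  proof -
    have "sat N (override_on b c X) \<theta> = sat N (override_on b c X) \<psi>" if "c \<in> points N X" for c
    proof -
      have "range (override_on b c X) \<subseteq> univ_of N"
        using b that by (auto simp: override_on_def points_def)
      then show ?thesis using \<psi>(2) model unfolding equiv_mod_def by blast
    qed
    then show ?thesis by (auto simp: mem_sols)
  qed
  also have "\<dots> \<in> B" by (rule bool_comb_constructible[OF \<psi>(1)]) (use b in auto)
  finally show ?thesis unfolding Pair .
qed

lemma constructible_sols:
  assumes "S \<in> B"
  shows "\<exists>\<chi>\<in>pforms L X (univ_of N). S = sols N X \<chi>"
  using assms
proof (induction rule: constructible.induct)
  case (base S)
  then obtain \<phi> Y b where "S = sols N X (\<phi>, b)" "(\<phi>, X, Y) \<in> F" "b ` Y \<subseteq> univ_of N"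
    unfolding instances_def by auto
  then show ?case using instance_pform by blast
next
  case (compl S)
  then obtain \<chi> where "\<chi> \<in> pforms L X (univ_of N)" "S = sols N X \<chi>" by blast
  then show ?case by (intro bexI[of _ "pneg \<chi>"]) (simp_all add: sols_pneg pneg_pforms)
next
  case (inter S S')
  then obtain \<chi> \<chi>' where "\<chi> \<in> pforms L X (univ_of N)" "S = sols N X \<chi>"
    "\<chi>' \<in> pforms L X (univ_of N)" "S' = sols N X \<chi>'" by blast
  then show ?case
    by (intro bexI[of _ "pconj X \<chi> \<chi>'"]) (simp_all add: sols_pconj[OF finX] pconj_pforms[OF finX])
qed

text \<open>Definable and constructible sets coincide, so the two recursions run over the same
  pieces. Both are evaluated in \<open>N\<close> itself, and \<open>N\<close> is not assumed to be
  saturated.\<close>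

lemma morley_ge_iff: "morley_ge L N X \<alpha> \<chi> \<longleftrightarrow> mge B \<alpha> (sols N X \<chi>)"
proof
  show "morley_ge L N X \<alpha> \<chi> \<Longrightarrow> mge B \<alpha> (sols N X \<chi>)"
  proof (induction rule: morley_ge.induct)
    case (zero \<chi>)
    then show ?case by (rule mge.zero)
  next
    case (succ \<psi> \<chi> \<alpha>)
    show ?case
      by (rule mge.succ[of "\<lambda>i. sols N X (\<psi> i)"]) (rule sols_constructible succ.hyps succ.IH | assumption)+
  next
    case (limit \<alpha> \<chi>)
    show ?case by (rule mge.limit[OF limit.hyps(1) limit.IH])
  qed
  have "mge B \<alpha> S \<Longrightarrow> S = sols N X \<chi> \<Longrightarrow> morley_ge L N X \<alpha> \<chi>" for S
  proof (induction arbitrary: \<chi> rule: mge.induct)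
    case (zero S)
    then show ?case by (intro morley_ge.zero) simp
  next
    case (succ \<psi> S \<alpha>)
    have "\<forall>i. \<exists>\<chi>. \<chi> \<in> pforms L X (univ_of N) \<and> \<psi> i = sols N X \<chi>"
      using constructible_sols[OF succ.hyps(1)] by blast
    then obtain f where f: "\<And>i. f i \<in> pforms L X (univ_of N)" "\<And>i. \<psi> i = sols N X (f i)"
      by metis
    show ?case
    proof (rule morley_ge.succ[of f])
      show "f i \<in> pforms L X (univ_of N)" for i by (rule f(1))
      show "sols N X (f i) \<subseteq> sols N X \<chi>" for i
        using succ.hyps(2)[of i] succ.prems by (simp add: f(2))
      show "sols N X (f i) \<inter> sols N X (f j) = {}" if "i \<noteq> j" for i j
        using succ.hyps(3)[OF that] by (simp add: f(2))
      show "morley_ge L N X \<alpha> (f i)" for i by (rule succ.IH[OF f(2)])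
    qed
  next
    case (limit \<alpha> S)
    show ?case by (rule morley_ge.limit[OF limit.hyps(1) limit.IH[OF _ limit.prems]])
  qed
  then show "mge B \<alpha> (sols N X \<chi>) \<Longrightarrow> morley_ge L N X \<alpha> \<chi>" by blast
qed

lemma rank_of_morley: "rank_of (\<lambda>\<alpha>. morley_ge L N X \<alpha> \<chi>) = mrank B (sols N X \<chi>)"
  by (simp add: mrank_def morley_ge_iff)

text \<open>The closure is an instance of some union form \<open>\<zeta>\<close>, but with
  parameters unrelated to \<open>a\<close>. Being the least closed superset, it is also the
  intersection of all instances of \<open>\<zeta>\<close> that contain the solutions of
  \<open>\<theta>\<close>, and this intersection is definable over \<open>a\<close>.\<close>

lemma closure_formula_exists:
  assumes "(\<theta>, a) \<in> pforms L X (univ_of N)"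
  shows "\<exists>\<chi>. wf_fm L \<chi> \<and> fv \<chi> \<subseteq> X \<union> fv \<theta> \<and> sols N X (\<chi>, a) = cl (sols N X (\<theta>, a))"
proof -
  let ?S = "sols N X (\<theta>, a)"
  note c = closure_props[OF sols_sub[of N X "(\<theta>, a)"]]
  obtain \<zeta> Y b where \<zeta>: "(\<zeta>, Y) \<in> union_form F X" "Y \<inter> (X \<union> fv \<theta>) = {}" "b ` Y \<subseteq> univ_of N"
    "cl ?S = sols N X (\<zeta>, b)"
    using closed_union_form[OF c(1), of "X \<union> fv \<theta>"] finX finite_fv[of \<theta>] by auto
  note Y = union_form_props[OF \<zeta>(1)]
  \<comment> \<open>The inner \<open>AllS X\<close> rebinds the tuple, so a point is tested only by
    the last occurrence of \<open>\<zeta>\<close>.\<close>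
  define \<chi> where "\<chi> = AllS Y (Imp (AllS X (Imp \<theta> \<zeta>)) \<zeta>)"
  have "wf_fm L \<chi>" using assms Y by (simp add: \<chi>_def mem_pforms)
  moreover have "fv \<chi> \<subseteq> X \<union> fv \<theta>" using Y finX by (auto simp: \<chi>_def)
  moreover have "sols N X (\<chi>, a) = cl ?S"
  proof -
    have iff: "sat N (override_on a x X) \<chi> \<longleftrightarrow>
        (\<forall>d\<in>points N Y. ?S \<subseteq> sols N X (\<zeta>, override_on a d Y) \<longrightarrow> x \<in> sols N X (\<zeta>, override_on a d Y))"
      if x: "x \<in> points N X" for x
    proof -
      have 1: "sat N (override_on (override_on (override_on a x X) d Y) x' X) \<theta> = sat N (override_on a x' X) \<theta>" for d x'
        by (rule sat_cong) (use \<zeta>(2) in \<open>auto simp: override_on_def\<close>)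
      have 2: "sat N (override_on (override_on (override_on a x X) d Y) x' X) \<zeta> = sat N (override_on (override_on a d Y) x' X) \<zeta>" for d x'
        by (rule sat_cong) (use Y in \<open>auto simp: override_on_def\<close>)
      have 3: "sat N (override_on (override_on a x X) d Y) \<zeta> = sat N (override_on (override_on a d Y) x X) \<zeta>" for d
        by (rule sat_cong) (use Y \<zeta>(2) in \<open>auto simp: override_on_def\<close>)
      have finY: "finite Y" using Y by simp
      have 4: "(\<forall>x'\<in>points N X. sat N (override_on a x' X) \<theta> \<longrightarrow> sat N (override_on (override_on a d Y) x' X) \<zeta>)
        \<longleftrightarrow> ?S \<subseteq> sols N X (\<zeta>, override_on a d Y)" for d by (auto simp: mem_sols)
      have 5: "sat N (override_on (override_on a d Y) x X) \<zeta> \<longleftrightarrow> x \<in> sols N X (\<zeta>, override_on a d Y)" for d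
        using x by (simp add: mem_sols)
      show ?thesis unfolding \<chi>_def sat_AllS[OF finY] sat_Imp sat_AllS[OF finX] 1 2 3 4 5 ..
    qed
    have closed_d: "closed (sols N X (\<zeta>, override_on a d Y))" if "d \<in> points N Y" for d
      by (rule union_form_closed[OF \<zeta>(1)]) (use that in \<open>auto simp: override_on_def points_def\<close>)
    have bY: "sols N X (\<zeta>, override_on a (restrict b Y) Y) = cl ?S"
      unfolding \<zeta>(4) by (rule sols_cong) (use Y in \<open>auto simp: override_on_def\<close>)
    have bY': "restrict b Y \<in> points N Y" using \<zeta>(3) by (auto simp: points_def)
    show ?thesis
    proof (intro equalityI subsetI)
      fix x assume "x \<in> sols N X (\<chi>, a)"
      then have "x \<in> points N X" "sat N (override_on a x X) \<chi>" by (auto simp: mem_sols)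
      then have "?S \<subseteq> cl ?S \<longrightarrow> x \<in> cl ?S" using iff bY bY' by metis
      then show "x \<in> cl ?S" using c(2) by blast
    next
      fix x assume x: "x \<in> cl ?S"
      then have xp: "x \<in> points N X" using closed_sub[OF c(1)] by blast
      have "x \<in> sols N X (\<zeta>, override_on a d Y)" if "d \<in> points N Y" "?S \<subseteq> sols N X (\<zeta>, override_on a d Y)" for d
        using c(3)[OF closed_d[OF that(1)] that(2)] x by blast
      then have "sat N (override_on a x X) \<chi>" using iff[OF xp] by simp
      then show "x \<in> sols N X (\<chi>, a)" using xp by (simp add: mem_sols)
    qed
  qed
  ultimately show ?thesis by blast
qed

lemma closure_formula_props:
  assumes "(\<theta>, a) \<in> pforms L X (univ_of N)"
  shows "wf_fm L (closure_formula L F N X \<theta> a)" "fv (closure_formula L F N X \<theta> a) \<subseteq> X \<union> fv \<theta>"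
    "sols N X (closure_formula L F N X \<theta> a, a) = cl (sols N X (\<theta>, a))"
  using someI_ex[OF closure_formula_exists[OF assms]] unfolding closure_formula_def by auto

end

text \<open>\<open>closure_formula\<close> is chosen in \<open>M\<close>, whereas the ranks are
  computed in \<open>N\<close>. That the set is an instance of a certain union form is first order
  over \<open>a\<close>, and so is the existence of a smaller instance of a given union form that
  still contains \<open>\<theta>\<close>. The first statement passes from \<open>M\<close> to
  \<open>N\<close>, the second back from \<open>N\<close> to \<open>M\<close>.\<close>

lemma closure_transfer:
  fixes M N :: "('f, 'r, 'u) struc"
  assumes M: "model_of_noetherian L T F M X" and N: "model_of_noetherian L T F N X"
    and h: "elementary_embedding L M N h" and \<theta>: "(\<theta>, a) \<in> pforms L X (univ_of M)"
    and \<chi>: "wf_fm L \<chi>" "fv \<chi> \<subseteq> X \<union> fv \<theta>"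
      "sols M X (\<chi>, a) = top_closure (instances F M X) (sols M X (\<theta>, a))"
  shows "sols N X (\<chi>, h \<circ> a) = top_closure (instances F N X) (sols N X (\<theta>, h \<circ> a))"
proof -
  interpret M: model_of_noetherian L T F M X by (rule M)
  interpret N: model_of_noetherian L T F N X by (rule N)
  note finX = M.finX and ne = M.univ_nonempty
  note cM = M.closure_props[OF sols_sub[of M X "(\<theta>, a)"]]
  note cN = N.closure_props[OF sols_sub[of N X "(\<theta>, h \<circ> a)"]]
  have \<chi>p: "(\<chi>, a) \<in> pforms L X (univ_of M)" using \<theta> \<chi>(1,2) by (auto simp: mem_pforms)
  have fin: "finite (X \<union> fv \<theta> \<union> fv \<chi>)" using finX by (simp add: finite_fv)
  have ov: "sat K (override_on (override_on s d Y) x X) \<eta> = sat K (override_on s x X) \<eta>"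
    if "Y \<inter> (X \<union> fv \<theta> \<union> fv \<chi>) = {}" "\<eta> = \<theta> \<or> \<eta> = \<chi>" for K :: "('f, 'r, 'u) struc" and s d Y x \<eta>
    by (rule sat_cong) (use that in \<open>auto simp: override_on_def\<close>)
  have closedN: "N.closed (sols N X (\<chi>, h \<circ> a))"
  proof -
    obtain \<zeta> Y b where \<zeta>: "(\<zeta>, Y) \<in> union_form F X" "Y \<inter> (X \<union> fv \<theta> \<union> fv \<chi>) = {}" "b ` Y \<subseteq> univ_of M"
      "sols M X (\<chi>, a) = sols M X (\<zeta>, b)"
      using M.closed_union_form[OF cM(1) fin] \<chi>(3) by auto
    note Y = M.union_form_props[OF \<zeta>(1)]
    then have finY: "finite Y" by simp
    let ?G = "AllS X (Conj (Imp \<chi> \<zeta>) (Imp \<zeta> \<chi>))"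
    have G: "sat K (override_on s d Y) ?G \<longleftrightarrow> sols K X (\<chi>, s) = sols K X (\<zeta>, override_on s d Y)" for K :: "('f, 'r, 'u) struc" and s d
      unfolding sat_AllS[OF finX] using ov[OF \<zeta>(2)] by (auto simp: mem_sols set_eq_iff)
    have "sols M X (\<zeta>, override_on a (restrict b Y) Y) = sols M X (\<zeta>, b)"
      by (rule sols_cong) (use Y in \<open>auto simp: override_on_def\<close>)
    then have "sat M (override_on a (restrict b Y) Y) ?G" unfolding G \<zeta>(4) ..
    moreover have "restrict b Y \<in> points M Y" using \<zeta>(3) by (auto simp: points_def)
    ultimately have "sat M a (ExS Y ?G)" unfolding sat_ExS[OF finY] by blast
    moreover have "sat M a (ExS Y ?G) = sat N (h \<circ> a) (ExS Y ?G)"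
    proof (rule elementary_sat[OF h ne])
      show "wf_fm L (ExS Y ?G)" using Y \<chi>(1) by simp
      show "a ` fv (ExS Y ?G) \<subseteq> univ_of M" using Y \<chi>(2) \<theta> finX by (auto simp: mem_pforms)
    qed
    ultimately obtain d where d: "d \<in> points N Y" "sat N (override_on (h \<circ> a) d Y) ?G"
      unfolding sat_ExS[OF finY] by blast
    have "N.closed (sols N X (\<zeta>, override_on (h \<circ> a) d Y))"
      by (rule N.union_form_closed[OF \<zeta>(1)]) (use d(1) in \<open>auto simp: override_on_def points_def\<close>)
    then show ?thesis using d(2) unfolding G by simp
  qed
  have "sols M X (\<theta>, a) \<subseteq> sols M X (\<chi>, a)" unfolding \<chi>(3) by (rule cM(2))
  then have sub: "sols N X (\<theta>, h \<circ> a) \<subseteq> sols N X (\<chi>, h \<circ> a)"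
    using elementary_sols_subset[OF h ne finX \<theta> \<chi>p] by simp
  show ?thesis
  proof (rule equalityI[OF _ cN(3)[OF closedN sub]], rule ccontr)
    let ?E = "N.cl (sols N X (\<theta>, h \<circ> a))"
    assume nsub: "\<not> sols N X (\<chi>, h \<circ> a) \<subseteq> ?E"
    obtain \<zeta> Y b where \<zeta>: "(\<zeta>, Y) \<in> union_form F X" "Y \<inter> (X \<union> fv \<theta> \<union> fv \<chi>) = {}" "b ` Y \<subseteq> univ_of N"
      "?E = sols N X (\<zeta>, b)"
      using N.closed_union_form[OF cN(1) fin] by auto
    note Y = M.union_form_props[OF \<zeta>(1)]
    then have finY: "finite Y" by simp
    \<comment> \<open>\<open>?G\<close> says that the instance of \<open>\<zeta>\<close> contains
      the solutions of \<open>\<theta>\<close> but not all those of \<open>\<chi>\<close>. Found in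
      \<open>M\<close>, such an instance contradicts the minimality of the closure there.\<close>
    let ?G = "Conj (AllS X (Imp \<theta> \<zeta>)) (ExS X (Conj \<chi> (Neg \<zeta>)))"
    have G: "sat K (override_on s d Y) ?G \<longleftrightarrow> sols K X (\<theta>, s) \<subseteq> sols K X (\<zeta>, override_on s d Y) \<and>
        \<not> sols K X (\<chi>, s) \<subseteq> sols K X (\<zeta>, override_on s d Y)" for K :: "('f, 'r, 'u) struc" and s d
      unfolding sat.simps sat_AllS[OF finX] sat_ExS[OF finX] using ov[OF \<zeta>(2)]
      by (auto simp: mem_sols subset_iff)
    have eq: "sols N X (\<zeta>, override_on (h \<circ> a) (restrict b Y) Y) = ?E"
      unfolding \<zeta>(4) by (rule sols_cong) (use Y in \<open>auto simp: override_on_def\<close>)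
    have "sat N (override_on (h \<circ> a) (restrict b Y) Y) ?G" unfolding G eq using cN(2) nsub by blast
    moreover have "restrict b Y \<in> points N Y" using \<zeta>(3) by (auto simp: points_def)
    ultimately have "sat N (h \<circ> a) (ExS Y ?G)" unfolding sat_ExS[OF finY] by blast
    moreover have "sat M a (ExS Y ?G) = sat N (h \<circ> a) (ExS Y ?G)"
    proof (rule elementary_sat[OF h ne])
      show "wf_fm L (ExS Y ?G)" using Y \<chi>(1) \<theta> by (simp add: mem_pforms)
      show "a ` fv (ExS Y ?G) \<subseteq> univ_of M" using Y \<chi>(2) \<theta> finX by (auto simp: mem_pforms)
    qed
    ultimately obtain d where d: "d \<in> points M Y" "sat M (override_on a d Y) ?G"
      unfolding sat_ExS[OF finY] by blast
    have "M.closed (sols M X (\<zeta>, override_on a d Y))"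
      by (rule M.union_form_closed[OF \<zeta>(1)]) (use d(1) in \<open>auto simp: override_on_def points_def\<close>)
    from cM(3)[OF this] d(2) show False unfolding G \<chi>(3) by blast
  qed
qed

section \<open>Skolem hulls of ultrapowers\<close>

definition card_le :: "'u itself \<Rightarrow> 'x set \<Rightarrow> bool" where
  "card_le (_ :: 'u itself) A \<longleftrightarrow> |A| \<le>o |UNIV :: 'u set|"

lemma card_le_subset: "card_le u A \<Longrightarrow> A' \<subseteq> A \<Longrightarrow> card_le u A'"
  unfolding card_le_def by (rule ordLeq_transitive[OF card_of_mono1])

lemma card_le_image: "card_le u A \<Longrightarrow> card_le u (f ` A)"
  unfolding card_le_def by (rule ordLeq_transitive[OF card_of_image])

lemma card_le_self: "card_le TYPE('u) (A :: 'u set)"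
  unfolding card_le_def by (rule card_of_mono1) simp

lemma card_le_times:
  assumes "infinite (UNIV :: 'u set)" "card_le TYPE('u) A" "card_le TYPE('u) A'"
  shows "card_le TYPE('u) (A \<times> A')"
  unfolding card_le_def
  by (rule card_of_Times_ordLeq_infinite_Field[OF _ _ _ card_of_Card_order])
    (use assms in \<open>simp_all add: card_le_def Field_card_of\<close>)

lemma card_le_UN:
  assumes "infinite (UNIV :: 'u set)" "card_le TYPE('u) I" "\<And>i. i \<in> I \<Longrightarrow> card_le TYPE('u) (A i)"
  shows "card_le TYPE('u) (\<Union>i\<in>I. A i)"
  unfolding card_le_def
  by (rule card_of_UNION_ordLeq_infinite_Field[OF _ card_of_Card_order])
    (use assms in \<open>simp_all add: card_le_def Field_card_of\<close>)

lemma card_le_nat: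
  assumes "infinite (UNIV :: 'u set)"
  shows "card_le TYPE('u) (A :: nat set)"
proof -
  have "card_le TYPE('u) (UNIV :: nat set)"
    unfolding card_le_def using assms infinite_iff_card_of_nat by blast
  then show ?thesis by (rule card_le_subset) simp
qed

lemma card_le_Un:
  assumes "infinite (UNIV :: 'u set)" "card_le TYPE('u) A" "card_le TYPE('u) A'"
  shows "card_le TYPE('u) (A \<union> A')"
proof -
  have "card_le TYPE('u) (\<Union>i\<in>{0, 1 :: nat}. if i = 0 then A else A')"
    by (rule card_le_UN[OF assms(1) card_le_nat[OF assms(1)]]) (use assms in simp)
  then show ?thesis by (rule card_le_subset) auto
qed

lemma card_le_lists:
  assumes inf: "infinite (UNIV :: 'u set)" and A: "card_le TYPE('u) A"
  shows "card_le TYPE('u) (lists A)"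
proof -
  have "card_le TYPE('u) {xs \<in> lists A. length xs = n}" for n
  proof (induction n)
    case 0
    have "card_le TYPE('u) ((\<lambda>_. []) ` {0 :: nat} :: 'b list set)"
      by (rule card_le_image[OF card_le_nat[OF inf]])
    then show ?case by (rule card_le_subset) auto
  next
    case (Suc n)
    have "card_le TYPE('u) ((\<lambda>(x, xs). x # xs) ` (A \<times> {xs \<in> lists A. length xs = n}))"
      by (rule card_le_image[OF card_le_times[OF inf A Suc]])
    then show ?case
    proof (rule card_le_subset, intro subsetI)
      fix xs assume "xs \<in> {xs \<in> lists A. length xs = Suc n}"
      then obtain y ys where "xs = y # ys" "y \<in> A" "ys \<in> lists A" "length ys = n"
        by (cases xs) auto
      then show "xs \<in> (\<lambda>(x, xs). x # xs) ` (A \<times> {xs \<in> lists A. length xs = n})" by force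
    qed
  qed
  then have "card_le TYPE('u) (\<Union>n\<in>UNIV. {xs \<in> lists A. length xs = n})"
    by (intro card_le_UN[OF inf card_le_nat[OF inf]])
  then show ?thesis by (rule card_le_subset) auto
qed

lemma card_le_inj:
  assumes "card_le TYPE('u) A" "|UNIV :: 'u set| \<le>o |R|"
  shows "\<exists>e. inj_on e A \<and> e ` A \<subseteq> R"
proof -
  have "|A| \<le>o |R|" using assms unfolding card_le_def by (rule ordLeq_transitive)
  then show ?thesis unfolding card_of_ordLeq[symmetric] .
qed

text \<open>Two copies of \<open>'u\<close> embed into \<open>R\<close>. Whenever a structure is
  enlarged inside \<open>'u\<close>, one part receives the new elements and the other remains free
  for later steps.\<close>

lemma split_room:
  assumes inf: "infinite (UNIV :: 'u set)" and R: "|UNIV :: 'u set| \<le>o |R :: 'u set|"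
  shows "\<exists>R1 R2. R1 \<union> R2 \<subseteq> R \<and> R1 \<inter> R2 = {} \<and> |UNIV :: 'u set| \<le>o |R1| \<and> |UNIV :: 'u set| \<le>o |R2|"
proof -
  have "card_le TYPE('u) ((UNIV :: 'u set) \<times> {0, 1 :: nat})"
    by (rule card_le_times[OF inf card_le_self card_le_nat[OF inf]])
  then obtain e where e: "inj_on e ((UNIV :: 'u set) \<times> {0, 1 :: nat})" "e ` (UNIV \<times> {0, 1}) \<subseteq> R"
    using card_le_inj[OF _ R] by blast
  have "|UNIV :: 'u set| \<le>o |(\<lambda>x. e (x, i)) ` (UNIV :: 'u set)|" if "i \<in> {0, 1}" for i
  proof -
    have "inj_on (\<lambda>x. e (x, i)) UNIV"
    proof (rule inj_onI)
      fix x y assume "e (x, i) = e (y, i)"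
      from inj_onD[OF e(1) this] that show "x = y" by simp
    qed
    then show ?thesis unfolding card_of_ordLeq[symmetric] by blast
  qed
  moreover have "(\<lambda>x. e (x, 0)) ` UNIV \<inter> (\<lambda>x. e (x, 1)) ` UNIV = {}"
  proof -
    have "e (x, 0) \<noteq> e (y, 1)" for x y using inj_onD[OF e(1), of "(x, 0)" "(y, 1)"] by auto
    then show ?thesis by blast
  qed
  ultimately show ?thesis
    by (intro exI[of _ "(\<lambda>x. e (x, 0)) ` UNIV"] exI[of _ "(\<lambda>x. e (x, 1)) ` UNIV"]) (use e(2) in auto)
qed

section \<open>Ultrafilters from families with the finite intersection property\<close>

definition ultrafilter :: "'i set set \<Rightarrow> bool" where
  "ultrafilter U \<longleftrightarrow> {} \<notin> U \<and> (\<forall>A\<in>U. \<forall>A'. A \<subseteq> A' \<longrightarrow> A' \<in> U) \<and>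
     (\<forall>A\<in>U. \<forall>A'\<in>U. A \<inter> A' \<in> U) \<and> (\<forall>A. A \<in> U \<or> - A \<in> U)"

definition fip :: "'i set set \<Rightarrow> bool" where
  "fip \<A> \<longleftrightarrow> (\<forall>\<F>\<subseteq>\<A>. finite \<F> \<longrightarrow> \<Inter>\<F> \<noteq> {})"

lemma ultrafilter_exists:
  assumes "fip \<A>"
  shows "\<exists>U. ultrafilter U \<and> \<A> \<subseteq> U"
proof -
  let ?Z = "{\<B>. \<A> \<subseteq> \<B> \<and> fip \<B>}"
  have "\<exists>U\<in>?Z. \<forall>\<B>\<in>?Z. U \<subseteq> \<B> \<longrightarrow> \<B> = U"
  proof (rule subset_Zorn_nonempty)
    show "?Z \<noteq> {}" using assms by blast
    fix \<C> assume C: "\<C> \<noteq> {}" "subset.chain ?Z \<C>"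
    then have sub: "\<C> \<subseteq> ?Z" by (simp add: subset.chain_def)
    have "fip (\<Union>\<C>)" unfolding fip_def
    proof (intro allI impI)
      fix \<F> assume F: "\<F> \<subseteq> \<Union>\<C>" "finite \<F>"
      then obtain \<B> where "\<B> \<in> \<C>" "\<F> \<subseteq> \<B>" using finite_subset_Union_chain[OF F(2,1) C] by blast
      then have "fip \<B>" using sub by auto
      then show "\<Inter>\<F> \<noteq> {}" using \<open>\<F> \<subseteq> \<B>\<close> F(2) by (simp add: fip_def)
    qed
    moreover have "\<A> \<subseteq> \<Union>\<C>" using C(1) sub by auto
    ultimately show "\<Union>\<C> \<in> ?Z" by simp
  qed
  then obtain U where Z: "U \<in> ?Z" "\<forall>\<B>\<in>?Z. U \<subseteq> \<B> \<longrightarrow> \<B> = U" ..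
  then have U: "\<A> \<subseteq> U" "fip U" by auto
  have max: "\<B> = U" if "\<A> \<subseteq> \<B>" "fip \<B>" "U \<subseteq> \<B>" for \<B> using Z(2) that by auto
  have mem: "A \<in> U" if "fip (insert A U)" for A
    using max[OF _ that] U(1) by blast
  have up: "A \<in> U" if "\<G> \<subseteq> U" "finite \<G>" "\<Inter>\<G> \<subseteq> A" for A \<G>
  proof (rule mem, unfold fip_def, intro allI impI)
    fix \<F> assume "\<F> \<subseteq> insert A U" "finite \<F>"
    then have "\<G> \<union> (\<F> - {A}) \<subseteq> U" "finite (\<G> \<union> (\<F> - {A}))" using that by auto
    then have "\<Inter>(\<G> \<union> (\<F> - {A})) \<noteq> {}" using U(2) unfolding fip_def by blast
    moreover have "\<Inter>(\<G> \<union> (\<F> - {A})) \<subseteq> \<Inter>\<F>" using that(3) by blast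
    ultimately show "\<Inter>\<F> \<noteq> {}" by blast
  qed
  have "{} \<notin> U"
  proof
    assume "{} \<in> U"
    then have "\<Inter>{{} :: 'a set} \<noteq> {}" using U(2)[unfolded fip_def, rule_format, of "{{}}"] by simp
    then show False by simp
  qed
  moreover have "A' \<in> U" if "A \<in> U" "A \<subseteq> A'" for A A' using up[of "{A}" A'] that by simp
  moreover have "A \<inter> A' \<in> U" if "A \<in> U" "A' \<in> U" for A A' using up[of "{A, A'}" "A \<inter> A'"] that by simp
  moreover have "A \<in> U \<or> - A \<in> U" for A
  proof (rule disjCI)
    assume "- A \<notin> U"
    show "A \<in> U"
    proof (rule mem, unfold fip_def, intro allI impI)
      fix \<F> assume F: "\<F> \<subseteq> insert A U" "finite \<F>"
      show "\<Inter>\<F> \<noteq> {}"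
      proof
        assume "\<Inter>\<F> = {}"
        \<comment> \<open>If adding \<open>A\<close> destroys the finite intersection property,
          finitely many members of \<open>U\<close> meet inside the complement of \<open>A\<close>,
          which then belongs to \<open>U\<close>.\<close>
        then have "\<Inter>(\<F> - {A}) \<subseteq> - A" by blast
        then have "- A \<in> U" using up[of "\<F> - {A}" "- A"] F by blast
        then show False using \<open>- A \<notin> U\<close> by blast
      qed
    qed
  qed
  ultimately have "ultrafilter U" unfolding ultrafilter_def by blast
  then show ?thesis using U(1) by blast
qed

lemma
  assumes "ultrafilter U"
  shows ultra_empty: "{} \<notin> U" and ultra_up: "A \<in> U \<Longrightarrow> A \<subseteq> A' \<Longrightarrow> A' \<in> U"
    and ultra_inter: "A \<in> U \<Longrightarrow> A' \<in> U \<Longrightarrow> A \<inter> A' \<in> U"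
    and ultra_compl: "- A \<in> U \<longleftrightarrow> A \<notin> U" and ultra_UNIV: "UNIV \<in> U"
proof -
  show 1: "{} \<notin> U" and 2: "\<And>A A'. A \<in> U \<Longrightarrow> A \<subseteq> A' \<Longrightarrow> A' \<in> U"
    and 3: "\<And>A A'. A \<in> U \<Longrightarrow> A' \<in> U \<Longrightarrow> A \<inter> A' \<in> U"
    using assms unfolding ultrafilter_def by blast+
  have 4: "A \<in> U \<or> - A \<in> U" for A using assms unfolding ultrafilter_def by blast
  show "- A \<in> U \<longleftrightarrow> A \<notin> U" for A using 4[of A] 3[of A "- A"] 1 by auto
  show "UNIV \<in> U" using 4[of UNIV] 1 by auto
qed

lemma ultra_ball:
  assumes "ultrafilter U"
  shows "finite I \<Longrightarrow> (\<And>x. x \<in> I \<Longrightarrow> {i. P x i} \<in> U) \<Longrightarrow> {i. \<forall>x\<in>I. P x i} \<in> U"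
proof (induction I rule: finite_induct)
  case empty
  then show ?case using ultra_UNIV[OF assms] by simp
next
  case (insert x I)
  then have "{i. P x i} \<inter> {i. \<forall>x\<in>I. P x i} \<in> U" by (intro ultra_inter[OF assms]) auto
  then show ?case by (rule ultra_up[OF assms]) auto
qed

lemma structure_fn:
  assumes "is_structure L M" "(f, length ds) \<in> funs L" "set ds \<subseteq> univ_of M"
  shows "fn M f ds \<in> univ_of M"
proof -
  have "\<forall>(f, n)\<in>funs L. \<forall>ds. length ds = n \<and> set ds \<subseteq> univ_of M \<longrightarrow> fn M f ds \<in> univ_of M"
    using assms(1) by (simp add: is_structure_def)
  from bspec[OF this assms(2)] show ?thesis using assms(3) by simp
qed

lemma structureI:
  assumes "univ_of M \<noteq> {}" "\<And>f ds. (f, length ds) \<in> funs L \<Longrightarrow> set ds \<subseteq> univ_of M \<Longrightarrow> fn M f ds \<in> univ_of M"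
  shows "is_structure L M"
  unfolding is_structure_def using assms by auto

text \<open>\<open>G\<close> is a set of representatives of part of the ultrapower, closed under
  pointwise Skolem functions so that Los's theorem still holds on this part. The map
  \<open>g\<close> names the classes modulo \<open>U\<close> by elements of \<open>'u\<close>; thus
  the resulting structure lives on \<open>'u\<close> however large the full ultrapower is.\<close>

locale skolem_ultrapower =
  fixes L :: "('f, 'r) lang" and M :: "('f, 'r, 'u) struc"
    and U :: "'i set set" and G :: "('i \<Rightarrow> 'u) set" and g :: "('i \<Rightarrow> 'u) \<Rightarrow> 'u"
  assumes structure_M: "is_structure L M" and ultra: "ultrafilter U"
    and G_univ: "f \<in> G \<Longrightarrow> f i \<in> univ_of M"
    and G_const: "m \<in> univ_of M \<Longrightarrow> (\<lambda>_. m) \<in> G"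
    and skolem: "wf_fm L \<phi> \<Longrightarrow> (\<And>v. s v \<in> G) \<Longrightarrow> \<exists>f\<in>G. \<forall>i.
      (\<exists>d\<in>univ_of M. sat M ((\<lambda>v. s v i)(x := d)) \<phi>) \<longrightarrow> sat M ((\<lambda>v. s v i)(x := f i)) \<phi>"
    and g_eq: "f \<in> G \<Longrightarrow> f' \<in> G \<Longrightarrow> g f = g f' \<longleftrightarrow> {i. f i = f' i} \<in> U"
begin

abbreviation k :: "'u \<Rightarrow> 'i \<Rightarrow> 'u" where "k \<equiv> inv_into G g"

definition N :: "('f, 'r, 'u) struc" where
  "N = \<lparr>univ_of = g ` G, fn = (\<lambda>f ds. g (\<lambda>i. fn M f (map (\<lambda>d. k d i) ds))),
    rl = (\<lambda>r ds. {i. rl M r (map (\<lambda>d. k d i) ds)} \<in> U)\<rparr>"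

lemma univ_N: "univ_of N = g ` G" by (simp add: N_def)

text \<open>The Skolem property is applied to the equation between a fresh variable and the function
  term: the values of the witness are forced, so the pointwise application of \<open>f\<close> lies
  in \<open>G\<close>.\<close>

lemma fn_G:
  assumes f: "(f, length \<tau>s) \<in> funs L" and \<tau>s: "set \<tau>s \<subseteq> G"
  shows "(\<lambda>i. fn M f (map (\<lambda>\<tau>. \<tau> i) \<tau>s)) \<in> G"
proof -
  obtain u where u: "u \<in> univ_of M" using structure_M by (auto simp: is_structure_def)
  define n where "n = length \<tau>s"
  define s where "s v = (if v < n then \<tau>s ! v else (\<lambda>_. u))" for v
  have s: "s v \<in> G" for v using \<tau>s G_const[OF u] by (auto simp: s_def n_def)
  let ?\<phi> = "Eq (Var n) (Fn f (map Var [0..<n])) :: ('f, 'r) fm"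
  have vals: "map (val M ((\<lambda>v. s v i)(n := d)) \<circ> Var) [0..<n] = map (\<lambda>\<tau>. \<tau> i) \<tau>s" for i d
    by (rule nth_equalityI) (auto simp: n_def s_def)
  have sat: "sat M ((\<lambda>v. s v i)(n := d)) ?\<phi> \<longleftrightarrow> d = fn M f (map (\<lambda>\<tau>. \<tau> i) \<tau>s)" for i d
    using vals[of i d] by (simp del: map_eq_conv add: comp_def)
  have wf: "wf_fm L ?\<phi>" using f by (simp add: n_def)
  from skolem[of ?\<phi> s, OF wf s, where x = n] obtain e where e: "e \<in> G"
    "\<And>i. (\<exists>d\<in>univ_of M. d = fn M f (map (\<lambda>\<tau>. \<tau> i) \<tau>s)) \<longrightarrow> e i = fn M f (map (\<lambda>\<tau>. \<tau> i) \<tau>s)"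
    unfolding sat by blast
  have "fn M f (map (\<lambda>\<tau>. \<tau> i) \<tau>s) \<in> univ_of M" for i
    by (rule structure_fn[OF structure_M]) (use f G_univ \<tau>s in auto)
  then have "e = (\<lambda>i. fn M f (map (\<lambda>\<tau>. \<tau> i) \<tau>s))" using e(2) by blast
  then show ?thesis using e(1) by simp
qed

lemma k_props:
  assumes "f \<in> G"
  shows "k (g f) \<in> G" "{i. k (g f) i = f i} \<in> U"
proof -
  show "k (g f) \<in> G" using assms by (simp add: inv_into_into)
  moreover have "g (k (g f)) = g f" using assms by (simp add: f_inv_into_f)
  ultimately show "{i. k (g f) i = f i} \<in> U" using g_eq assms by blast
qed

lemma k_map:
  assumes "set \<tau>s \<subseteq> G"
  shows "{i. map (\<lambda>d. k d i) (map g \<tau>s) = map (\<lambda>\<tau>. \<tau> i) \<tau>s} \<in> U"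
proof -
  have "{i. \<forall>\<tau>\<in>set \<tau>s. k (g \<tau>) i = \<tau> i} \<in> U"
    by (rule ultra_ball[OF ultra]) (use k_props(2) assms in auto)
  then show ?thesis by (rule ultra_up[OF ultra]) auto
qed

lemma los_term:
  assumes s: "\<And>v. s v \<in> G"
  shows "wf_tm L t \<Longrightarrow> (\<lambda>i. val M (\<lambda>v. s v i) t) \<in> G \<and>
    val N (\<lambda>v. g (s v)) t = g (\<lambda>i. val M (\<lambda>v. s v i) t)"
proof (induction t)
  case (Var v)
  then show ?case using s by simp
next
  case (Fn f ts)
  define \<tau>s where "\<tau>s = map (\<lambda>t i. val M (\<lambda>v. s v i) t) ts"
  have IH: "(\<lambda>i. val M (\<lambda>v. s v i) t) \<in> G" "val N (\<lambda>v. g (s v)) t = g (\<lambda>i. val M (\<lambda>v. s v i) t)"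
    if "t \<in> set ts" for t using Fn.IH[OF that] Fn.prems that by auto
  have \<tau>s: "set \<tau>s \<subseteq> G" using IH(1) by (auto simp: \<tau>s_def)
  have f: "(f, length \<tau>s) \<in> funs L" using Fn.prems by (simp add: \<tau>s_def)
  have vM: "val M (\<lambda>v. s v i) (Fn f ts) = fn M f (map (\<lambda>\<tau>. \<tau> i) \<tau>s)" for i
    by (simp add: \<tau>s_def comp_def)
  have vN: "map (val N (\<lambda>v. g (s v))) ts = map g \<tau>s" using IH(2) by (simp add: \<tau>s_def)
  \<comment> \<open>\<open>N\<close> applies function symbols to the chosen representatives, which
    agree with the given ones on a set of \<open>U\<close>.\<close>
  let ?\<tau>s = "map k (map g \<tau>s)"
  have "set ?\<tau>s \<subseteq> G" using \<tau>s k_props(1) by auto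
  then have G': "(\<lambda>i. fn M f (map (\<lambda>\<tau>. \<tau> i) ?\<tau>s)) \<in> G" using fn_G[of f ?\<tau>s] f by simp
  have G: "(\<lambda>i. fn M f (map (\<lambda>\<tau>. \<tau> i) \<tau>s)) \<in> G" by (rule fn_G[OF f \<tau>s])
  have eq: "map (\<lambda>d. k d i) (map g \<tau>s) = map (\<lambda>\<tau>. \<tau> i) ?\<tau>s" for i by simp
  have "val N (\<lambda>v. g (s v)) (Fn f ts) = g (\<lambda>i. fn M f (map (\<lambda>d. k d i) (map g \<tau>s)))"
    unfolding val.simps vN by (simp add: N_def)
  also have "\<dots> = g (\<lambda>i. fn M f (map (\<lambda>\<tau>. \<tau> i) ?\<tau>s))" unfolding eq ..
  also have "\<dots> = g (\<lambda>i. fn M f (map (\<lambda>\<tau>. \<tau> i) \<tau>s))"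
    unfolding g_eq[OF G' G]
    by (rule ultra_up[OF ultra k_map[OF \<tau>s]]) (auto simp: eq simp del: map_map map_eq_conv)
  finally show ?case unfolding vM using G by blast
qed

text \<open>Los's theorem for the Skolem-closed part. In the quantifier case the Skolem property
  supplies witnesses for all indices at once by a single member of \<open>G\<close>.\<close>

lemma los:
  "wf_fm L \<phi> \<Longrightarrow> (\<And>v. s v \<in> G) \<Longrightarrow> sat N (\<lambda>v. g (s v)) \<phi> \<longleftrightarrow> {i. sat M (\<lambda>v. s v i) \<phi>} \<in> U"
proof (induction \<phi> arbitrary: s)
  case Fls
  then show ?case using ultra_empty[OF ultra] by simp
next
  case (Eq t t')
  then show ?case using los_term[OF Eq.prems(2)] g_eq by simp
next
  case (Rel r ts)
  define \<tau>s where "\<tau>s = map (\<lambda>t i. val M (\<lambda>v. s v i) t) ts"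
  have wf: "wf_tm L t" if "t \<in> set ts" for t using Rel.prems(1) that by simp
  have \<tau>s: "set \<tau>s \<subseteq> G" using los_term[OF Rel.prems(2) wf] by (auto simp: \<tau>s_def)
  have vN: "map (val N (\<lambda>v. g (s v))) ts = map g \<tau>s"
    using los_term[OF Rel.prems(2) wf] by (simp add: \<tau>s_def)
  have vM: "map (val M (\<lambda>v. s v i)) ts = map (\<lambda>\<tau>. \<tau> i) \<tau>s" for i by (simp add: \<tau>s_def)
  let ?E = "{i. map (\<lambda>d. k d i) (map g \<tau>s) = map (\<lambda>\<tau>. \<tau> i) \<tau>s}"
  let ?A = "{i. rl M r (map (\<lambda>d. k d i) (map g \<tau>s))}" and ?A' = "{i. rl M r (map (\<lambda>\<tau>. \<tau> i) \<tau>s)}"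
  have E: "?E \<in> U" by (rule k_map[OF \<tau>s])
  have "?A \<inter> ?E \<subseteq> ?A'" "?A' \<inter> ?E \<subseteq> ?A" by (auto simp del: map_map map_eq_conv)
  then have "?A \<in> U \<longleftrightarrow> ?A' \<in> U" using ultra_up[OF ultra] ultra_inter[OF ultra _ E] by meson
  then show ?case unfolding sat.simps vN vM by (simp add: N_def del: map_map)
next
  case (Neg \<phi>)
  have "{i. sat M (\<lambda>v. s v i) (Neg \<phi>)} = - {i. sat M (\<lambda>v. s v i) \<phi>}" by auto
  then show ?case using Neg ultra_compl[OF ultra] by simp
next
  case (Conj \<phi> \<psi>)
  let ?A = "{i. sat M (\<lambda>v. s v i) \<phi>}" and ?A' = "{i. sat M (\<lambda>v. s v i) \<psi>}"
  have "{i. sat M (\<lambda>v. s v i) (Conj \<phi> \<psi>)} = ?A \<inter> ?A'" by auto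
  moreover have "?A \<inter> ?A' \<in> U \<longleftrightarrow> ?A \<in> U \<and> ?A' \<in> U"
    using ultra_up[OF ultra, of "?A \<inter> ?A'"] ultra_inter[OF ultra, of ?A ?A'] by blast
  ultimately show ?case using Conj by simp
next
  case (Ex x \<phi>)
  have upd: "(\<lambda>v. g (s v))(x := g f) = (\<lambda>v. g ((s(x := f)) v))" for f by auto
  have upd': "(\<lambda>v. (s(x := f)) v i) = (\<lambda>v. s v i)(x := f i)" for f i by auto
  have IH: "sat N ((\<lambda>v. g (s v))(x := g f)) \<phi> \<longleftrightarrow> {i. sat M ((\<lambda>v. s v i)(x := f i)) \<phi>} \<in> U"
    if f: "f \<in> G" for f
  proof -
    have "(s(x := f)) v \<in> G" for v using Ex.prems(2) f by simp
    from Ex.IH[OF _ this] show ?thesis unfolding upd upd'[symmetric] using Ex.prems(1) by simp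
  qed
  show ?case
  proof
    assume "sat N (\<lambda>v. g (s v)) (Ex x \<phi>)"
    then obtain f where f: "f \<in> G" "sat N ((\<lambda>v. g (s v))(x := g f)) \<phi>" by (auto simp: univ_N)
    then have "{i. sat M ((\<lambda>v. s v i)(x := f i)) \<phi>} \<in> U" using IH by blast
    then show "{i. sat M (\<lambda>v. s v i) (Ex x \<phi>)} \<in> U"
      by (rule ultra_up[OF ultra]) (use G_univ[OF f(1)] in auto)
  next
    assume *: "{i. sat M (\<lambda>v. s v i) (Ex x \<phi>)} \<in> U"
    obtain f where f: "f \<in> G"
      "\<And>i. (\<exists>d\<in>univ_of M. sat M ((\<lambda>v. s v i)(x := d)) \<phi>) \<longrightarrow> sat M ((\<lambda>v. s v i)(x := f i)) \<phi>"
      using skolem[of \<phi> s, where x = x] Ex.prems by auto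
    have "{i. sat M ((\<lambda>v. s v i)(x := f i)) \<phi>} \<in> U"
      by (rule ultra_up[OF ultra *]) (use f(2) in auto)
    then have "sat N ((\<lambda>v. g (s v))(x := g f)) \<phi>" using IH[OF f(1)] by simp
    then show "sat N (\<lambda>v. g (s v)) (Ex x \<phi>)" using f(1) by (auto simp: univ_N)
  qed
qed

lemma structure_N: "is_structure L N"
proof (rule structureI)
  show "univ_of N \<noteq> {}" using structure_M G_const by (auto simp: univ_N is_structure_def)
  fix f ds assume f: "(f, length ds) \<in> funs L" and ds: "set ds \<subseteq> univ_of N"
  have "k d \<in> G" if "d \<in> set ds" for d
    by (rule inv_into_into) (use ds that in \<open>auto simp: univ_N\<close>)
  then have "set (map k ds) \<subseteq> G" by auto
  then have "(\<lambda>i. fn M f (map (\<lambda>\<tau>. \<tau> i) (map k ds))) \<in> G" using fn_G[of f "map k ds"] f ds by simp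
  moreover have "map (\<lambda>\<tau>. \<tau> i) (map k ds) = map (\<lambda>d. k d i) ds" for i by simp
  ultimately have "(\<lambda>i. fn M f (map (\<lambda>d. k d i) ds)) \<in> G" by (simp only:)
  then show "fn N f ds \<in> univ_of N" by (simp add: N_def)
qed

lemma sat_N_const:
  assumes "wf_fm L \<phi>" "range s \<subseteq> univ_of M"
  shows "sat N (\<lambda>v. g (\<lambda>_. s v)) \<phi> = sat M s \<phi>"
proof -
  have "sat N (\<lambda>v. g (\<lambda>_. s v)) \<phi> \<longleftrightarrow> {i. sat M (\<lambda>v. s v) \<phi>} \<in> U"
    by (rule los[OF assms(1)]) (use assms(2) G_const in auto)
  then show ?thesis using ultra_UNIV[OF ultra] ultra_empty[OF ultra] by (cases "sat M s \<phi>") auto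
qed

end

text \<open>\<open>G0\<close> is closed in countably many stages. A stage adds one function for each
  formula, variable and finite list of earlier functions, so the size stays within that of
  \<open>'u\<close>.\<close>

lemma skolem_hull:
  fixes M :: "('f, 'r, 'u) struc" and G0 :: "('i \<Rightarrow> 'u) set"
  assumes inf: "infinite (UNIV :: 'u set)" and fms: "card_le TYPE('u) {\<phi>. wf_fm L \<phi>}"
    and ne: "univ_of M \<noteq> {}" and G0: "card_le TYPE('u) G0" "\<And>f i. f \<in> G0 \<Longrightarrow> f i \<in> univ_of M"
  shows "\<exists>G. G0 \<subseteq> G \<and> card_le TYPE('u) G \<and> (\<forall>f\<in>G. \<forall>i. f i \<in> univ_of M) \<and>
    (\<forall>\<phi> s x. wf_fm L \<phi> \<longrightarrow> (\<forall>v. s v \<in> G) \<longrightarrow> (\<exists>f\<in>G. \<forall>i.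
      (\<exists>d\<in>univ_of M. sat M ((\<lambda>v. s v i)(x := d)) \<phi>) \<longrightarrow> sat M ((\<lambda>v. s v i)(x := f i)) \<phi>))"
proof -
  obtain u where u: "u \<in> univ_of M" using ne by blast
  define sk where "sk \<phi> x s = (if \<exists>d\<in>univ_of M. sat M (s(x := d)) \<phi>
    then SOME d. d \<in> univ_of M \<and> sat M (s(x := d)) \<phi> else u)" for \<phi> :: "('f, 'r) fm" and x s
  have sk_ex: "sk \<phi> x s \<in> univ_of M \<and> sat M (s(x := sk \<phi> x s)) \<phi>"
    if ex: "\<exists>d\<in>univ_of M. sat M (s(x := d)) \<phi>" for \<phi> x s
  proof -
    have "\<exists>d. d \<in> univ_of M \<and> sat M (s(x := d)) \<phi>" using ex by blast
    from someI_ex[OF this] show ?thesis using ex by (simp add: sk_def)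
  qed
  have sk_univ: "sk \<phi> x s \<in> univ_of M" for \<phi> x s
    using sk_ex[of s x \<phi>] u by (cases "\<exists>d\<in>univ_of M. sat M (s(x := d)) \<phi>") (auto simp: sk_def)
  \<comment> \<open>A formula reads finitely many variables, so an assignment by functions is coded
    by a finite list; \<open>u\<close> is the value at all other variables.\<close>
  define asg where "asg xs i v = (if v < length xs then (xs ! v) i else u)"
    for xs :: "('i \<Rightarrow> 'u) list" and i and v :: nat
  define st where "st G = (\<lambda>((\<phi>, x), xs). \<lambda>i. sk \<phi> x (asg xs i)) ` (({\<phi>. wf_fm L \<phi>} \<times> UNIV) \<times> lists G)"
    for G :: "('i \<Rightarrow> 'u) set"
  define H where "H = rec_nat G0 (\<lambda>_ G. G \<union> st G)"
  have H0: "H 0 = G0" and HS: "H (Suc n) = H n \<union> st (H n)" for n by (simp_all add: H_def)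
  have Hc: "card_le TYPE('u) (H n)" for n
  proof (induction n)
    case 0
    then show ?case using G0 by (simp add: H0)
  next
    case (Suc n)
    have "card_le TYPE('u) (st (H n))" unfolding st_def
      by (intro card_le_image card_le_times[OF inf] card_le_lists[OF inf] Suc fms card_le_nat[OF inf])
    then show ?case unfolding HS by (rule card_le_Un[OF inf Suc])
  qed
  have Hu: "\<forall>f\<in>H n. \<forall>i. f i \<in> univ_of M" for n
  proof (induction n)
    case 0
    then show ?case using G0(2) by (simp add: H0)
  next
    case (Suc n)
    then show ?case using sk_univ by (auto simp: HS st_def)
  qed
  have Hmono: "H m \<subseteq> H n" if "m \<le> n" for m n
    using that by (rule lift_Suc_mono_le[rotated]) (simp add: HS)
  define G where "G = (\<Union>n\<in>UNIV. H n)"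
  have "\<exists>f\<in>G. \<forall>i. (\<exists>d\<in>univ_of M. sat M ((\<lambda>v. s v i)(x := d)) \<phi>) \<longrightarrow> sat M ((\<lambda>v. s v i)(x := f i)) \<phi>"
    if \<phi>: "wf_fm L \<phi>" and s: "\<forall>v. s v \<in> G" for \<phi> s x
  proof -
    obtain n where n: "\<forall>v\<in>fv \<phi>. v < n" using finite_fv[of \<phi>] finite_nat_set_iff_bounded by blast
    define xs where "xs = map s [0..<n]"
    have "\<forall>v. \<exists>m. s v \<in> H m" using s by (auto simp: G_def)
    then obtain m where m: "\<And>v. s v \<in> H (m v)" by metis
    \<comment> \<open>The finitely many functions that \<open>\<phi>\<close> reads all appear by a
      common stage.\<close>
    define k where "k = Max (insert 0 (m ` {0..<n}))"
    have "s v \<in> H k" if "v < n" for v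
    proof -
      have "m v \<le> k" unfolding k_def using that by (intro Max_ge) auto
      then show ?thesis using m[of v] Hmono by blast
    qed
    then have xs: "xs \<in> lists (H k)" by (auto simp: xs_def)
    let ?f = "\<lambda>i. sk \<phi> x (asg xs i)"
    have "?f \<in> st (H k)" unfolding st_def using xs \<phi> by (intro image_eqI[of _ _ "((\<phi>, x), xs)"]) auto
    then have "?f \<in> G" unfolding G_def using HS[of k] by blast
    moreover have agree: "sat M ((\<lambda>v. s v i)(x := d)) \<phi> = sat M ((asg xs i)(x := d)) \<phi>" for i d
      by (rule sat_cong) (use n in \<open>auto simp: asg_def xs_def\<close>)
    moreover have "sat M ((asg xs i)(x := ?f i)) \<phi>" if "\<exists>d\<in>univ_of M. sat M ((asg xs i)(x := d)) \<phi>" for i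
      using sk_ex[OF that] by simp
    ultimately show ?thesis by (intro bexI[of _ ?f]) simp_all
  qed
  moreover have "card_le TYPE('u) G" unfolding G_def by (rule card_le_UN[OF inf card_le_nat[OF inf] Hc])
  moreover have "G0 \<subseteq> G" unfolding G_def using H0 by blast
  moreover have "\<forall>f\<in>G. \<forall>i. f i \<in> univ_of M" unfolding G_def using Hu by blast
  ultimately show ?thesis by (intro exI[of _ G]) blast
qed

section \<open>Counting and realising types\<close>

lemma types_sub: "p \<in> types L M X A \<Longrightarrow> \<chi> \<in> p \<Longrightarrow> \<chi> \<in> pforms L X A"
  unfolding types_def by blast

lemma types_fin:
  "p \<in> types L M X A \<Longrightarrow> finite \<Gamma> \<Longrightarrow> \<Gamma> \<subseteq> p \<Longrightarrow> \<exists>c\<in>points M X. \<forall>\<chi>\<in>\<Gamma>. c \<in> sols M X \<chi>"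
  unfolding types_def by blast

lemma types_complete:
  assumes "p \<in> types L M X A" "\<chi> \<in> pforms L X A"
  shows "\<chi> \<in> p \<or> pneg \<chi> \<in> p"
proof -
  have "\<forall>(\<theta>, a)\<in>pforms L X A. (\<theta>, a) \<in> p \<or> (Neg \<theta>, a) \<in> p"
    using assms(1) by (simp add: types_def)
  from bspec[OF this assms(2)] show ?thesis by (cases \<chi>) simp
qed

lemma typesI:
  assumes "p \<subseteq> pforms L X A"
    and "\<And>\<Gamma>. \<Gamma> \<subseteq> p \<Longrightarrow> finite \<Gamma> \<Longrightarrow> \<exists>c\<in>points M X. \<forall>\<chi>\<in>\<Gamma>. c \<in> sols M X \<chi>"
    and "\<And>\<theta> a. (\<theta>, a) \<in> pforms L X A \<Longrightarrow> (\<theta>, a) \<in> p \<or> (Neg \<theta>, a) \<in> p"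
  shows "p \<in> types L M X A"
proof -
  have "\<forall>(\<theta>, a)\<in>pforms L X A. (\<theta>, a) \<in> p \<or> (Neg \<theta>, a) \<in> p" using assms(3) by blast
  then show ?thesis unfolding types_def using assms(1,2) by simp
qed

lemma types_nonempty: "p \<in> types L M X A \<Longrightarrow> \<chi> \<in> p \<Longrightarrow> sols M X \<chi> \<noteq> {}"
  using types_fin[of p L M X A "{\<chi>}"] by auto

lemma types_up:
  assumes "p \<in> types L M X A" "\<chi> \<in> p" "\<chi>' \<in> pforms L X A" "sols M X \<chi> \<subseteq> sols M X \<chi>'"
  shows "\<chi>' \<in> p"
proof (rule ccontr)
  assume "\<chi>' \<notin> p"
  then have "pneg \<chi>' \<in> p" using types_complete[OF assms(1,3)] by blast
  then obtain c where "c \<in> sols M X \<chi>" "c \<in> sols M X (pneg \<chi>')"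
    using types_fin[OF assms(1), of "{\<chi>, pneg \<chi>'}"] assms(2) by auto
  then show False using assms(4) by (auto simp: sols_pneg)
qed

lemma types_conj:
  assumes X: "finite X" and p: "p \<in> types L M X A" and \<chi>: "\<chi> \<in> p" "\<chi>' \<in> p"
  shows "pconj X \<chi> \<chi>' \<in> p"
proof (rule ccontr)
  assume "pconj X \<chi> \<chi>' \<notin> p"
  then have "pneg (pconj X \<chi> \<chi>') \<in> p"
    using types_complete[OF p pconj_pforms[OF X types_sub[OF p \<chi>(1)] types_sub[OF p \<chi>(2)]]] by blast
  then obtain c where "c \<in> sols M X \<chi>" "c \<in> sols M X \<chi>'" "c \<in> sols M X (pneg (pconj X \<chi> \<chi>'))"
    using types_fin[OF p, of "{\<chi>, \<chi>', pneg (pconj X \<chi> \<chi>')}"] \<chi> by auto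
  then show False by (simp add: sols_pneg sols_pconj[OF X])
qed

lemma types_neg:
  assumes "p \<in> types L M X A" "\<chi> \<in> pforms L X A"
  shows "pneg \<chi> \<in> p \<longleftrightarrow> \<chi> \<notin> p"
proof
  assume *: "pneg \<chi> \<in> p"
  show "\<chi> \<notin> p"
  proof
    assume "\<chi> \<in> p"
    then obtain c where "c \<in> sols M X \<chi>" "c \<in> sols M X (pneg \<chi>)"
      using types_fin[OF assms(1), of "{\<chi>, pneg \<chi>}"] * by auto
    then show False by (simp add: sols_pneg)
  qed
qed (use types_complete[OF assms] in blast)

lemma types_eqI:
  assumes "p \<in> types L M X A" "q \<in> types L M X A" "p \<subseteq> q"
  shows "p = q"
proof (intro equalityI assms(3) subsetI)
  fix \<chi> assume \<chi>: "\<chi> \<in> q"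
  show "\<chi> \<in> p"
    using types_neg[OF assms(1) types_sub[OF assms(2) \<chi>]] types_neg[OF assms(2) types_sub[OF assms(2) \<chi>]]
      \<chi> assms(3) by blast
qed

lemma types_Tru: "p \<in> types L M X A \<Longrightarrow> (Tru, a) \<in> p"
  using types_complete[OF _ Tru_pforms[of a], of p L M X A] types_nonempty[of p L M X A "pneg (Tru, a)"]
  by (auto simp: sols_def)

lemma ultrafilter_type:
  assumes U: "ultrafilter U" "points M X \<in> U"
  shows "{\<chi> \<in> pforms L X A. sols M X \<chi> \<in> U} \<in> types L M X A"
proof (rule typesI)
  fix \<Gamma> assume G: "\<Gamma> \<subseteq> {\<chi> \<in> pforms L X A. sols M X \<chi> \<in> U}" "finite \<Gamma>"
  have "{c. \<forall>\<chi>\<in>\<Gamma>. c \<in> sols M X \<chi>} \<in> U"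
    by (rule ultra_ball[OF U(1) G(2)]) (use G(1) in auto)
  then have "points M X \<inter> {c. \<forall>\<chi>\<in>\<Gamma>. c \<in> sols M X \<chi>} \<in> U" by (rule ultra_inter[OF U])
  then have "points M X \<inter> {c. \<forall>\<chi>\<in>\<Gamma>. c \<in> sols M X \<chi>} \<noteq> {}" using ultra_empty[OF U(1)] by metis
  then show "\<exists>c\<in>points M X. \<forall>\<chi>\<in>\<Gamma>. c \<in> sols M X \<chi>" by blast
next
  fix \<theta> a assume *: "(\<theta>, a) \<in> pforms L X A"
  have "sols M X (Neg \<theta>, a) \<in> U" if "sols M X (\<theta>, a) \<notin> U"
  proof -
    have "points M X \<inter> - sols M X (\<theta>, a) \<in> U"
      using that ultra_compl[OF U(1)] ultra_inter[OF U] by blast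
    then show ?thesis using sols_pneg[of M X "(\<theta>, a)"] by (simp add: Diff_eq)
  qed
  moreover have "(Neg \<theta>, a) \<in> pforms L X A" using * by (simp add: mem_pforms)
  ultimately show "(\<theta>, a) \<in> {\<chi> \<in> pforms L X A. sols M X \<chi> \<in> U} \<or> (Neg \<theta>, a) \<in> {\<chi> \<in> pforms L X A. sols M X \<chi> \<in> U}"
    using * by blast
qed auto

locale noetherian_setting =
  fixes L :: "('f, 'r) lang" and T :: "('f, 'r) fm set" and F :: "('f, 'r) partfm set"
    and ut :: "'u itself"
  assumes universe_large: "|{\<phi>. wf_fm L \<phi>}| \<le>o |UNIV :: 'u set|"
    and theory_T: "is_theory L T"
    and collection_F: "formula_collection L F"
    and noetherian_T: "noetherian_theory TYPE('u) L T F"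
begin

lemma card_le_formulas: "card_le TYPE('u) {\<phi>. wf_fm L \<phi>}"
  unfolding card_le_def by (rule universe_large)

text \<open>The iterated negations of \<open>Fls\<close> are infinitely many formulae in any
  language.\<close>

lemma infinite_universe: "infinite (UNIV :: 'u set)"
proof
  assume "finite (UNIV :: 'u set)"
  then have fin: "finite {\<phi>. wf_fm L \<phi>}" using universe_large card_of_ordLeq_finite by blast
  have size: "size ((Neg ^^ n) Fls :: ('f, 'r) fm) = n + size (Fls :: ('f, 'r) fm)" for n
    by (induction n) auto
  have "wf_fm L ((Neg ^^ n) Fls)" for n by (induction n) auto
  then have "range (\<lambda>n. (Neg ^^ n) Fls) \<subseteq> {\<phi>. wf_fm L \<phi>}" by blast
  then have "finite (range (\<lambda>n. (Neg ^^ n) Fls :: ('f, 'r) fm))" using fin finite_subset by blast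
  moreover have "inj (\<lambda>n. (Neg ^^ n) Fls :: ('f, 'r) fm)" by (rule injI) (metis size add_right_cancel)
  ultimately show False using finite_imageD by blast
qed

lemma model_locale:
  "is_model L T (M :: ('f, 'r, 'u) struc) \<Longrightarrow> finite X \<Longrightarrow> model_of_noetherian L T F M X"
  using theory_T collection_F noetherian_T by unfold_locales

text \<open>A definable set is given by a formula and a finite list of parameters.\<close>

lemma card_constructible:
  assumes "is_model L T (M :: ('f, 'r, 'u) struc)" "finite X"
  shows "card_le TYPE('u) (constructible (points M X) (instances F M X))"
proof -
  interpret model_of_noetherian L T F M X by (rule model_locale[OF assms])
  have "card_le TYPE('u) ((\<lambda>(\<theta>, xs). sols M X (\<theta>, \<lambda>i. xs ! i)) ` ({\<theta>. wf_fm L \<theta>} \<times> lists (UNIV :: 'u set)))"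
    by (intro card_le_image card_le_times[OF infinite_universe] card_le_formulas card_le_lists[OF infinite_universe] card_le_self)
  then show ?thesis
  proof (rule card_le_subset, intro subsetI)
    fix S assume "S \<in> B"
    then obtain \<theta> a where S: "(\<theta>, a) \<in> pforms L X (univ_of M)" "S = sols M X (\<theta>, a)"
      using constructible_sols by force
    obtain n where n: "\<forall>v\<in>fv \<theta>. v < n" using finite_fv[of \<theta>] finite_nat_set_iff_bounded by blast
    have "S = sols M X (\<theta>, \<lambda>i. map a [0..<n] ! i)"
      unfolding S(2) by (rule sols_cong) (use n in auto)
    then show "S \<in> (\<lambda>(\<theta>, xs). sols M X (\<theta>, \<lambda>i. xs ! i)) ` ({\<theta>. wf_fm L \<theta>} \<times> lists (UNIV :: 'u set))"
      using S(1) by (intro image_eqI[of _ _ "(\<theta>, map a [0..<n])"]) (auto simp: mem_pforms)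
  qed
qed

lemma card_closed:
  assumes "is_model L T (M :: ('f, 'r, 'u) struc)" "finite X"
  shows "card_le TYPE('u) (closed_sets (instances F M X))"
proof -
  interpret model_of_noetherian L T F M X by (rule model_locale[OF assms])
  show ?thesis by (rule card_le_subset[OF card_constructible[OF assms]]) (use closed_constructible in blast)
qed

text \<open>A type is determined by the least closed set it contains.\<close>

lemma card_types:
  assumes "is_model L T (M :: ('f, 'r, 'u) struc)" "finite X"
  shows "card_le TYPE('u) (types L M X (univ_of M))"
proof -
  interpret model_of_noetherian L T F M X by (rule model_locale[OF assms])
  let ?T = "types L M X (univ_of M)"
  \<comment> \<open>\<open>mem p\<close> is the ultrafilter of constructible sets that the type
    \<open>p\<close> induces.\<close>
  define mem where "mem p S \<longleftrightarrow> (\<exists>\<chi>\<in>p. sols M X \<chi> = S)" for p :: "('f, 'r, 'u) pform set" and S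
  have mem_iff: "mem p (sols M X \<chi>) \<longleftrightarrow> \<chi> \<in> p" if "p \<in> ?T" "\<chi> \<in> pforms L X (univ_of M)" for p \<chi>
    using types_up[OF that(1) _ that(2)] by (auto simp: mem_def)
  have mem_compl: "mem p (points M X - S) \<longleftrightarrow> \<not> mem p S" if p: "p \<in> ?T" and S: "S \<in> B" for p S
  proof -
    obtain \<chi> where \<chi>: "\<chi> \<in> pforms L X (univ_of M)" "S = sols M X \<chi>" using constructible_sols[OF S] by blast
    have "pneg \<chi> \<in> pforms L X (univ_of M)" using \<chi>(1) by (simp add: pneg_pforms)
    from mem_iff[OF p this] mem_iff[OF p \<chi>(1)] types_neg[OF p \<chi>(1)]
    show ?thesis by (simp add: sols_pneg \<chi>(2))
  qed
  have mem_up: "mem p S'" if p: "p \<in> ?T" and S: "mem p S" "S \<subseteq> S'" "S' \<in> B" for p S S'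
  proof -
    obtain \<chi> where \<chi>: "\<chi> \<in> p" "S = sols M X \<chi>" using S(1) by (auto simp: mem_def)
    obtain \<chi>' where \<chi>': "\<chi>' \<in> pforms L X (univ_of M)" "S' = sols M X \<chi>'" using constructible_sols[OF S(3)] by blast
    have "\<chi>' \<in> p" by (rule types_up[OF p \<chi>(1) \<chi>'(1)]) (use S(2) \<chi>(2) \<chi>'(2) in simp)
    then show ?thesis using \<chi>'(2) by (auto simp: mem_def)
  qed
  have mem_inter: "mem p (S \<inter> S') \<longleftrightarrow> mem p S \<and> mem p S'" if p: "p \<in> ?T" and S: "S \<in> B" "S' \<in> B" for p S S'
  proof
    assume "mem p (S \<inter> S')"
    then show "mem p S \<and> mem p S'" using mem_up[OF p] S by blast
  next
    assume "mem p S \<and> mem p S'"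
    then obtain \<chi> \<chi>' where \<chi>: "\<chi> \<in> p" "S = sols M X \<chi>" "\<chi>' \<in> p" "S' = sols M X \<chi>'" by (auto simp: mem_def)
    then have "pconj X \<chi> \<chi>' \<in> p" by (intro types_conj[OF assms(2) p])
    moreover have "sols M X (pconj X \<chi> \<chi>') = S \<inter> S'" using \<chi> by (simp add: sols_pconj[OF assms(2)])
    ultimately show "mem p (S \<inter> S')" by (auto simp: mem_def)
  qed
  have "\<exists>Z. closed Z \<and> mem p Z \<and> (\<forall>Z'. closed Z' \<longrightarrow> mem p Z' \<longrightarrow> Z' \<subseteq> Z \<longrightarrow> Z' = Z)" if p: "p \<in> ?T" for p
  proof -
    have "mem p (points M X)" using types_Tru[OF p, of undefined] sols_Tru[of M X undefined] by (auto simp: mem_def)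
    from closed_minimal[OF closed_top, of "mem p", OF this] show ?thesis by blast
  qed
  then have "\<forall>p\<in>?T. \<exists>Z. closed Z \<and> mem p Z \<and> (\<forall>Z'. closed Z' \<longrightarrow> mem p Z' \<longrightarrow> Z' \<subseteq> Z \<longrightarrow> Z' = Z)" by blast
  from bchoice[OF this] obtain z where
    z': "\<forall>p\<in>?T. closed (z p) \<and> mem p (z p) \<and> (\<forall>Z'. closed Z' \<longrightarrow> mem p Z' \<longrightarrow> Z' \<subseteq> z p \<longrightarrow> Z' = z p)" ..
  have z: "closed (z p)" "mem p (z p)" "closed Z' \<Longrightarrow> mem p Z' \<Longrightarrow> Z' \<subseteq> z p \<Longrightarrow> Z' = z p"
    if "p \<in> ?T" for p Z' using bspec[OF z' that] by blast+
  \<comment> \<open>Since \<open>p\<close> is closed under conjunction, the minimal closed set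
    \<open>z p\<close> is the least one.\<close>
  have mem_closed: "mem p W \<longleftrightarrow> z p \<subseteq> W" if p: "p \<in> ?T" and W: "closed W" for p W
  proof
    assume "mem p W"
    then have "mem p (W \<inter> z p)" using mem_inter[OF p closed_constructible[OF W] closed_constructible[OF z(1)[OF p]]] z(2)[OF p] by blast
    then have "W \<inter> z p = z p" using z(3)[OF p closed_inter[OF W z(1)[OF p]]] by blast
    then show "z p \<subseteq> W" by blast
  qed (use mem_up[OF p z(2)[OF p] _ closed_constructible[OF W]] in blast)
  have "inj_on z ?T"
  proof (rule inj_onI)
    fix p q assume p: "p \<in> ?T" and q: "q \<in> ?T" and eq: "z p = z q"
    \<comment> \<open>The closed members of a type determine its constructible members, by induction
      on the Boolean combination.\<close>
    have same: "mem p S \<longleftrightarrow> mem q S" if "S \<in> B" for S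
      using that
    proof (induction rule: constructible.induct)
      case (base S)
      then show ?case using mem_closed[OF p closed_base] mem_closed[OF q closed_base] eq by simp
    next
      case (compl S)
      then show ?case using mem_compl[OF p] mem_compl[OF q] by simp
    next
      case (inter S S')
      then show ?case using mem_inter[OF p] mem_inter[OF q] by simp
    qed
    show "p = q"
    proof (rule types_eqI[OF p q], rule subsetI)
      fix \<chi> assume \<chi>: "\<chi> \<in> p"
      note \<chi>' = types_sub[OF p \<chi>]
      show "\<chi> \<in> q" using \<chi> mem_iff[OF p \<chi>'] mem_iff[OF q \<chi>'] same[OF sols_constructible[OF \<chi>']] by blast
    qed
  qed
  moreover have "z ` ?T \<subseteq> closed_sets (instances F M X)" using z(1) by blast
  ultimately have "|?T| \<le>o |closed_sets (instances F M X)|" unfolding card_of_ordLeq[symmetric] by blast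
  then show ?thesis using card_closed[OF assms] unfolding card_le_def by (rule ordLeq_transitive)
qed

text \<open>A single ultrapower realises all types over \<open>M\<close> in all finite tuples: at an
  index \<open>\<Gamma>\<close>, a type is represented by a point that satisfies those of its
  formulae which \<open>\<Gamma>\<close> lists. The hull of the constants and the coordinates of
  these points has at most as many elements as \<open>'u\<close>, because there are few types; the
  free room in the conclusion allows iteration.\<close>

lemma elementary_step:
  fixes M :: "('f, 'r, 'u) struc" and h :: "'u \<Rightarrow> 'u"
  assumes M: "is_model L T M" and h: "inj_on h (univ_of M)"
    and room: "|UNIV :: 'u set| \<le>o |UNIV - h ` univ_of M|"
  shows "\<exists>M' :: ('f, 'r, 'u) struc. is_structure L M' \<and> elementary_embedding L M M' h \<and>
    |UNIV :: 'u set| \<le>o |UNIV - univ_of M'| \<and>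
    (\<forall>X p. finite X \<longrightarrow> p \<in> types L M X (univ_of M) \<longrightarrow> (\<exists>c\<in>points M' X. \<forall>\<chi>\<in>p. c \<in> sols M' X (map_params h \<chi>)))"
proof -
  have str: "is_structure L M" using M by (simp add: is_model_def)
  then obtain u0 where u0: "u0 \<in> univ_of M" by (auto simp: is_structure_def)
  \<comment> \<open>Indices are sets of pairs of a tuple and a formula. The ultrafilter contains
    every \<open>E x\<close>, so it concentrates on the finite sets, and on those that list any
    prescribed formula.\<close>
  define E where "E x = {\<Gamma>. finite \<Gamma> \<and> x \<in> \<Gamma>}" for x :: "nat set \<times> ('f, 'r, 'u) pform"
  have "fip (range E)" unfolding fip_def
  proof (intro allI impI)
    fix \<F> assume F: "\<F> \<subseteq> range E" "finite \<F>"
    obtain J where J: "finite J" "\<F> = E ` J" using finite_subset_image[OF F(2,1)] by blast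
    then have "J \<in> \<Inter>\<F>" by (auto simp: E_def)
    then show "\<Inter>\<F> \<noteq> {}" by blast
  qed
  then obtain U where U: "ultrafilter U" "range E \<subseteq> U" using ultrafilter_exists by blast
  let ?K = "SIGMA X:{X. finite X}. types L M X (univ_of M)"
  define c where "c = (\<lambda>(X, p) \<Gamma>. SOME c. c \<in> points M X \<and> (\<forall>\<chi>\<in>{\<chi> \<in> p. (X, \<chi>) \<in> \<Gamma>}. c \<in> sols M X \<chi>))"
  have c: "c (X, p) \<Gamma> \<in> points M X \<and> (\<forall>\<chi>\<in>{\<chi> \<in> p. (X, \<chi>) \<in> \<Gamma>}. c (X, p) \<Gamma> \<in> sols M X \<chi>)"
    if "p \<in> types L M X (univ_of M)" "finite \<Gamma>" for X p \<Gamma>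
  proof -
    have "finite (Pair X -` \<Gamma>)" by (rule finite_vimageI[OF that(2)]) (simp add: inj_on_def)
    then have "finite {\<chi> \<in> p. (X, \<chi>) \<in> \<Gamma>}" by (rule finite_subset[rotated]) auto
    then have "\<exists>c. c \<in> points M X \<and> (\<forall>\<chi>\<in>{\<chi> \<in> p. (X, \<chi>) \<in> \<Gamma>}. c \<in> sols M X \<chi>)"
      using types_fin[OF that(1)] by blast
    from someI_ex[OF this] show ?thesis by (simp add: c_def)
  qed
  \<comment> \<open>The coordinate \<open>v\<close> of the representing point. The default
    \<open>u0\<close> at infinite indices, which \<open>U\<close> ignores, keeps all values in
    \<open>M\<close>.\<close>
  define cr where "cr x v \<Gamma> = (if finite \<Gamma> \<and> v \<in> fst x then c x \<Gamma> v else u0)" for x v \<Gamma>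
  have cr: "cr x v \<Gamma> \<in> univ_of M" if "x \<in> ?K" for x v \<Gamma>
  proof (cases "finite \<Gamma> \<and> v \<in> fst x")
    case True
    obtain X p where x: "x = (X, p)" by fastforce
    then have "c x \<Gamma> \<in> points M X" using c[of p X \<Gamma>] that True by auto
    then show ?thesis using True x by (auto simp: cr_def points_def)
  next
    case False
    then show ?thesis using u0 by (auto simp: cr_def)
  qed
  define G0 where "G0 = (\<lambda>m _. m) ` univ_of M \<union> (\<lambda>(x, v). cr x v) ` (?K \<times> UNIV)"
  have cX: "card_le TYPE('u) {X :: nat set. finite X}"
  proof -
    have "card_le TYPE('u) (set ` lists (UNIV :: nat set))"
      by (intro card_le_image card_le_lists[OF infinite_universe] card_le_nat[OF infinite_universe])
    then show ?thesis by (rule card_le_subset) (use finite_list in force)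
  qed
  have K: "?K = (\<Union>X\<in>{X. finite X}. Pair X ` types L M X (univ_of M))" by auto
  have cK: "card_le TYPE('u) ?K"
    unfolding K by (rule card_le_UN[OF infinite_universe cX], rule card_le_image, rule card_types[OF M]) simp
  have cG0: "card_le TYPE('u) G0" unfolding G0_def
    by (intro card_le_Un[OF infinite_universe] card_le_image card_le_times[OF infinite_universe] cK card_le_nat[OF infinite_universe] card_le_self)
  have uG0: "f i \<in> univ_of M" if "f \<in> G0" for f i
    using that cr unfolding G0_def by force
  have ne: "univ_of M \<noteq> {}" using u0 by blast
  have "\<exists>G. G0 \<subseteq> G \<and> card_le TYPE('u) G \<and> (\<forall>f\<in>G. \<forall>i. f i \<in> univ_of M) \<and>
    (\<forall>\<phi> s x. wf_fm L \<phi> \<longrightarrow> (\<forall>v. s v \<in> G) \<longrightarrow> (\<exists>f\<in>G. \<forall>i.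
      (\<exists>d\<in>univ_of M. sat M ((\<lambda>v. s v i)(x := d)) \<phi>) \<longrightarrow> sat M ((\<lambda>v. s v i)(x := f i)) \<phi>))"
    by (rule skolem_hull[OF infinite_universe card_le_formulas ne cG0]) (rule uG0)
  then obtain G where G: "G0 \<subseteq> G" "card_le TYPE('u) G" "\<forall>f\<in>G. \<forall>i. f i \<in> univ_of M"
    "\<forall>\<phi> s x. wf_fm L \<phi> \<longrightarrow> (\<forall>v. s v \<in> G) \<longrightarrow> (\<exists>f\<in>G. \<forall>i.
      (\<exists>d\<in>univ_of M. sat M ((\<lambda>v. s v i)(x := d)) \<phi>) \<longrightarrow> sat M ((\<lambda>v. s v i)(x := f i)) \<phi>)"
    by (elim exE conjE)
  have constG: "(\<lambda>_. m) \<in> G" if "m \<in> univ_of M" for m using that G(1) by (auto simp: G0_def)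
  \<comment> \<open>\<open>R1\<close> provides names for the new elements, and \<open>R2\<close>
    stays outside the new universe.\<close>
  obtain R1 R2 where R: "R1 \<union> R2 \<subseteq> UNIV - h ` univ_of M" "R1 \<inter> R2 = {}" "|UNIV :: 'u set| \<le>o |R1|" "|UNIV :: 'u set| \<le>o |R2|"
    using split_room[OF infinite_universe room] by auto
  obtain e where e: "inj_on e G" "e ` G \<subseteq> R1" using card_le_inj[OF G(2) R(3)] by blast
  define eqv where "eqv f f' \<longleftrightarrow> {i. f i = f' i} \<in> U" for f f' :: "(nat set \<times> ('f, 'r, 'u) pform) set \<Rightarrow> 'u"
  have eqv_refl: "eqv f f" for f using ultra_UNIV[OF U(1)] by (simp add: eqv_def)
  have eqv_sym: "eqv f' f" if "eqv f f'" for f f' using that by (simp add: eqv_def eq_commute)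
  have eqv_trans: "eqv f f''" if "eqv f f'" "eqv f' f''" for f f' f''
    unfolding eqv_def by (rule ultra_up[OF U(1) ultra_inter[OF U(1) that[unfolded eqv_def]]]) auto
  have eqv_const: "m = m'" if "eqv (\<lambda>_. m) (\<lambda>_. m')" for m m'
    using that ultra_empty[OF U(1)] by (cases "m = m'") (auto simp: eqv_def)
  define rp where "rp f = (SOME f'. f' \<in> G \<and> eqv f' f)" for f
  have rp: "rp f \<in> G" "eqv (rp f) f" if "f \<in> G" for f
  proof -
    have "\<exists>f'. f' \<in> G \<and> eqv f' f" using that eqv_refl by blast
    from someI_ex[OF this] show "rp f \<in> G" "eqv (rp f) f" by (auto simp: rp_def)
  qed
  have rp_eq: "rp f = rp f'" if "eqv f f'" for f f'
  proof -
    have "eqv f'' f \<longleftrightarrow> eqv f'' f'" for f'' using that eqv_trans eqv_sym by blast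
    then show ?thesis by (simp add: rp_def)
  qed
  define isc where "isc f m \<longleftrightarrow> m \<in> univ_of M \<and> eqv f (\<lambda>_. m)" for f m
  have isc_unique: "m = m'" if "isc f m" "isc f m'" for f m m'
    using that eqv_const eqv_trans eqv_sym unfolding isc_def by metis
  \<comment> \<open>The classes of constants are named by \<open>h\<close>, which thereby becomes
    the diagonal embedding; every other class gets a name in \<open>R1\<close>, disjoint from the
    image of \<open>M\<close>.\<close>
  define g where "g f = (if \<exists>m. isc f m then h (THE m. isc f m) else e (rp f))" for f
  have g_isc: "g f = h m" if "isc f m" for f m
  proof -
    have "(THE m. isc f m) = m" by (rule the_equality) (use isc_unique that in blast)+
    then show ?thesis using that by (auto simp: g_def)
  qed
  have g_else: "g f = e (rp f)" if "\<nexists>m. isc f m" for f using that by (auto simp: g_def)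
  have disj: "h m \<noteq> e f" if "m \<in> univ_of M" "f \<in> G" for m f
    using R(1) e(2) that by auto
  have g_eq: "g f = g f' \<longleftrightarrow> eqv f f'" if f: "f \<in> G" "f' \<in> G" for f f'
  proof
    assume eq: "eqv f f'"
    show "g f = g f'"
    proof (cases "\<exists>m. isc f m")
      case True
      then obtain m where m: "isc f m" by blast
      then have "isc f' m" using eq eqv_sym eqv_trans unfolding isc_def by blast
      then show ?thesis using g_isc m by metis
    next
      case False
      then have "\<nexists>m. isc f' m" using eq eqv_trans unfolding isc_def by blast
      then show ?thesis using g_else[OF False] g_else rp_eq[OF eq] by metis
    qed
  next
    assume eq: "g f = g f'"
    consider m m' where "isc f m" "isc f' m'" | m where "isc f m" "\<nexists>m. isc f' m"
      | m where "\<nexists>m. isc f m" "isc f' m" | "\<nexists>m. isc f m" "\<nexists>m. isc f' m" by blast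
    then show "eqv f f'"
    proof cases
      case 1
      then have "h m = h m'" using eq g_isc by metis
      then have "m = m'" using h 1 by (auto simp: isc_def dest: inj_onD)
      then show ?thesis using 1 eqv_sym eqv_trans unfolding isc_def by blast
    next
      case 2
      then have "h m = e (rp f')" using eq g_isc g_else by metis
      then show ?thesis using disj[of m "rp f'"] rp(1)[OF f(2)] 2(1) by (simp add: isc_def)
    next
      case 3
      then have "h m = e (rp f)" using eq g_isc g_else by metis
      then show ?thesis using disj[of m "rp f"] rp(1)[OF f(1)] 3(2) by (simp add: isc_def)
    next
      case 4
      then have "e (rp f) = e (rp f')" using eq g_else by metis
      then have "rp f = rp f'" using e(1) rp(1) f by (auto dest: inj_onD)
      then show ?thesis using rp(2)[OF f(1)] rp(2)[OF f(2)] eqv_sym eqv_trans by metis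
    qed
  qed
  interpret S: skolem_ultrapower L M U G g
    by unfold_locales (use str U(1) G(3) constG G(4) g_eq in \<open>auto simp: eqv_def\<close>)
  have g_const: "g (\<lambda>_. m) = h m" if "m \<in> univ_of M" for m
    by (rule g_isc) (simp add: isc_def that eqv_refl)
  have emb: "elementary_embedding L M S.N h" unfolding elementary_embedding_def
  proof (intro conjI allI impI)
    show "h ` univ_of M \<subseteq> univ_of S.N" using g_const constG by (force simp: S.univ_N)
    fix \<phi> and s :: "nat \<Rightarrow> 'u" assume *: "wf_fm L \<phi> \<and> range s \<subseteq> univ_of M"
    have "(\<lambda>v. g (\<lambda>_. s v)) = h \<circ> s" using * g_const by (auto simp: fun_eq_iff)
    then show "sat M s \<phi> = sat S.N (h \<circ> s) \<phi>" using S.sat_N_const[of \<phi> s] * by simp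
  qed
  have "g f \<in> h ` univ_of M \<union> R1" if "f \<in> G" for f
  proof (cases "\<exists>m. isc f m")
    case True
    then obtain m where "isc f m" by blast
    then show ?thesis using g_isc by (auto simp: isc_def)
  next
    case False
    then show ?thesis using g_else rp(1)[OF that] e(2) by auto
  qed
  then have "R2 \<subseteq> UNIV - univ_of S.N" unfolding S.univ_N using R(1,2) by blast
  then have room': "|UNIV :: 'u set| \<le>o |UNIV - univ_of S.N|"
    using R(4) card_of_mono1 ordLeq_transitive by metis
  have real: "\<exists>c\<in>points S.N X. \<forall>\<chi>\<in>p. c \<in> sols S.N X (map_params h \<chi>)"
    if X: "finite X" and p: "p \<in> types L M X (univ_of M)" for X p
  proof -
    let ?x = "(X, p)"
    have crG: "cr ?x v \<in> G" for v
    proof -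
      have "cr ?x v \<in> G0" unfolding G0_def using X p by (intro UnI2 image_eqI[of _ _ "(?x, v)"]) auto
      then show ?thesis using G(1) by blast
    qed
    define d where "d = restrict (\<lambda>v. g (cr ?x v)) X"
    have d: "d \<in> points S.N X" using crG by (auto simp: d_def points_def S.univ_N)
    have "d \<in> sols S.N X (map_params h \<chi>)" if \<chi>: "\<chi> \<in> p" for \<chi>
    proof -
      obtain \<theta> a where eq: "\<chi> = (\<theta>, a)" by fastforce
      have pf: "(\<theta>, a) \<in> pforms L X (univ_of M)" using types_sub[OF p \<chi>] eq by simp
      define s where "s v = (if v \<in> X then cr ?x v else if v \<in> fv \<theta> then (\<lambda>_. a v) else (\<lambda>_. u0))" for v
      have sG: "s v \<in> G" for v using crG constG pf u0 by (auto simp: s_def mem_pforms)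
      \<comment> \<open>At each finite index that lists \<open>(X, \<chi>)\<close> the chosen point
        satisfies \<open>\<chi>\<close>, so Los's theorem applies.\<close>
      have "E (X, \<chi>) \<subseteq> {i. sat M (\<lambda>v. s v i) \<theta>}"
      proof
        fix \<Gamma> assume "\<Gamma> \<in> E (X, \<chi>)"
        then have \<Gamma>: "finite \<Gamma>" "(X, \<chi>) \<in> \<Gamma>" by (auto simp: E_def)
        have "c ?x \<Gamma> \<in> sols M X \<chi>" using c[OF p \<Gamma>(1)] \<chi> \<Gamma>(2) by blast
        then have "sat M (override_on a (c ?x \<Gamma>) X) \<theta>" by (simp add: eq mem_sols)
        moreover have "sat M (override_on a (c ?x \<Gamma>) X) \<theta> = sat M (\<lambda>v. s v \<Gamma>) \<theta>"
          by (rule sat_cong) (auto simp: override_on_def s_def cr_def \<Gamma>(1))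
        ultimately show "\<Gamma> \<in> {i. sat M (\<lambda>v. s v i) \<theta>}" by simp
      qed
      then have "{i. sat M (\<lambda>v. s v i) \<theta>} \<in> U" using ultra_up[OF U(1)] U(2) by blast
      then have "sat S.N (\<lambda>v. g (s v)) \<theta>" using S.los[of \<theta> s] sG pf by (simp add: mem_pforms)
      moreover have "sat S.N (\<lambda>v. g (s v)) \<theta> = sat S.N (override_on (h \<circ> a) d X) \<theta>"
        by (rule sat_cong) (use pf g_const in \<open>auto simp: override_on_def s_def d_def mem_pforms\<close>)
      ultimately show ?thesis using d by (simp add: eq mem_sols)
    qed
    then show ?thesis using d by blast
  qed
  show ?thesis by (intro exI[of _ S.N] conjI S.structure_N emb room' allI impI real)
qed

end

section \<open>Saturated extensions and invariance of Morley rank\<close>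

lemma elementary_id: "elementary_embedding L M M id"
  by (simp add: elementary_embedding_def)

lemma elementary_comp:
  fixes M N K :: "('f, 'r, 'u) struc"
  assumes "elementary_embedding L M N h" "elementary_embedding L N K h'"
  shows "elementary_embedding L M K (h' \<circ> h)"
  unfolding elementary_embedding_def
proof (intro conjI allI impI)
  have u: "h ` univ_of M \<subseteq> univ_of N" "h' ` univ_of N \<subseteq> univ_of K"
    using assms by (simp_all add: elementary_embedding_def)
  then show "(h' \<circ> h) ` univ_of M \<subseteq> univ_of K" by auto
  fix \<phi> and s :: "nat \<Rightarrow> 'u" assume s: "wf_fm L \<phi> \<and> range s \<subseteq> univ_of M"
  then have "range (h \<circ> s) \<subseteq> univ_of N" using u(1) by auto
  then have "sat N (h \<circ> s) \<phi> = sat K (h' \<circ> (h \<circ> s)) \<phi>"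
    using assms(2) s unfolding elementary_embedding_def by blast
  moreover have "sat M s \<phi> = sat N (h \<circ> s) \<phi>"
    using assms(1) s unfolding elementary_embedding_def by blast
  ultimately show "sat M s \<phi> = sat K (h' \<circ> h \<circ> s) \<phi>" by (simp only: comp_assoc)
qed

lemma val_univ:
  assumes "is_structure L M" "range s \<subseteq> univ_of M"
  shows "wf_tm L t \<Longrightarrow> val M s t \<in> univ_of M"
proof (induction t)
  case (Var i)
  then show ?case using assms(2) by auto
next
  case (Fn f ts)
  have "fn M f (map (val M s) ts) \<in> univ_of M"
    by (rule structure_fn[OF assms(1)]) (use Fn in auto)
  then show ?case by simp
qed

text \<open>The graph of \<open>f\<close> is defined by an equation, which the elementary inclusion
  preserves. Hence the interpretations along a chain can be glued.\<close>

lemma elementary_fn: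
  fixes M N :: "('f, 'r, 'u) struc"
  assumes h: "elementary_embedding L M N id" and M: "is_structure L M"
    and f: "(f, length ds) \<in> funs L" and ds: "set ds \<subseteq> univ_of M"
  shows "fn N f ds = fn M f ds"
proof -
  define n where "n = length ds"
  let ?e = "fn M f ds"
  have e: "?e \<in> univ_of M" by (rule structure_fn[OF M f ds])
  define s where "s v = (if v < n then ds ! v else ?e)" for v
  have s: "range s \<subseteq> univ_of M" using ds e by (auto simp: s_def n_def)
  have vs: "map (val K s \<circ> Var) [0..<n] = ds" for K :: "('f, 'r, 'u) struc"
    by (rule nth_equalityI) (auto simp: n_def s_def)
  have sat: "sat K s (Eq (Var n) (Fn f (map Var [0..<n]))) \<longleftrightarrow> ?e = fn K f ds" for K :: "('f, 'r, 'u) struc"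
    using vs[of K] by (simp add: s_def del: map_eq_conv)
  have "sat M s (Eq (Var n) (Fn f (map Var [0..<n])))
      = sat N (id \<circ> s) (Eq (Var n) (Fn f (map Var [0..<n])))"
    by (rule elementary_sat[OF h]) (use M f s in \<open>auto simp: is_structure_def n_def\<close>)
  then show ?thesis using sat[of M] sat[of N] by simp
qed

lemma elementary_rl:
  fixes M N :: "('f, 'r, 'u) struc"
  assumes h: "elementary_embedding L M N id" and M: "is_structure L M"
    and r: "(r, length ds) \<in> rels L" and ds: "set ds \<subseteq> univ_of M"
  shows "rl N r ds = rl M r ds"
proof -
  define n where "n = length ds"
  obtain e where e: "e \<in> univ_of M" using M by (auto simp: is_structure_def)
  define s where "s v = (if v < n then ds ! v else e)" for v
  have s: "range s \<subseteq> univ_of M" using ds e by (auto simp: s_def n_def)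
  have vs: "map (val K s \<circ> Var) [0..<n] = ds" for K :: "('f, 'r, 'u) struc"
    by (rule nth_equalityI) (auto simp: n_def s_def)
  have sat: "sat K s (Rel r (map Var [0..<n])) \<longleftrightarrow> rl K r ds" for K :: "('f, 'r, 'u) struc"
    using vs[of K] by (simp del: map_eq_conv)
  have "sat M s (Rel r (map Var [0..<n])) = sat N (id \<circ> s) (Rel r (map Var [0..<n]))"
    by (rule elementary_sat[OF h]) (use M r s in \<open>auto simp: is_structure_def n_def\<close>)
  then show ?thesis using sat[of M] sat[of N] by simp
qed

text \<open>The elementary chain theorem. Satisfaction in the union is compared with satisfaction in
  every stage that contains the assignment; the stage must vary in the induction because a witness
  may appear later.\<close>

lemma chain_union:
  fixes K :: "nat \<Rightarrow> ('f, 'r, 'u) struc"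
  assumes str: "\<And>n. is_structure L (K n)" and emb: "\<And>n. elementary_embedding L (K n) (K (Suc n)) id"
  shows "\<exists>N. is_structure L N \<and> univ_of N = (\<Union>n. univ_of (K n)) \<and> (\<forall>n. elementary_embedding L (K n) N id)"
proof -
  have le: "elementary_embedding L (K m) (K n) id" if "m \<le> n" for m n
    using that
  proof (induction n rule: dec_induct)
    case base
    show ?case by (rule elementary_id)
  next
    case (step n)
    from elementary_comp[OF step.IH emb[of n]] show ?case by simp
  qed
  then have mono: "univ_of (K m) \<subseteq> univ_of (K n)" if "m \<le> n" for m n
    using that by (auto simp: elementary_embedding_def)
  \<comment> \<open>Symbols are evaluated in the first stage that contains all the arguments; every
    later stage gives the same value.\<close>
  define k where "k ds = (LEAST n. set ds \<subseteq> univ_of (K n))" for ds :: "'u list"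
  have k: "set ds \<subseteq> univ_of (K (k ds))" "k ds \<le> n" if "set ds \<subseteq> univ_of (K n)" for ds n
    using that unfolding k_def by (rule LeastI, rule Least_le)
  define N :: "('f, 'r, 'u) struc" where
    "N = \<lparr>univ_of = (\<Union>n. univ_of (K n)), fn = (\<lambda>f ds. fn (K (k ds)) f ds), rl = (\<lambda>r ds. rl (K (k ds)) r ds)\<rparr>"
  have uN: "univ_of N = (\<Union>n. univ_of (K n))" by (simp add: N_def)
  have fnN: "fn N f ds = fn (K n) f ds" if "(f, length ds) \<in> funs L" "set ds \<subseteq> univ_of (K n)" for f ds n
    using elementary_fn[OF le[OF k(2)[OF that(2)]] str that(1) k(1)[OF that(2)]] by (simp add: N_def)
  have rlN: "rl N r ds = rl (K n) r ds" if "(r, length ds) \<in> rels L" "set ds \<subseteq> univ_of (K n)" for r ds n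
    using elementary_rl[OF le[OF k(2)[OF that(2)]] str that(1) k(1)[OF that(2)]] by (simp add: N_def)
  have valN: "val N s t = val (K n) s t" if s: "range s \<subseteq> univ_of (K n)" and t: "wf_tm L t" for s t n
    using t
  proof (induction t)
    case (Fn f ts)
    have "map (val N s) ts = map (val (K n) s) ts" using Fn by simp
    moreover have "fn N f (map (val (K n) s) ts) = fn (K n) f (map (val (K n) s) ts)"
      by (rule fnN) (use Fn.prems val_univ[OF str s] in auto)
    ultimately show ?case by (simp only: val.simps)
  qed simp
  have satN: "wf_fm L \<phi> \<Longrightarrow> range s \<subseteq> univ_of (K n) \<Longrightarrow> sat N s \<phi> = sat (K n) s \<phi>" for \<phi> s n
  proof (induction \<phi> arbitrary: s n)
    case (Eq t t')
    then show ?case using valN[OF Eq.prems(2)] by simp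
  next
    case (Rel r ts)
    have "map (val N s) ts = map (val (K n) s) ts" using Rel.prems(1) valN[OF Rel.prems(2)] by simp
    moreover have "rl N r (map (val (K n) s) ts) = rl (K n) r (map (val (K n) s) ts)"
      by (rule rlN) (use Rel.prems val_univ[OF str Rel.prems(2)] in auto)
    ultimately show ?case by (simp only: sat.simps)
  next
    case (Ex i \<phi>)
    have wf: "wf_fm L \<phi>" using Ex.prems by simp
    show ?case
    proof
      assume "sat N s (Ex i \<phi>)"
      then obtain d m where d: "d \<in> univ_of (K m)" "sat N (s(i := d)) \<phi>" by (auto simp: uN)
      \<comment> \<open>The witness in the union lies in some stage; elementarity between two stages
        brings the existential statement back to stage \<open>n\<close>.\<close>
      let ?m = "max m n"
      have "range s \<subseteq> univ_of (K ?m)" "d \<in> univ_of (K ?m)"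
        using Ex.prems(2) d(1) mono[of n ?m] mono[of m ?m] by auto
      then have "range (s(i := d)) \<subseteq> univ_of (K ?m)" by auto
      then have "sat (K ?m) (s(i := d)) \<phi>" using Ex.IH[OF wf] d(2) by blast
      then have "sat (K ?m) (id \<circ> s) (Ex i \<phi>)" using \<open>d \<in> univ_of (K ?m)\<close> by auto
      moreover have "sat (K n) s (Ex i \<phi>) = sat (K ?m) (id \<circ> s) (Ex i \<phi>)"
        by (rule elementary_sat[OF le]) (use str[of n] Ex.prems in \<open>auto simp: is_structure_def\<close>)
      ultimately show "sat (K n) s (Ex i \<phi>)" by blast
    next
      assume "sat (K n) s (Ex i \<phi>)"
      then obtain d where d: "d \<in> univ_of (K n)" "sat (K n) (s(i := d)) \<phi>" by auto
      have "range (s(i := d)) \<subseteq> univ_of (K n)" using Ex.prems(2) d(1) by auto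
      then have "sat N (s(i := d)) \<phi>" using Ex.IH[OF wf] d(2) by blast
      then show "sat N s (Ex i \<phi>)" using d(1) by (auto simp: uN)
    qed
  qed auto
  have "is_structure L N"
  proof (rule structureI)
    show "univ_of N \<noteq> {}" using str[of 0] by (auto simp: uN is_structure_def)
    fix f ds assume f: "(f, length ds) \<in> funs L" and ds: "set ds \<subseteq> univ_of N"
    have "\<exists>n. set ds \<subseteq> univ_of (K n)" using ds
    proof (induction ds)
      case (Cons d ds)
      then obtain m n where "d \<in> univ_of (K m)" "set ds \<subseteq> univ_of (K n)" by (auto simp: uN)
      then have "set (d # ds) \<subseteq> univ_of (K (max m n))"
        using mono[of m "max m n"] mono[of n "max m n"] by auto
      then show ?case by blast
    qed simp
    then obtain n where n: "set ds \<subseteq> univ_of (K n)" by blast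
    have "fn (K n) f ds \<in> univ_of (K n)" by (rule structure_fn[OF str f n])
    then show "fn N f ds \<in> univ_of N" using fnN[OF f n] by (auto simp: uN)
  qed
  moreover have "elementary_embedding L (K n) N id" for n
    unfolding elementary_embedding_def using satN by (auto simp: uN)
  ultimately show ?thesis using uN by blast
qed

context noetherian_setting
begin

text \<open>A chain of length omega suffices for saturation over finite sets: finitely many
  parameters lie in one stage, and the next stage realises the types over it.\<close>

lemma saturated_ext_exists:
  fixes M :: "('f, 'r, 'u) struc"
  assumes M: "is_model L T M"
  shows "\<exists>N h. is_structure L N \<and> aleph0_saturated L N \<and> elementary_embedding L M N (h :: 'u \<Rightarrow> 'u)"
proof -
  let ?room = "\<lambda>K :: ('f, 'r, 'u) struc. |UNIV :: 'u set| \<le>o |UNIV - univ_of K|"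
  let ?real = "\<lambda>K K' :: ('f, 'r, 'u) struc. \<forall>X p. finite X \<longrightarrow> p \<in> types L K X (univ_of K) \<longrightarrow>
    (\<exists>c\<in>points K' X. \<forall>\<chi>\<in>p. c \<in> sols K' X \<chi>)"
  \<comment> \<open>\<open>M\<close> may exhaust \<open>'u\<close>, so it is first moved into a part
    whose complement is as large as \<open>'u\<close>.\<close>
  obtain R1 R2 where R: "R1 \<inter> R2 = {}" "|UNIV :: 'u set| \<le>o |R1 :: 'u set|" "|UNIV :: 'u set| \<le>o |R2 :: 'u set|"
    using split_room[OF infinite_universe, of UNIV] card_of_mono1[OF subset_refl] by blast
  obtain h :: "'u \<Rightarrow> 'u" where h: "inj h" "range h \<subseteq> R1"
    using card_le_inj[OF card_le_self[of UNIV] R(2)] by blast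
  have "R2 \<subseteq> UNIV - h ` univ_of M" using R(1) h(2) by blast
  then have "|UNIV :: 'u set| \<le>o |UNIV - h ` univ_of M|"
    by (rule ordLeq_transitive[OF R(3) card_of_mono1])
  then obtain K0 :: "('f, 'r, 'u) struc" where
    K0: "is_structure L K0" "elementary_embedding L M K0 h" "?room K0"
    using elementary_step[OF M _, of h] inj_on_subset[OF h(1) subset_UNIV] by blast
  let ?P = "\<lambda>n K. (n = (0 :: nat) \<longrightarrow> K = K0) \<and> is_model L T K \<and> ?room K"
  let ?Q = "\<lambda>K K'. elementary_embedding L K K' id \<and> ?real K K'"
  have "\<exists>K. \<forall>n. ?P n (K n) \<and> ?Q (K n) (K (Suc n))"
  proof (rule dependent_nat_choice)
    show "\<exists>K. ?P 0 K" using K0 elementary_model[OF K0(2) M K0(1) theory_T] by blast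
    fix K n assume K: "?P n K"
    have "|UNIV :: 'u set| \<le>o |UNIV - id ` univ_of K|" using K by simp
    then obtain K' :: "('f, 'r, 'u) struc" where K': "is_structure L K'" "elementary_embedding L K K' id" "?room K'"
      "\<forall>X p. finite X \<longrightarrow> p \<in> types L K X (univ_of K) \<longrightarrow> (\<exists>c\<in>points K' X. \<forall>\<chi>\<in>p. c \<in> sols K' X (map_params id \<chi>))"
      using elementary_step[of K id] K by auto
    then have "is_model L T K'" using elementary_model[OF K'(2) _ K'(1) theory_T] K by blast
    then show "\<exists>K'. ?P (Suc n) K' \<and> ?Q K K'" using K' by (intro exI[of _ K']) simp
  qed
  then obtain K where K: "\<forall>n. ?P n (K n) \<and> ?Q (K n) (K (Suc n))" ..
  have K_0: "K 0 = K0" using K by blast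
  have Km: "is_model L T (K n)" for n using K by blast
  then have Ks: "is_structure L (K n)" for n by (simp add: is_model_def)
  have Ke: "elementary_embedding L (K n) (K (Suc n)) id" for n using K by blast
  have Kr: "?real (K n) (K (Suc n))" for n using K by blast
  obtain N where N: "is_structure L N" "univ_of N = (\<Union>n. univ_of (K n))"
    "\<And>n. elementary_embedding L (K n) N id" using chain_union[of L K, OF Ks Ke] by blast
  have mono: "univ_of (K m) \<subseteq> univ_of (K n)" if "m \<le> n" for m n
    using that by (rule lift_Suc_mono_le[rotated]) (use Ke in \<open>auto simp: elementary_embedding_def\<close>)
  have "aleph0_saturated L N" unfolding aleph0_saturated_def
  proof (intro allI impI ballI)
    fix X A p assume XA: "finite X \<and> finite A \<and> A \<subseteq> univ_of N" and p: "p \<in> types L N X A"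
    then have X: "finite X" by blast
    have "\<exists>n. A \<subseteq> univ_of (K n)"
    proof -
      have "finite A" "A \<subseteq> univ_of N" using XA by auto
      then show ?thesis
      proof (induction A rule: finite_induct)
        case (insert a A)
        then obtain m n where "a \<in> univ_of (K m)" "A \<subseteq> univ_of (K n)" by (auto simp: N(2))
        then have "insert a A \<subseteq> univ_of (K (max m n))"
          using mono[of m "max m n"] mono[of n "max m n"] by auto
        then show ?case by blast
      qed simp
    qed
    then obtain n where n: "A \<subseteq> univ_of (K n)" by blast
    have ne: "univ_of (K n) \<noteq> {}" using Ks[of n] by (simp add: is_structure_def)
    \<comment> \<open>A stage realises complete types over the whole previous stage, while
      \<open>p\<close> is a type over \<open>A\<close> only. An ultrafilter on the points of
      \<open>K n\<close> extends \<open>p\<close> to such a type.\<close>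
    have "fip (sols (K n) X ` p)" unfolding fip_def
    proof (intro allI impI)
      fix \<F> assume F: "\<F> \<subseteq> sols (K n) X ` p" "finite \<F>"
      obtain \<Gamma> where \<Gamma>: "\<Gamma> \<subseteq> p" "finite \<Gamma>" "\<F> = sols (K n) X ` \<Gamma>" using finite_subset_image[OF F(2,1)] by blast
      have "\<Gamma> \<subseteq> pforms L X A" using \<Gamma>(1) types_sub[OF p] by blast
      from pconj_finite[OF X \<Gamma>(2) this] obtain \<chi> where \<chi>: "\<chi> \<in> pforms L X A"
        "\<forall>(K :: ('f, 'r, 'u) struc) h. sols K X (map_params h \<chi>) = {c \<in> points K X. \<forall>\<chi>'\<in>\<Gamma>. c \<in> sols K X (map_params h \<chi>')}" ..
      have sols: "sols K' X \<chi> = {c \<in> points K' X. \<forall>\<chi>'\<in>\<Gamma>. c \<in> sols K' X \<chi>'}" for K' :: "('f, 'r, 'u) struc"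
        using \<chi>(2)[rule_format, of K' id] by simp
      have "sols N X \<chi> \<noteq> {}" using types_fin[OF p \<Gamma>(2,1)] unfolding sols by blast
      moreover have "\<chi> \<in> pforms L X (univ_of (K n))" using \<chi>(1) pforms_mono[OF n] by blast
      ultimately have "sols (K n) X \<chi> \<noteq> {}" using elementary_sols_empty[OF N(3) ne X] by simp
      then show "\<Inter>\<F> \<noteq> {}" unfolding sols \<Gamma>(3) by blast
    qed
    then obtain U where U: "ultrafilter U" "sols (K n) X ` p \<subseteq> U" using ultrafilter_exists by blast
    have "sols (K n) X (Tru, undefined) \<in> U" using U(2) types_Tru[OF p] by blast
    then have pU: "points (K n) X \<in> U" by (simp only: sols_Tru)
    let ?q = "{\<chi> \<in> pforms L X (univ_of (K n)). sols (K n) X \<chi> \<in> U}"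
    have "?q \<in> types L (K n) X (univ_of (K n))" by (rule ultrafilter_type[OF U(1) pU])
    then obtain c where c: "c \<in> points (K (Suc n)) X" "\<forall>\<chi>\<in>?q. c \<in> sols (K (Suc n)) X \<chi>"
      using Kr X by blast
    show "\<exists>c\<in>points N X. \<forall>\<chi>\<in>p. c \<in> sols N X \<chi>"
    proof (intro bexI[of _ c] ballI)
      show cN: "c \<in> points N X" using c(1) N(2) by (auto simp: points_def)
      fix \<chi> assume \<chi>: "\<chi> \<in> p"
      obtain \<theta> a where eq: "\<chi> = (\<theta>, a)" by fastforce
      have pf: "\<chi> \<in> pforms L X A" using types_sub[OF p \<chi>] .
      then have "\<chi> \<in> ?q" using \<chi> U(2) pforms_mono[OF n] by blast
      then have "sat (K (Suc n)) (override_on a c X) \<theta>" using c(2) by (auto simp: eq mem_sols)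
      moreover have "sat (K (Suc n)) (override_on a c X) \<theta> = sat N (id \<circ> override_on a c X) \<theta>"
      proof (rule elementary_sat[OF N(3)])
        show "univ_of (K (Suc n)) \<noteq> {}" using Ks[of "Suc n"] by (simp add: is_structure_def)
        show "wf_fm L \<theta>" using pf by (simp add: eq mem_pforms)
        have "a v \<in> univ_of (K (Suc n))" if "v \<in> fv \<theta> - X" for v
          using pf that n mono[of n "Suc n"] unfolding eq mem_pforms by fastforce
        then show "override_on a c X ` fv \<theta> \<subseteq> univ_of (K (Suc n))"
          using c(1) by (auto simp: override_on_def points_def)
      qed
      ultimately show "c \<in> sols N X \<chi>" using cN by (simp add: eq mem_sols)
    qed
  qed
  moreover have "elementary_embedding L M N (id \<circ> h)"
    using elementary_comp[OF _ N(3)[of 0]] K0(2) K_0 by simp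
  ultimately show ?thesis using N(1) by blast
qed

lemma saturated_ext_props:
  fixes M :: "('f, 'r, 'u) struc"
  assumes M: "is_model L T M" and N: "saturated_ext L M = (N, h)"
  shows "is_model L T N" "aleph0_saturated L N" "elementary_embedding L M N h"
proof -
  have "\<exists>x :: ('f, 'r, 'u) struc \<times> ('u \<Rightarrow> 'u). case x of (N, h) \<Rightarrow>
      is_structure L N \<and> aleph0_saturated L N \<and> elementary_embedding L M N h"
    using saturated_ext_exists[OF M] by auto
  from someI_ex[OF this] have *: "is_structure L N \<and> aleph0_saturated L N \<and> elementary_embedding L M N h"
    using N unfolding saturated_ext_def by simp
  then show "aleph0_saturated L N" "elementary_embedding L M N h" by blast+
  show "is_model L T N" using elementary_model[OF _ M _ theory_T] * by blast
qed

end

section \<open>Back and forth between saturated structures\<close>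

lemma partial_elementary_inj:
  assumes f: "partial_elementary L M N A f"
  shows "inj_on f A"
proof (rule inj_onI)
  fix x y assume xy: "x \<in> A" "y \<in> A" "f x = f y"
  let ?s = "\<lambda>i :: nat. if i = 0 then x else y"
  have "sat M ?s (Eq (Var 0) (Var 1)) = sat N (f \<circ> ?s) (Eq (Var 0) (Var 1))"
    by (rule partial_elementary_sat[OF f]) (use xy in auto)
  then show "x = y" using xy(3) by simp
qed

lemma partial_elementary_inverse:
  assumes f: "partial_elementary L M N A f"
  shows "partial_elementary L N M (f ` A) (inv_into A f)"
  unfolding partial_elementary_def
proof (intro conjI allI impI)
  show "f ` A \<subseteq> univ_of N" using f by (simp add: partial_elementary_def)
  show "inv_into A f ` f ` A \<subseteq> univ_of M"
    using f inv_into_into[of _ f A] unfolding partial_elementary_def by blast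
  fix \<phi> s assume *: "wf_fm L \<phi>" "s ` fv \<phi> \<subseteq> f ` A"
  have "sat M (inv_into A f \<circ> s) \<phi> = sat N (f \<circ> (inv_into A f \<circ> s)) \<phi>"
    by (rule partial_elementary_sat[OF f *(1)]) (use *(2) inv_into_into[of _ f A] in auto)
  also have "\<dots> = sat N s \<phi>"
    by (rule sat_cong) (use *(2) f_inv_into_f[of _ f A] in auto)
  finally show "sat N s \<phi> = sat M (inv_into A f \<circ> s) \<phi>" by simp
qed

lemma partial_elementary_subset: "partial_elementary L M N A f \<Longrightarrow> A' \<subseteq> A \<Longrightarrow> partial_elementary L M N A' f"
  unfolding partial_elementary_def by (meson image_mono order_trans)

text \<open>The type of \<open>b\<close> over \<open>A\<close>, with parameters transported by
  \<open>f\<close>, is finitely satisfiable in \<open>N\<close>. A point that realises it is a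
  possible value at \<open>b\<close>.\<close>

lemma partial_elementary_extend1:
  fixes M N :: "('f, 'r, 'u) struc"
  assumes sat_N: "aleph0_saturated L N" and A: "finite A" and f: "partial_elementary L M N A f" and b: "b \<in> univ_of M"
  shows "\<exists>f'. (\<forall>x\<in>A. f' x = f x) \<and> partial_elementary L M N (insert b A) f'"
proof (cases "b \<in> A")
  case True
  then show ?thesis using f by (intro exI[of _ f]) (simp add: insert_absorb)
next
  case False
  define g where "g = inv_into A f"
  have fg: "f (g y) = y" "g y \<in> A" if "y \<in> f ` A" for y
    using that f_inv_into_f inv_into_into unfolding g_def by metis+
  have gf: "g (f x) = x" if "x \<in> A" for x
    using that partial_elementary_inj[OF f] by (simp add: g_def)
  \<comment> \<open>The transported type: \<open>g\<close> pulls the parameters back to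
    \<open>A\<close>, and the variable 0 stands for \<open>b\<close>.\<close>
  define p where "p = {\<chi> \<in> pforms L {0} (f ` A). sat M ((g \<circ> snd \<chi>)(0 := b)) (fst \<chi>)}"
  have "p \<in> types L N {0} (f ` A)"
  proof (rule typesI)
    show "p \<subseteq> pforms L {0} (f ` A)" by (auto simp: p_def)
    show "(\<theta>, a) \<in> p \<or> (Neg \<theta>, a) \<in> p" if "(\<theta>, a) \<in> pforms L {0} (f ` A)" for \<theta> a
      using that by (auto simp: p_def mem_pforms)
    fix \<Gamma> assume \<Gamma>: "\<Gamma> \<subseteq> p" "finite \<Gamma>"
    have "\<Gamma> \<subseteq> pforms L {0} (f ` A)" using \<Gamma>(1) by (auto simp: p_def)
    from pconj_finite[OF _ \<Gamma>(2) this] obtain \<chi> where \<chi>: "\<chi> \<in> pforms L {0} (f ` A)"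
      "\<forall>(K :: ('f, 'r, 'u) struc) h. sols K {0} (map_params h \<chi>) = {c \<in> points K {0}. \<forall>\<chi>'\<in>\<Gamma>. c \<in> sols K {0} (map_params h \<chi>')}"
      by auto
    define c0 where "c0 = restrict (\<lambda>_ :: nat. b) {0}"
    have c0: "c0 \<in> points M {0}" using b by (auto simp: c0_def points_def)
    have ov: "override_on s c0 {0} = s(0 := b)" for s by (auto simp: override_on_def c0_def)
    have "c0 \<in> sols M {0} (map_params g \<chi>')" if "\<chi>' \<in> \<Gamma>" for \<chi>'
      using that \<Gamma>(1) c0 by (auto simp: map_params_def mem_sols ov p_def)
    then have "c0 \<in> sols M {0} (map_params g \<chi>)" using \<chi>(2) c0 by simp
    then have ne: "sols M {0} (map_params g \<chi>) \<noteq> {}" by blast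
    have "map_params g \<chi> \<in> pforms L {0} A" using \<chi>(1) fg(2) by (cases \<chi>) (auto simp: mem_pforms)
    from partial_elementary_sols_empty[OF f _ this] ne have "sols N {0} (map_params f (map_params g \<chi>)) \<noteq> {}" by simp
    moreover have "sols N {0} (map_params f (map_params g \<chi>)) = sols N {0} \<chi>"
    proof (cases \<chi>)
      case (Pair \<theta> a)
      show ?thesis unfolding Pair map_params_simp
        by (rule sols_cong) (use \<chi>(1) fg(1) Pair in \<open>auto simp: mem_pforms\<close>)
    qed
    moreover have "sols N {0} \<chi> = {c \<in> points N {0}. \<forall>\<chi>'\<in>\<Gamma>. c \<in> sols N {0} \<chi>'}"
      using \<chi>(2)[rule_format, of N id] by simp
    ultimately show "\<exists>c\<in>points N {0}. \<forall>\<chi>\<in>\<Gamma>. c \<in> sols N {0} \<chi>" by auto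
  qed
  moreover have "finite (f ` A)" "f ` A \<subseteq> univ_of N" using A f by (auto simp: partial_elementary_def)
  ultimately obtain c where c: "c \<in> points N {0}" "\<forall>\<chi>\<in>p. c \<in> sols N {0} \<chi>"
    using sat_N unfolding aleph0_saturated_def by (metis finite.emptyI finite.insertI)
  define f' where "f' = f(b := c 0)"
  have f'A: "f' x = f x" if "x \<in> A" for x using that False by (auto simp: f'_def)
  have f'b: "f' b = c 0" by (simp add: f'_def)
  have c0: "c 0 \<in> univ_of N" using c(1) by (auto simp: points_def)
  text \<open>Variables other than 0 that are assigned \<open>b\<close> are quantified away one by one, so that only
    formulae in which \<open>b\<close> is the value of the variable 0 have to be considered.\<close>
  have core: "sat M s \<phi> = sat N (f' \<circ> s) \<phi>"
    if "wf_fm L \<phi>" "s ` fv \<phi> \<subseteq> insert b A" "0 \<in> fv \<phi> \<longrightarrow> s 0 = b" for \<phi> s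
    using that
  proof (induction "card {v \<in> fv \<phi>. v \<noteq> 0 \<and> s v = b}" arbitrary: \<phi> s)
    case 0
    then have none: "\<And>v. v \<in> fv \<phi> \<Longrightarrow> v \<noteq> 0 \<Longrightarrow> s v \<in> A"
      using finite_fv[of \<phi>] by auto
    have main: "sat N (f' \<circ> s) \<psi>" if sat: "sat M s \<psi>" and \<psi>: "wf_fm L \<psi>" "fv \<psi> = fv \<phi>" for \<psi>
    proof -
      have pf: "(\<psi>, f \<circ> s) \<in> pforms L {0} (f ` A)" using \<psi> none by (auto simp: mem_pforms)
      have "sat M ((g \<circ> (f \<circ> s))(0 := b)) \<psi> = sat M s \<psi>"
        by (rule sat_cong) (use none gf 0 \<psi>(2) in auto)
      then have "(\<psi>, f \<circ> s) \<in> p" using pf sat by (simp add: p_def)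
      then have "sat N (override_on (f \<circ> s) c {0}) \<psi>" using c(2) by (auto simp: mem_sols)
      moreover have "sat N (override_on (f \<circ> s) c {0}) \<psi> = sat N (f' \<circ> s) \<psi>"
        by (rule sat_cong) (use none f'A f'b 0 \<psi>(2) in \<open>auto simp: override_on_def\<close>)
      ultimately show ?thesis by simp
    qed
    show ?case using main[of \<phi>] main[of "Neg \<phi>"] 0(2) by (auto simp: comp_def)
  next
    case (Suc n)
    then have "{v \<in> fv \<phi>. v \<noteq> 0 \<and> s v = b} \<noteq> {}" by (metis card.empty nat.distinct(1))
    then obtain v where v: "v \<in> fv \<phi>" "v \<noteq> 0" "s v = b" by blast
    let ?\<psi> = "Ex v (Conj (Eq (Var v) (Var 0)) \<phi>)"
    let ?s = "s(0 := b)"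
    have fv\<psi>: "fv ?\<psi> = insert 0 (fv \<phi> - {v})" using v by auto
    have "{w \<in> fv ?\<psi>. w \<noteq> 0 \<and> ?s w = b} = {w \<in> fv \<phi>. w \<noteq> 0 \<and> s w = b} - {v}"
      unfolding fv\<psi> by auto
    then have "n = card {w \<in> fv ?\<psi>. w \<noteq> 0 \<and> ?s w = b}"
      using Suc.hyps(2) v by (simp add: card_Diff_singleton)
    moreover have "?s ` fv ?\<psi> \<subseteq> insert b A" unfolding fv\<psi> using Suc.prems(2) by auto
    ultimately have IH: "sat M ?s ?\<psi> = sat N (f' \<circ> ?s) ?\<psi>"
      using Suc.hyps(1)[of ?\<psi> ?s] Suc.prems(1) by auto
    have "sat M ?s ?\<psi> \<longleftrightarrow> sat M (?s(v := b)) \<phi>" using v b by auto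
    also have "sat M (?s(v := b)) \<phi> = sat M s \<phi>" by (rule sat_cong) (use v Suc.prems(3) in auto)
    finally have 1: "sat M ?s ?\<psi> = sat M s \<phi>" .
    have "sat N (f' \<circ> ?s) ?\<psi> \<longleftrightarrow> sat N ((f' \<circ> ?s)(v := f' b)) \<phi>" using v c0 f'b by auto
    also have "sat N ((f' \<circ> ?s)(v := f' b)) \<phi> = sat N (f' \<circ> s) \<phi>"
      by (rule sat_cong) (use v Suc.prems(3) in auto)
    finally show ?case using IH 1 by simp
  qed
  have "partial_elementary L M N (insert b A) f'" unfolding partial_elementary_def
  proof (intro conjI allI impI)
    show "insert b A \<subseteq> univ_of M" using f b by (simp add: partial_elementary_def)
    show "f' ` insert b A \<subseteq> univ_of N" using f f'A f'b c0 by (auto simp: partial_elementary_def)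
    fix \<phi> s assume *: "wf_fm L \<phi>" "s ` fv \<phi> \<subseteq> insert b A"
    \<comment> \<open>Moving the free variables away from 0 makes the condition on the variable 0 in
      \<open>core\<close> vacuous.\<close>
    obtain \<sigma> :: "nat \<Rightarrow> nat" where \<sigma>: "bij \<sigma>" "\<sigma> ` fv \<phi> \<inter> {0} = {}"
      using renaming_exists[of "{}" "fv \<phi>" "{0}"] finite_fv[of \<phi>] by auto
    have inj: "inj \<sigma>" using \<sigma>(1) by (rule bij_is_inj)
    define t where "t = s \<circ> inv \<sigma>"
    have t: "t (\<sigma> i) = s i" for i by (simp add: t_def inv_f_f[OF inj])
    have "sat M t (rename \<sigma> \<phi>) = sat N (f' \<circ> t) (rename \<sigma> \<phi>)"
      by (rule core) (use * t \<sigma>(2) in \<open>auto simp: wf_rename fv_rename[OF inj]\<close>)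
    then show "sat M s \<phi> = sat N (f' \<circ> s) \<phi>" unfolding sat_rename[OF inj] comp_apply t by (simp add: comp_def)
  qed
  then show ?thesis using f'A by blast
qed

lemma partial_elementary_extend:
  fixes M N :: "('f, 'r, 'u) struc"
  assumes sat_N: "aleph0_saturated L N" and "finite S" "S \<subseteq> univ_of M" "finite A" "partial_elementary L M N A f"
  shows "\<exists>f'. (\<forall>x\<in>A. f' x = f x) \<and> partial_elementary L M N (S \<union> A) f'"
  using assms(2,3)
proof (induction S rule: finite_induct)
  case empty
  then show ?case using assms(5) by auto
next
  case (insert b S)
  then obtain f' where f': "\<forall>x\<in>A. f' x = f x" "partial_elementary L M N (S \<union> A) f'" by auto
  have "finite (S \<union> A)" "b \<in> univ_of M" using insert assms(4) by auto
  from partial_elementary_extend1[OF sat_N this(1) f'(2) this(2)] obtain f'' where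
    "\<forall>x\<in>S \<union> A. f'' x = f' x" "partial_elementary L M N (insert b (S \<union> A)) f''" by blast
  then show ?case using f'(1) by (intro exI[of _ f'']) auto
qed

lemma map_params_sols_cong:
  assumes "\<chi> \<in> pforms L X A" "\<And>x. x \<in> A \<Longrightarrow> f' x = f x"
  shows "sols N X (map_params f' \<chi>) = sols N X (map_params f \<chi>)"
proof (cases \<chi>)
  case (Pair \<theta> a)
  show ?thesis unfolding Pair map_params_simp by (rule sols_cong) (use assms Pair in \<open>auto simp: mem_pforms\<close>)
qed

text \<open>The pieces at a successor level have infinitely many parameters altogether, more than
  one application of saturation can handle. The finite map is extended along them one piece at a
  time, and disjointness of two pieces is checked at a stage that covers both. Only \<open>N\<close>
  has to be saturated.\<close>

lemma morley_ge_partial_elementary: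
  fixes M N :: "('f, 'r, 'u) struc"
  assumes sat_N: "aleph0_saturated L N" and X: "finite X"
  shows "morley_ge L M X \<alpha> \<chi> \<Longrightarrow> finite A \<Longrightarrow> partial_elementary L M N A f \<Longrightarrow> \<chi> \<in> pforms L X A \<Longrightarrow>
    morley_ge L N X \<alpha> (map_params f \<chi>)"
proof (induction arbitrary: A f rule: morley_ge.induct)
  case (zero \<chi>)
  then show ?case using partial_elementary_sols_empty[OF zero.prems(2) X] by (intro morley_ge.zero) simp
next
  case (succ \<psi> \<chi> \<alpha>)
  define P where "P i = snd (\<psi> i) ` (fv (fst (\<psi> i)) - X)" for i
  have P: "finite (P i)" "P i \<subseteq> univ_of M" "\<psi> i \<in> pforms L X S \<longleftrightarrow> P i \<subseteq> S" for i S
    using succ.hyps(1)[of i] finite_fv by (auto simp: P_def pforms_def split: prod.splits)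
  \<comment> \<open>A stage is a finite domain together with a map on it; stage \<open>n\<close>
    covers the parameters of the first \<open>n\<close> pieces.\<close>
  let ?P = "\<lambda>n x. finite (fst x) \<and> partial_elementary L M N (fst x) (snd x) \<and> A \<subseteq> fst x \<and>
    (\<forall>y\<in>A. snd x y = f y) \<and> (\<forall>i<n. P i \<subseteq> fst x)"
  let ?Q = "\<lambda>x x'. fst x \<subseteq> fst x' \<and> (\<forall>y\<in>fst x. snd x' y = snd x y)"
  have "\<exists>e :: nat \<Rightarrow> 'u set \<times> ('u \<Rightarrow> 'u). \<forall>n. ?P n (e n) \<and> ?Q (e n) (e (Suc n))"
  proof (rule dependent_nat_choice)
    show "\<exists>x. ?P 0 x" using succ.prems by (intro exI[of _ "(A, f)"]) simp
    fix x n assume x: "?P n x"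
    then have "finite (fst x)" "partial_elementary L M N (fst x) (snd x)" by auto
    from partial_elementary_extend[OF sat_N P(1)[of n] P(2)[of n] this]
    obtain f' where "\<forall>y\<in>fst x. f' y = snd x y" "partial_elementary L M N (P n \<union> fst x) f'" by blast
    then show "\<exists>x'. ?P (Suc n) x' \<and> ?Q x x'"
      using x P(1) by (intro exI[of _ "(P n \<union> fst x, f')"]) (auto simp: less_Suc_eq)
  qed
  then obtain e where e: "\<forall>n. ?P n (e n) \<and> ?Q (e n) (e (Suc n))" ..
  define D where "D n = fst (e n)" for n
  define j where "j n = snd (e n)" for n
  have D: "finite (D n)" "partial_elementary L M N (D n) (j n)" "A \<subseteq> D n" "\<And>y. y \<in> A \<Longrightarrow> j n y = f y"
    "\<And>i. i < n \<Longrightarrow> P i \<subseteq> D n" for n using e unfolding D_def j_def by blast+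
  have step: "D n \<subseteq> D (Suc n) \<and> (\<forall>y\<in>D n. j (Suc n) y = j n y)" for n using e unfolding D_def j_def by blast
  have agree: "D m \<subseteq> D n \<and> (\<forall>y\<in>D m. j n y = j m y)" if "m \<le> n" for m n
    using that
  proof (induction n rule: dec_induct)
    case (step n)
    then show ?case using \<open>\<And>n. D n \<subseteq> D (Suc n) \<and> (\<forall>y\<in>D n. j (Suc n) y = j n y)\<close>[of n] by (metis subset_iff)
  qed simp
  \<comment> \<open>Each piece is transported by a map already defined on its parameters; later maps
    agree with it there.\<close>
  let ?\<psi> = "\<lambda>i. map_params (j (Suc i)) (\<psi> i)"
  have pf: "\<psi> i \<in> pforms L X (D n)" if "i < n" for i n using P(3) D(5)[OF that] by blast
  have same: "sols N X (?\<psi> i) = sols N X (map_params (j n) (\<psi> i))" if "i < n" for i n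
    using map_params_sols_cong[OF pf[of i "Suc i"], of "j n" "j (Suc i)" N] agree[of "Suc i" n] that by auto
  show ?case
  proof (rule morley_ge.succ[of ?\<psi>])
    fix i
    show "?\<psi> i \<in> pforms L X (univ_of N)"
      using pf[of i "Suc i"] D(2)[of "Suc i"] by (cases "\<psi> i") (auto simp: mem_pforms partial_elementary_def)
    have \<chi>D: "\<chi> \<in> pforms L X (D (Suc i))" using succ.prems(3) pforms_mono[OF D(3)] by blast
    have "sols N X (?\<psi> i) \<subseteq> sols N X (map_params (j (Suc i)) \<chi>)"
      using partial_elementary_sols_subset[OF D(2) X pf[of i "Suc i"] \<chi>D] succ.hyps(2)[of i] by blast
    also have "sols N X (map_params (j (Suc i)) \<chi>) = sols N X (map_params f \<chi>)"
      by (rule map_params_sols_cong[OF succ.prems(3)]) (rule D(4))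
    finally show "sols N X (?\<psi> i) \<subseteq> sols N X (map_params f \<chi>)" .
    show "morley_ge L N X \<alpha> (?\<psi> i)" by (rule succ.IH[OF D(1) D(2) pf]) simp
  next
    fix i i' :: nat assume ne: "i \<noteq> i'"
    let ?n = "Suc (max i i')"
    have l: "i < ?n" "i' < ?n" by auto
    show "sols N X (?\<psi> i) \<inter> sols N X (?\<psi> i') = {}"
      unfolding same[OF l(1)] same[OF l(2)]
      using partial_elementary_disjoint[OF D(2)[of ?n] X pf[OF l(1)] pf[OF l(2)]] succ.hyps(3)[OF ne] by blast
  qed
next
  case (limit \<alpha> \<chi>)
  show ?case by (rule morley_ge.limit[OF limit.hyps(1)]) (rule limit.IH[OF _ limit.prems])
qed

text \<open>A formula has finitely many parameters, on which \<open>h\<close> restricts to a finite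
  partial elementary map. One direction uses this map and the saturation of \<open>N\<close>, the
  other its inverse and the saturation of \<open>M\<close>.\<close>

lemma morley_ge_elementary:
  fixes M N :: "('f, 'r, 'u) struc"
  assumes M: "aleph0_saturated L M" "model_of_noetherian L T F M X"
    and N: "aleph0_saturated L N" and h: "elementary_embedding L M N h" and \<chi>: "\<chi> \<in> pforms L X (univ_of M)"
  shows "morley_ge L N X \<alpha> (map_params h \<chi>) \<longleftrightarrow> morley_ge L M X \<alpha> \<chi>"
proof -
  interpret M: model_of_noetherian L T F M X by (rule M(2))
  obtain \<theta> a where eq: "\<chi> = (\<theta>, a)" by fastforce
  define A where "A = a ` (fv \<theta> - X)"
  have A: "finite A" "A \<subseteq> univ_of M" "\<chi> \<in> pforms L X A"
    using \<chi> by (auto simp: eq A_def mem_pforms finite_fv)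
  have pe: "partial_elementary L M N A h" by (rule partial_elementary_subset[OF elementary_partial_elementary[OF h M.univ_nonempty] A(2)])
  show ?thesis
  proof
    assume "morley_ge L N X \<alpha> (map_params h \<chi>)"
    then have "morley_ge L M X \<alpha> (map_params (inv_into A h) (map_params h \<chi>))"
    proof (rule morley_ge_partial_elementary[OF M(1) M.finX _ _ partial_elementary_inverse[OF pe]])
      show "finite (h ` A)" using A(1) by simp
      show "map_params h \<chi> \<in> pforms L X (h ` A)" using A(3) by (auto simp: eq mem_pforms)
    qed
    moreover have "sols M X (map_params (inv_into A h) (map_params h \<chi>)) = sols M X \<chi>"
      unfolding eq map_params_simp
      by (rule sols_cong) (use partial_elementary_inj[OF pe] in \<open>simp add: A_def\<close>)
    ultimately show "morley_ge L M X \<alpha> \<chi>" by (simp add: M.morley_ge_iff)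
  qed (rule morley_ge_partial_elementary[OF N M.finX _ A(1) pe A(3)])
qed

section \<open>The equivalences\<close>

context model_of_noetherian
begin

text \<open>The type of a generic point of \<open>V\<close>. Finitely many of its formulae fail
  together only on a small subset of \<open>V\<close>, which cannot be all of
  \<open>V\<close>.\<close>

lemma generic_type:
  assumes V: "irreducible V"
  shows "{\<chi> \<in> pforms L X (univ_of N). \<not> small V (sols N X \<chi>)} \<in> types L N X (univ_of N)"
proof (rule typesI)
  fix \<Gamma> assume \<Gamma>: "\<Gamma> \<subseteq> {\<chi> \<in> pforms L X (univ_of N). \<not> small V (sols N X \<chi>)}" "finite \<Gamma>"
  have one: "small V (points N X - sols N X \<chi>)" if "\<chi> \<in> \<Gamma>" for \<chi>
    using small_dichotomy[OF V sols_constructible[of \<chi>]] \<Gamma>(1) that by blast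
  have "small V (\<Union>\<chi>\<in>\<Gamma>. points N X - sols N X \<chi>)"
    using \<Gamma>(2) one
  proof (induction \<Gamma> rule: finite_induct)
    case empty
    then show ?case using small_empty[OF V] by simp
  next
    case (insert \<chi> \<Gamma>)
    then have "small V ((points N X - sols N X \<chi>) \<union> (\<Union>\<chi>\<in>\<Gamma>. points N X - sols N X \<chi>))"
      by (intro small_union[OF V]) auto
    then show ?case by simp
  qed
  then have "\<not> V \<subseteq> (\<Union>\<chi>\<in>\<Gamma>. points N X - sols N X \<chi>)" using not_small_self by blast
  moreover have "V \<subseteq> points N X" by (rule closed_sub[OF irreducible_closed[OF V]])
  ultimately show "\<exists>c\<in>points N X. \<forall>\<chi>\<in>\<Gamma>. c \<in> sols N X \<chi>" by blast
next
  fix \<theta> a assume *: "(\<theta>, a) \<in> pforms L X (univ_of N)"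
  then have "(Neg \<theta>, a) \<in> pforms L X (univ_of N)" by (simp add: mem_pforms)
  moreover have "\<not> small V (sols N X (\<theta>, a)) \<or> \<not> small V (sols N X (Neg \<theta>, a))"
    using not_both_small[OF V, of "sols N X (\<theta>, a)"] sols_pneg[of N X "(\<theta>, a)"] by auto
  ultimately show "(\<theta>, a) \<in> {\<chi> \<in> pforms L X (univ_of N). \<not> small V (sols N X \<chi>)} \<or>
      (Neg \<theta>, a) \<in> {\<chi> \<in> pforms L X (univ_of N). \<not> small V (sols N X \<chi>)}" using * by blast
qed auto

lemma sols_boundary:
  assumes "(\<theta>, a) \<in> pforms L X (univ_of N)"
  shows "sols N X (Conj (closure_formula L F N X \<theta> a) (Neg \<theta>), a) = cl (sols N X (\<theta>, a)) - sols N X (\<theta>, a)"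
  unfolding closure_formula_props(3)[OF assms, symmetric] by (auto simp: mem_sols)

text \<open>The closure formula reuses the parameters of \<open>\<theta>\<close>, so closure and
  boundary remain available in types over a small set \<open>A\<close>.\<close>

lemma boundary_pform:
  assumes "(\<theta>, a) \<in> pforms L X A" "A \<subseteq> univ_of N"
  shows "(closure_formula L F N X \<theta> a, a) \<in> pforms L X A"
    "(Conj (closure_formula L F N X \<theta> a) (Neg \<theta>), a) \<in> pforms L X A"
proof -
  have "(\<theta>, a) \<in> pforms L X (univ_of N)" using assms pforms_mono by blast
  from closure_formula_props(1,2)[OF this] assms(1)
  show "(closure_formula L F N X \<theta> a, a) \<in> pforms L X A"
    "(Conj (closure_formula L F N X \<theta> a) (Neg \<theta>), a) \<in> pforms L X A"
    by (auto simp: mem_pforms)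
qed

end

context noetherian_setting
begin

abbreviation defsets :: "('f, 'r, 'u) struc \<Rightarrow> nat set \<Rightarrow> (nat \<Rightarrow> 'u) set set" where
  "defsets N X \<equiv> constructible (points N X) (instances F N X)"

section \<open>Morley rank of formulae and types over a model\<close>

lemma RM_eq:
  fixes M :: "('f, 'r, 'u) struc"
  assumes M: "is_model L T M" "finite X" and N: "saturated_ext L M = (N, h)"
  shows "RM L M X \<chi> = mrank (defsets N X) (sols N X (map_params h \<chi>))"
proof -
  interpret N: model_of_noetherian L T F N X
    by (rule model_locale[OF saturated_ext_props(1)[OF M(1) N] M(2)])
  show ?thesis by (cases \<chi>) (simp add: RM_def N N.rank_of_morley)
qed

text \<open>The covering in \<open>M\<close> is a first-order statement and passes to the saturated
  extension, where the rank of a union is known. The disjunction is written with \<open>pneg\<close>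
  and \<open>pconj\<close>, whose behaviour under transport is available.\<close>

lemma RM_union:
  fixes M :: "('f, 'r, 'u) struc"
  assumes M: "is_model L T M" "finite X"
    and \<chi>: "\<chi> \<in> pforms L X (univ_of M)" "\<chi>1 \<in> pforms L X (univ_of M)" "\<chi>2 \<in> pforms L X (univ_of M)"
    and sub: "sols M X \<chi> \<subseteq> sols M X \<chi>1 \<union> sols M X \<chi>2"
  shows "RM L M X \<chi> \<le> max (RM L M X \<chi>1) (RM L M X \<chi>2)"
proof -
  obtain N h where N: "saturated_ext L M = (N, h)" by fastforce
  note ext = saturated_ext_props[OF M(1) N]
  interpret M: model_of_noetherian L T F M X by (rule model_locale[OF M])
  interpret N: model_of_noetherian L T F N X by (rule model_locale[OF ext(1) M(2)])
  let ?\<delta> = "pneg (pconj X (pneg \<chi>1) (pneg \<chi>2))"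
  have \<delta>: "?\<delta> \<in> pforms L X (univ_of M)" using \<chi>(2,3) by (simp add: pneg_pforms pconj_pforms[OF M(2)])
  have sols_\<delta>: "sols K X (map_params k ?\<delta>) = sols K X (map_params k \<chi>1) \<union> sols K X (map_params k \<chi>2)" for K :: "('f, 'r, 'u) struc" and k
    unfolding map_params_pneg sols_pneg sols_map_params_pconj[OF M(2)]
    using sols_sub[of K X "map_params k \<chi>1"] sols_sub[of K X "map_params k \<chi>2"] by auto
  have "sols M X \<chi> \<subseteq> sols M X ?\<delta>" using sub sols_\<delta>[of M id] by simp
  then have subN: "sols N X (map_params h \<chi>) \<subseteq> sols N X (map_params h \<chi>1) \<union> sols N X (map_params h \<chi>2)"
    using elementary_sols_subset[OF ext(3) M.univ_nonempty M(2) \<chi>(1) \<delta>] sols_\<delta>[of N h] by simp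
  have B: "sols N X (map_params h \<chi>1) \<in> N.B" "sols N X (map_params h \<chi>2) \<in> N.B"
    by (rule N.sols_constructible[OF map_params_pforms[OF ext(3)]], rule \<chi>)+
  show ?thesis unfolding RM_eq[OF M N]
  proof (rule extended_leI[OF infinite_universe])
    fix \<alpha> :: "'u ordinal" assume "Fin \<alpha> \<le> mrank N.B (sols N X (map_params h \<chi>))"
    then have "mge N.B \<alpha> (sols N X (map_params h \<chi>))" by (simp only: Fin_le_mrank[OF infinite_universe])
    then have "mge N.B \<alpha> (sols N X (map_params h \<chi>1) \<union> sols N X (map_params h \<chi>2))" using subN by (rule mge_mono)
    then have "mge N.B \<alpha> (sols N X (map_params h \<chi>1)) \<or> mge N.B \<alpha> (sols N X (map_params h \<chi>2))"
      by (rule N.mge_union_B[OF infinite_universe B])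
    then show "Fin \<alpha> \<le> max (mrank N.B (sols N X (map_params h \<chi>1))) (mrank N.B (sols N X (map_params h \<chi>2)))"
      by (simp only: le_max_iff_disj Fin_le_mrank[OF infinite_universe])
  qed
qed

lemma RM_mono:
  fixes M :: "('f, 'r, 'u) struc"
  assumes "is_model L T M" "finite X" "\<chi> \<in> pforms L X (univ_of M)" "\<chi>' \<in> pforms L X (univ_of M)"
    "sols M X \<chi> \<subseteq> sols M X \<chi>'"
  shows "RM L M X \<chi> \<le> RM L M X \<chi>'"
  using RM_union[OF assms(1-4,4)] assms(5) by simp

lemma RM_nonempty:
  fixes M :: "('f, 'r, 'u) struc"
  assumes M: "is_model L T M" "finite X" and \<chi>: "\<chi> \<in> pforms L X (univ_of M)"
  shows "Fin 0 \<le> RM L M X \<chi> \<longleftrightarrow> sols M X \<chi> \<noteq> {}"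
proof -
  obtain N h where N: "saturated_ext L M = (N, h)" by fastforce
  note ext = saturated_ext_props[OF M(1) N]
  interpret M: model_of_noetherian L T F M X by (rule model_locale[OF M])
  have "Fin 0 \<le> RM L M X \<chi> \<longleftrightarrow> sols N X (map_params h \<chi>) \<noteq> {}"
    unfolding RM_eq[OF M N] Fin_le_mrank[OF infinite_universe] using mge_0[OF infinite_universe] mge.zero by blast
  then show ?thesis using elementary_sols_empty[OF ext(3) M.univ_nonempty M(2) \<chi>] by simp
qed

lemma RM_type_props:
  fixes M :: "('f, 'r, 'u) struc"
  assumes p: "p \<in> types L M X A"
  shows "\<exists>\<mu>\<in>p. RM_type L M X p = RM L M X \<mu>" "\<chi> \<in> p \<Longrightarrow> RM_type L M X p \<le> RM L M X \<chi>"
proof -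
  have "RM L M X (Tru, undefined) \<in> RM L M X ` p" using types_Tru[OF p] by blast
  then obtain m where m: "m \<in> RM L M X ` p" "\<forall>x\<in>RM L M X ` p. m \<le> x" using extended_has_minimum by blast
  have "RM_type L M X p = m" unfolding RM_type_def
    by (rule Least_equality) (use m in blast)+
  then show "\<exists>\<mu>\<in>p. RM_type L M X p = RM L M X \<mu>" "\<chi> \<in> p \<Longrightarrow> RM_type L M X p \<le> RM L M X \<chi>"
    using m by auto
qed

definition boundary_cond :: bool where
  "boundary_cond \<longleftrightarrow> (\<forall>(M :: ('f, 'r, 'u) struc) X \<theta> a.
     is_model L T M \<and> finite X \<and> (\<theta>, a) \<in> pforms L X (univ_of M) \<and> sols M X (\<theta>, a) \<noteq> {} \<longrightarrow>
     RM L M X (Conj (closure_formula L F M X \<theta> a) (Neg \<theta>), a) < RM L M X (\<theta>, a))"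

definition rank_cond :: bool where
  "rank_cond \<longleftrightarrow> (\<forall>(M :: ('f, 'r, 'u) struc) X \<theta> a.
     is_model L T M \<and> finite X \<and> (\<theta>, a) \<in> pforms L X (univ_of M) \<longrightarrow>
     RM L M X (\<theta>, a) = R_F L F M X (\<theta>, a))"

text \<open>The least closed set of a type isolates it: a second type of at least the same rank that
  contains this set would contain the boundary of a formula of minimal rank in the first type.\<close>

lemma boundary_imp_isolation:
  assumes c: boundary_cond
  shows "noetherian_isolation TYPE('u) L T F"
  unfolding noetherian_isolation_def
proof (intro allI impI)
  fix M :: "('f, 'r, 'u) struc" and X A p
  assume *: "is_model L T M \<and> finite X \<and> A \<subseteq> univ_of M \<and> p \<in> types L M X A"
  then have M: "is_model L T M" "finite X" and A: "A \<subseteq> univ_of M" and p: "p \<in> types L M X A" by auto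
  interpret M: model_of_noetherian L T F M X by (rule model_locale[OF M])
  note AM = subsetD[OF pforms_mono[OF A]]
  have "\<exists>\<chi>\<in>p. sols M X \<chi> = points M X" using types_Tru[OF p, of undefined] sols_Tru[of M X] by blast
  \<comment> \<open>Minimality is among the closed sets defined by formulae of \<open>p\<close>,
    hence over \<open>A\<close>, although the instances that make up \<open>V\<close> may need other
    parameters.\<close>
  then obtain V where V: "M.closed V" "\<exists>\<chi>\<in>p. sols M X \<chi> = V"
    "\<And>Z. M.closed Z \<Longrightarrow> \<exists>\<chi>\<in>p. sols M X \<chi> = Z \<Longrightarrow> Z \<subseteq> V \<Longrightarrow> Z = V"
    using M.closed_minimal[OF M.closed_top, of "\<lambda>Z. \<exists>\<chi>\<in>p. sols M X \<chi> = Z"] by blast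
  then obtain v where v: "v \<in> p" "sols M X v = V" by blast
  show "\<exists>\<chi>\<in>p. closed_formula F M X \<chi> \<and>
      (\<forall>q\<in>types L M X A. RM_type L M X p \<le> RM_type L M X q \<and> \<chi> \<in> q \<longrightarrow> q = p)"
  proof (intro bexI[of _ v] conjI ballI impI)
    show "closed_formula F M X v" using V(1) v(2) by (simp add: closed_formula_def)
    show "v \<in> p" by (rule v(1))
    fix q assume q: "q \<in> types L M X A" and le: "RM_type L M X p \<le> RM_type L M X q \<and> v \<in> q"
    show "q = p"
    proof (rule ccontr)
      assume "q \<noteq> p"
      then obtain \<chi>0 where \<chi>0: "\<chi>0 \<in> p" "\<chi>0 \<notin> q" using types_eqI[OF p q] by blast
      obtain \<mu> where \<mu>: "\<mu> \<in> p" "RM_type L M X p = RM L M X \<mu>" using RM_type_props(1)[OF p] by blast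
      \<comment> \<open>\<open>\<theta>\<close> combines a formula that separates \<open>p\<close>
        from \<open>q\<close>, the formula of \<open>V\<close>, and a formula \<open>\<mu>\<close>
        of least rank in \<open>p\<close>.\<close>
      obtain \<theta> a where \<theta>: "pconj X (pconj X \<chi>0 v) \<mu> = (\<theta>, a)" by fastforce
      have \<theta>p: "(\<theta>, a) \<in> p"
        unfolding \<theta>[symmetric] by (intro types_conj[OF M(2) p] \<chi>0(1) v(1) \<mu>(1))
      have S: "sols M X (\<theta>, a) = sols M X \<chi>0 \<inter> V \<inter> sols M X \<mu>"
        unfolding \<theta>[symmetric] sols_pconj[OF M(2)] v(2) ..
      note pf = types_sub[OF p \<theta>p] note pfM = AM[OF pf]
      note c = M.closure_props[OF sols_sub[of M X "(\<theta>, a)"]]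
      have "(closure_formula L F M X \<theta> a, a) \<in> p"
        by (rule types_up[OF p \<theta>p M.boundary_pform(1)[OF pf A]])
          (use c(2) M.closure_formula_props(3)[OF pfM] in simp)
      then have "\<exists>\<chi>\<in>p. sols M X \<chi> = M.cl (sols M X (\<theta>, a))"
        using M.closure_formula_props(3)[OF pfM] by blast
      moreover have "M.cl (sols M X (\<theta>, a)) \<subseteq> V" by (rule c(3)[OF V(1)]) (use S in blast)
      \<comment> \<open>The closure of \<open>\<theta>\<close> is defined over \<open>A\<close> and
        belongs to \<open>p\<close>, so it cannot be smaller than \<open>V\<close>.\<close>
      ultimately have clV: "M.cl (sols M X (\<theta>, a)) = V" using V(3)[OF c(1)] by blast
      let ?\<delta> = "(Conj (closure_formula L F M X \<theta> a) (Neg \<theta>), a)"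
      have neg: "pneg \<chi>0 \<in> q" using types_neg[OF q types_sub[OF p \<chi>0(1)]] \<chi>0(2) by simp
      have vq: "v \<in> q" using le by blast
      \<comment> \<open>\<open>q\<close> contains \<open>V\<close> and omits \<open>\<chi>0\<close>,
        while the solutions of \<open>\<theta>\<close> satisfy \<open>\<chi>0\<close>; so
        \<open>q\<close> contains the boundary.\<close>
      have "?\<delta> \<in> q"
      proof (rule types_up[OF q types_conj[OF M(2) q vq neg] M.boundary_pform(2)[OF pf A]])
        show "sols M X (pconj X v (pneg \<chi>0)) \<subseteq> sols M X ?\<delta>"
          unfolding sols_pconj[OF M(2)] sols_pneg M.sols_boundary[OF pfM] clV v(2) using S by blast
      qed
      then have "RM_type L M X q \<le> RM L M X ?\<delta>" by (rule RM_type_props(2)[OF q])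
      also have "\<dots> < RM L M X (\<theta>, a)"
        using assms[unfolded boundary_cond_def, rule_format, of M X \<theta> a] M pfM types_nonempty[OF p \<theta>p] by blast
      also have "\<dots> \<le> RM L M X \<mu>"
        by (rule RM_mono[OF M pfM AM[OF types_sub[OF p \<mu>(1)]]]) (use S in blast)
      also have "\<dots> = RM_type L M X p" using \<mu>(2) by simp
      finally show False using leD[OF conjunct1[OF le]] by blast
    qed
  qed
qed

text \<open>If the boundary of \<open>\<theta>\<close> had large rank, a minimal closed set \<open>V\<close> that witnesses this would lie
  properly in a component \<open>W\<close> of the closure of \<open>\<theta>\<close>, and no closed formula of the generic type of
  \<open>W\<close> could separate it from the generic type of \<open>V\<close>.\<close>

lemma isolation_imp_boundary:
  assumes iso: "noetherian_isolation TYPE('u) L T F"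
  shows boundary_cond
  unfolding boundary_cond_def
proof (intro allI impI)
  fix M :: "('f, 'r, 'u) struc" and X \<theta> a
  assume *: "is_model L T M \<and> finite X \<and> (\<theta>, a) \<in> pforms L X (univ_of M) \<and> sols M X (\<theta>, a) \<noteq> {}"
  then have M: "is_model L T M" "finite X" and pf: "(\<theta>, a) \<in> pforms L X (univ_of M)"
    and ne: "sols M X (\<theta>, a) \<noteq> {}" by auto
  interpret M: model_of_noetherian L T F M X by (rule model_locale[OF M])
  let ?\<delta> = "(Conj (closure_formula L F M X \<theta> a) (Neg \<theta>), a)"
  let ?S = "sols M X (\<theta>, a)"
  note c = M.closure_props[OF sols_sub[of M X "(\<theta>, a)"]]
  have \<delta>: "?\<delta> \<in> pforms L X (univ_of M)" by (rule M.boundary_pform(2)[OF pf subset_refl])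
  have D: "sols M X ?\<delta> = M.cl ?S - ?S" by (rule M.sols_boundary[OF pf])
  define D where "D = M.cl ?S - ?S"
  have DB: "D \<in> M.B" unfolding D_def by (rule M.constructible_diff[OF M.closed_constructible[OF c(1)] M.sols_constructible[OF pf]])
  \<comment> \<open>A defining formula for each constructible set, so that \<open>RM\<close> can be
    evaluated on sets.\<close>
  define fm where "fm S = (SOME \<chi>. \<chi> \<in> pforms L X (univ_of M) \<and> sols M X \<chi> = S)" for S
  have fm: "fm S \<in> pforms L X (univ_of M)" "sols M X (fm S) = S" if "S \<in> M.B" for S
  proof -
    have "\<exists>\<chi>. \<chi> \<in> pforms L X (univ_of M) \<and> sols M X \<chi> = S" using M.constructible_sols[OF that] by blast
    from someI_ex[OF this] show "fm S \<in> pforms L X (univ_of M)" "sols M X (fm S) = S" by (auto simp: fm_def)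
  qed
  define \<beta> where "\<beta> = RM L M X (\<theta>, a)"
  have \<beta>0: "Fin 0 \<le> \<beta>" unfolding \<beta>_def using RM_nonempty[OF M pf] ne by simp
  show "RM L M X ?\<delta> < RM L M X (\<theta>, a)"
  proof (rule ccontr)
    assume "\<not> ?thesis"
    then have big: "\<beta> \<le> RM L M X ?\<delta>" by (simp add: \<beta>_def)
    have clB: "M.closed Z \<Longrightarrow> Z \<inter> D \<in> M.B" for Z using constructible.inter[OF M.closed_constructible DB] .
    let ?Q = "\<lambda>Z. \<beta> \<le> RM L M X (fm (Z \<inter> D))"
    have "M.cl ?S \<inter> D = D" unfolding D_def by blast
    then have "sols M X ?\<delta> \<subseteq> sols M X (fm (M.cl ?S \<inter> D))" using fm(2)[OF DB] D by (simp add: D_def)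
    then have "RM L M X ?\<delta> \<le> RM L M X (fm (M.cl ?S \<inter> D))" by (rule RM_mono[OF M \<delta> fm(1)[OF clB[OF c(1)]]])
    then have "?Q (M.cl ?S)" using big by (rule order_trans[rotated])
    then have "?Q (M.cl ?S) \<and> M.cl ?S \<subseteq> M.cl ?S" by simp
    then obtain V where V: "M.closed V" "?Q V \<and> V \<subseteq> M.cl ?S"
      "\<And>Z. M.closed Z \<Longrightarrow> ?Q Z \<and> Z \<subseteq> M.cl ?S \<Longrightarrow> Z \<subseteq> V \<Longrightarrow> Z = V"
      using M.closed_minimal[OF c(1), of "\<lambda>Z. ?Q Z \<and> Z \<subseteq> M.cl ?S"] by blast
    have less: "RM L M X (fm (Z \<inter> D)) < \<beta>" if "M.closed Z" "Z \<subset> V" for Z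
    proof (rule ccontr)
      assume "\<not> ?thesis"
      then have "?Q Z \<and> Z \<subseteq> M.cl ?S" using that(2) V(2) by auto
      then show False using V(3)[OF that(1)] that(2) by blast
    qed
    \<comment> \<open>If \<open>V\<close> were a union of two proper closed subsets, the trace of
      one of them on the boundary would already have rank at least \<open>\<beta>\<close>.\<close>
    have irr: "M.irreducible V" unfolding irreducible_closed_def
    proof (intro conjI ballI impI)
      show "M.closed V" by (rule V(1))
      have "Fin 0 \<le> RM L M X (fm (V \<inter> D))" by (rule order_trans[OF \<beta>0 conjunct1[OF V(2)]])
      then have "V \<inter> D \<noteq> {}" using RM_nonempty[OF M fm(1)[OF clB[OF V(1)]]] fm(2)[OF clB[OF V(1)]] by simp
      then show "V \<noteq> {}" by blast
      fix A A' assume A: "M.closed A" "M.closed A'" "V = A \<union> A'"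
      have "RM L M X (fm (V \<inter> D)) \<le> max (RM L M X (fm (A \<inter> D))) (RM L M X (fm (A' \<inter> D)))"
        by (rule RM_union[OF M fm(1) fm(1) fm(1)])
          (simp_all only: clB V(1) A(1,2) fm(2), use A(3) in blast)
      from order_trans[OF conjunct1[OF V(2)] this]
      have "\<beta> \<le> RM L M X (fm (A \<inter> D)) \<or> \<beta> \<le> RM L M X (fm (A' \<inter> D))"
        by (simp only: le_max_iff_disj)
      then have "\<not> A \<subset> V \<or> \<not> A' \<subset> V" using less[OF A(1)] less[OF A(2)] leD by blast
      then show "V = A \<or> V = A'" using A(3) by blast
    qed
    let ?q = "{\<chi> \<in> pforms L X (univ_of M). \<not> M.small V (sols M X \<chi>)}"
    have q: "?q \<in> types L M X (univ_of M)" by (rule M.generic_type[OF irr])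
    \<comment> \<open>A formula of the generic type covers the trace of \<open>V\<close> on the
      boundary except for a part in a proper closed subset, whose rank is below
      \<open>\<beta>\<close>.\<close>
    have "\<beta> \<le> RM L M X \<psi>" if \<psi>: "\<psi> \<in> ?q" for \<psi>
    proof -
      have \<psi>pf: "\<psi> \<in> pforms L X (univ_of M)" using \<psi> by blast
      have "M.small V (points M X - sols M X \<psi>)"
        using M.small_dichotomy[OF irr M.sols_constructible[OF \<psi>pf]] \<psi> by blast
      then obtain W where W: "M.closed W" "W \<subset> V" "(points M X - sols M X \<psi>) \<inter> V \<subseteq> W"
        unfolding M.small_def by blast
      have "RM L M X (fm (V \<inter> D)) \<le> max (RM L M X (fm (W \<inter> D))) (RM L M X \<psi>)"
      proof (rule RM_union[OF M fm(1)[OF clB[OF V(1)]] fm(1)[OF clB[OF W(1)]] \<psi>pf])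
        show "sols M X (fm (V \<inter> D)) \<subseteq> sols M X (fm (W \<inter> D)) \<union> sols M X \<psi>"
          unfolding fm(2)[OF clB[OF V(1)]] fm(2)[OF clB[OF W(1)]]
          using W(3) M.closed_sub[OF V(1)] by blast
      qed
      from order_trans[OF conjunct1[OF V(2)] this]
      have "\<beta> \<le> RM L M X (fm (W \<inter> D)) \<or> \<beta> \<le> RM L M X \<psi>" by (simp only: le_max_iff_disj)
      then show ?thesis using less[OF W(1,2)] leD by blast
    qed
    then have qb: "\<beta> \<le> RM_type L M X ?q" using RM_type_props(1)[OF q] by auto
    have \<delta>q: "?\<delta> \<in> ?q"
    proof (intro CollectI conjI \<delta> notI)
      assume "M.small V (sols M X ?\<delta>)"
      then obtain W where W: "M.closed W" "W \<subset> V" "D \<inter> V \<subseteq> W" unfolding M.small_def D D_def by blast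
      have "RM L M X (fm (V \<inter> D)) \<le> RM L M X (fm (W \<inter> D))"
        by (rule RM_mono[OF M fm(1)[OF clB[OF V(1)]] fm(1)[OF clB[OF W(1)]]])
          (unfold fm(2)[OF clB[OF V(1)]] fm(2)[OF clB[OF W(1)]], use W(3) in blast)
      from order_trans[OF conjunct1[OF V(2)] this] show False using less[OF W(1,2)] leD by blast
    qed
    obtain W where W: "W \<in> irr_components (instances F M X) (M.cl ?S)" "V \<subseteq> W"
      using M.irr_components_props(2)[OF c(1) irr] V(2) by blast
    have irrW: "M.irreducible W" "W \<subseteq> M.cl ?S" using W(1) M.irr_component_props by blast+
    let ?p = "{\<chi> \<in> pforms L X (univ_of M). \<not> M.small W (sols M X \<chi>)}"
    have p: "?p \<in> types L M X (univ_of M)" by (rule M.generic_type[OF irrW(1)])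
    have \<theta>p: "(\<theta>, a) \<in> ?p"
      using pf M.component_not_small[OF sols_sub W(1) c(2) irrW(2)] by blast
    have "RM_type L M X ?p \<le> \<beta>" unfolding \<beta>_def by (rule RM_type_props(2)[OF p \<theta>p])
    then have le: "RM_type L M X ?p \<le> RM_type L M X ?q" using qb by (rule order_trans)
    have "\<exists>\<chi>\<in>?p. closed_formula F M X \<chi> \<and>
        (\<forall>q\<in>types L M X (univ_of M). RM_type L M X ?p \<le> RM_type L M X q \<and> \<chi> \<in> q \<longrightarrow> q = ?p)"
      using iso[unfolded noetherian_isolation_def, rule_format, of M X "univ_of M" ?p] M p by blast
    then obtain \<chi> where \<chi>: "\<chi> \<in> ?p" "closed_formula F M X \<chi>"
      "\<forall>q\<in>types L M X (univ_of M). RM_type L M X ?p \<le> RM_type L M X q \<and> \<chi> \<in> q \<longrightarrow> q = ?p" by (elim bexE conjE)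
    \<comment> \<open>A closed set that is dense in \<open>W\<close> contains \<open>W\<close>,
      hence \<open>V\<close>; thus the isolating formula also lies in the generic type of
      \<open>V\<close>.\<close>
    have "W \<subseteq> sols M X \<chi>"
    proof (rule ccontr)
      assume "\<not> W \<subseteq> sols M X \<chi>"
      then have "M.closed (sols M X \<chi> \<inter> W) \<and> sols M X \<chi> \<inter> W \<subset> W"
        using \<chi>(2) M.closed_inter M.irreducible_closed[OF irrW(1)] unfolding closed_formula_def by blast
      then have "M.small W (sols M X \<chi>)" unfolding M.small_def by blast
      then show False using \<chi>(1) by blast
    qed
    then have "\<chi> \<in> ?q" using W(2) \<chi>(1) M.not_small_self[of V "sols M X \<chi>"] by blast
    then have "?q = ?p" using \<chi>(3) q le by blast
    \<comment> \<open>The generic type of \<open>V\<close> would now contain both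
      \<open>\<theta>\<close> and its boundary.\<close>
    then have "(\<theta>, a) \<in> ?q" using \<theta>p by blast
    then obtain x where "x \<in> sols M X (\<theta>, a)" "x \<in> sols M X ?\<delta>"
      using types_fin[OF q, of "{(\<theta>, a), ?\<delta>}"] \<delta>q by blast
    then show False unfolding D by blast
  qed
qed

lemma R_F_eq: "saturated_ext L M = (N, h) \<Longrightarrow> R_F L F M X \<chi> = rank_C (instances F N X) (sols N X (map_params h \<chi>))"
  by (cases \<chi>) (simp add: R_F_def)

text \<open>By (b) both sides of (c) are foundation ranks in \<open>N\<close>. Once the boundary
  formula is known to define the boundary in \<open>N\<close>, the topological inequality
  applies.\<close>

lemma rank_imp_boundary:
  assumes b: rank_cond
  shows boundary_cond
  unfolding boundary_cond_def
proof (intro allI impI)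
  fix M :: "('f, 'r, 'u) struc" and X \<theta> a
  assume *: "is_model L T M \<and> finite X \<and> (\<theta>, a) \<in> pforms L X (univ_of M) \<and> sols M X (\<theta>, a) \<noteq> {}"
  then have M: "is_model L T M" "finite X" and pf: "(\<theta>, a) \<in> pforms L X (univ_of M)"
    and ne: "sols M X (\<theta>, a) \<noteq> {}" by auto
  obtain N h where N: "saturated_ext L M = (N, h)" by fastforce
  note ext = saturated_ext_props[OF M(1) N]
  interpret M: model_of_noetherian L T F M X by (rule model_locale[OF M])
  interpret N: model_of_noetherian L T F N X by (rule model_locale[OF ext(1) M(2)])
  let ?c = "closure_formula L F M X \<theta> a"
  let ?S = "sols N X (\<theta>, h \<circ> a)"
  have \<delta>: "(Conj ?c (Neg \<theta>), a) \<in> pforms L X (univ_of M)" by (rule M.boundary_pform(2)[OF pf subset_refl])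
  have clN: "sols N X (?c, h \<circ> a) = N.cl ?S"
    by (rule closure_transfer[OF M.model_of_noetherian_axioms N.model_of_noetherian_axioms ext(3) pf
          M.closure_formula_props[OF pf]])
  have D: "sols N X (Conj ?c (Neg \<theta>), h \<circ> a) = N.cl ?S - ?S"
    unfolding clN[symmetric] by (auto simp: mem_sols)
  have neN: "?S \<noteq> {}" using elementary_sols_empty[OF ext(3) M.univ_nonempty M(2) pf] ne by simp
  have B: "?S \<in> N.B" using N.sols_constructible[OF map_params_pforms[OF ext(3) pf]] by simp
  have card: "|closed_sets (instances F N X)| \<le>o |UNIV :: 'u set|"
    using card_closed[OF ext(1) M(2)] unfolding card_le_def .
  have "RM L M X (Conj ?c (Neg \<theta>), a) = rank_C (instances F N X) (N.cl ?S - ?S)"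
    using b M \<delta> unfolding rank_cond_def by (simp add: R_F_eq[OF N] D)
  also have "\<dots> < rank_C (instances F N X) ?S" by (rule N.rank_C_boundary[OF infinite_universe card B neN])
  also have "\<dots> = RM L M X (\<theta>, a)"
    using b M pf unfolding rank_cond_def by (simp add: R_F_eq[OF N])
  finally show "RM L M X (Conj ?c (Neg \<theta>), a) < RM L M X (\<theta>, a)" .
qed

text \<open>(c) is used for the saturated extension \<open>N\<close>, not for \<open>M\<close>: the
  comparison of ranks needs the inequality for all definable sets of \<open>N\<close>, also for
  those with parameters outside the image of \<open>M\<close>.\<close>

lemma boundary_imp_rank:
  assumes c: boundary_cond
  shows rank_cond
  unfolding rank_cond_def
proof (intro allI impI)
  fix M :: "('f, 'r, 'u) struc" and X \<theta> a
  assume *: "is_model L T M \<and> finite X \<and> (\<theta>, a) \<in> pforms L X (univ_of M)"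
  then have M: "is_model L T M" "finite X" and pf: "(\<theta>, a) \<in> pforms L X (univ_of M)" by auto
  obtain N h where N: "saturated_ext L M = (N, h)" by fastforce
  note ext = saturated_ext_props[OF M(1) N]
  obtain N' h' where N': "saturated_ext L N = (N', h')" by fastforce
  note ext' = saturated_ext_props[OF ext(1) N']
  interpret N: model_of_noetherian L T F N X by (rule model_locale[OF ext(1) M(2)])
  \<comment> \<open>By definition this rank is computed in \<open>N'\<close>. As \<open>N\<close>
    and \<open>N'\<close> are both saturated, it agrees with the rank computed in
    \<open>N\<close>.\<close>
  have RM_N: "RM L N X \<chi> = mrank N.B (sols N X \<chi>)" if "\<chi> \<in> pforms L X (univ_of N)" for \<chi>
  proof -
    have "RM L N X \<chi> = rank_of (\<lambda>\<alpha>. morley_ge L N' X \<alpha> (map_params h' \<chi>))"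
      by (cases \<chi>) (simp add: RM_def N')
    also have "\<dots> = rank_of (\<lambda>\<alpha>. morley_ge L N X \<alpha> \<chi>)"
      unfolding morley_ge_elementary[OF ext(2) N.model_of_noetherian_axioms ext'(2,3) that] ..
    finally show ?thesis by (simp only: N.rank_of_morley)
  qed
  have boundary: "mrank N.B (N.cl S - S) < (mrank N.B S :: 'u ordinal extended)" if S: "S \<in> N.B" "S \<noteq> {}" for S
  proof -
    obtain \<theta> a where \<theta>: "(\<theta>, a) \<in> pforms L X (univ_of N)" "S = sols N X (\<theta>, a)"
      using N.constructible_sols[OF S(1)] by auto
    have "RM L N X (Conj (closure_formula L F N X \<theta> a) (Neg \<theta>), a) < RM L N X (\<theta>, a)"
      using c[unfolded boundary_cond_def, rule_format, of N X \<theta> a] ext(1) M(2) \<theta> S(2) by blast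
    then show ?thesis
      unfolding RM_N[OF \<theta>(1)] RM_N[OF N.boundary_pform(2)[OF \<theta>(1) subset_refl]] N.sols_boundary[OF \<theta>(1)] \<theta>(2) .
  qed
  have B: "sols N X (map_params h (\<theta>, a)) \<in> N.B" by (rule N.sols_constructible[OF map_params_pforms[OF ext(3) pf]])
  show "RM L M X (\<theta>, a) = R_F L F M X (\<theta>, a)"
    unfolding RM_eq[OF M N] R_F_eq[OF N] by (rule N.mrank_eq_rank_C[OF infinite_universe boundary B])
qed

end

theorem theorem2p32:
  fixes L :: "('f, 'r) lang"
    and T :: "('f, 'r) fm set"
    and F :: "('f, 'r) partfm set"
  assumes universe_large: "|{\<phi>. wf_fm L \<phi>}| \<le>o |UNIV :: 'u set|"
    and theory_T: "is_theory L T"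
    and collection_F: "formula_collection L F"
    and noetherian_T: "noetherian_theory TYPE('u) L T F"
  shows "(noetherian_isolation TYPE('u) L T F \<longleftrightarrow>
            (\<forall>(M :: ('f, 'r, 'u) struc) X \<theta> a.
               is_model L T M \<and> finite X \<and> (\<theta>, a) \<in> pforms L X (univ_of M) \<longrightarrow>
               RM L M X (\<theta>, a) = R_F L F M X (\<theta>, a)))
       \<and> (noetherian_isolation TYPE('u) L T F \<longleftrightarrow>
            (\<forall>(M :: ('f, 'r, 'u) struc) X \<theta> a.
               is_model L T M \<and> finite X \<and> (\<theta>, a) \<in> pforms L X (univ_of M) \<and> sols M X (\<theta>, a) \<noteq> {} \<longrightarrow>
               RM L M X (Conj (closure_formula L F M X \<theta> a) (Neg \<theta>), a) < RM L M X (\<theta>, a)))"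
proof -
  interpret noetherian_setting L T F "TYPE('u)"
    by unfold_locales (rule assms)+
  have "noetherian_isolation TYPE('u) L T F \<longleftrightarrow> rank_cond"
    using isolation_imp_boundary boundary_imp_rank rank_imp_boundary boundary_imp_isolation by blast
  moreover have "noetherian_isolation TYPE('u) L T F \<longleftrightarrow> boundary_cond"
    using isolation_imp_boundary boundary_imp_isolation by blast
  ultimately show ?thesis unfolding rank_cond_def boundary_cond_def by (intro conjI)
qed

end
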